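(* Let $b$ be a graph over $(X,m)$ and let $d$ be an intrinsic pseudo metric on $X$ such that all distance balls $B_r=\{y\in X\mid d(o,y)\le r\}$, $r\ge 0$, are finite. If $$\int_{1}^{\infty}\frac{r}{\log^\sharp(m(B_{r}))}\,dr=\infty,$$ where $\log^\sharp=\max\{\log,1\}$, then the graph $b$ over $(X,m)$ is stochastically complete.
   Context: $X$ is a countable discrete set with a fixed reference vertex $o\in X$, and $m:X\to(0,\infty)$ is extended to a measure on all subsets of $X$ by additivity. A graph over $(X,m)$ is a symmetric map $b:X\times X\to[0,\infty)$ with $b(x,x)=0$ and $\sum_{y\in X}b(x,y)<\infty$ for all $x\in X$ (no local finiteness is assumed). A pseudo metric $d$ on $X$ is intrinsic (for $b$ over $(X,m)$) if $\sum_{y\in X}b(x,y)d(x,y)^2\le m(x)$ for all $x\in X$. Stochastic completeness: let $C_c(X)$ be the finitely supported real functions on $X$ and $Q(f)=\frac12\sum_{x,y\in X}b(x,y)(f(x)-f(y))^2$, with domain $D(Q)$ the closure of $C_c(X)$ with respect to the norm $\|f\|_Q=\sqrt{Q(f)+\|f\|_2^2}$. This is a regular Dirichlet form on $\ell^2(X,m)$; let $L\ge 0$ be the associated self-adjoint operator. The Markovian semigroup $e^{-tL}$, $t>0$, extends in the usual way to $\ell^p(X,m)$, $p\in[1,\infty]$ (for $0\le f\in\ell^\infty$, $e^{-tL}f$ is the monotone limit of $e^{-tL}f_n$ for $0\le f_n\in\ell^2(X,m)$ increasing pointwise to $f$). The graph $b$ over $(X,m)$ is stochastically complete if $e^{-tL}1=1$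 for some (equivalently, all) $t>0$, where $1$ is the constant function. *)

theory Defs
  imports "HOL-Analysis.Analysis"
begin

section \<open>Weighted graphs and intrinsic pseudo metrics\<close>

text \<open>The discrete set \<open>X\<close> is the universe of a type \<open>'a\<close> of class \<open>countable\<close>, finite or infinite.\<close>

definition weighted_graph :: "('a \<Rightarrow> 'a \<Rightarrow> real) \<Rightarrow> bool" where
  "weighted_graph b \<longleftrightarrow>
     (\<forall>x y. 0 \<le> b x y) \<and> (\<forall>x y. b x y = b y x) \<and> (\<forall>x. b x x = 0) \<and>
     (\<forall>x. (\<lambda>y. b x y) summable_on UNIV)"

definition pseudo_metric :: "('a \<Rightarrow> 'a \<Rightarrow> real) \<Rightarrow> bool" where
  "pseudo_metric d \<longleftrightarrow>
     (\<forall>x y. 0 \<le> d x y) \<and> (\<forall>x. d x x = 0) \<and> (\<forall>x y. d x y = d y x) \<and>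
     (\<forall>x y z. d x z \<le> d x y + d y z)"

definition intrinsic :: "('a \<Rightarrow> 'a \<Rightarrow> real) \<Rightarrow> ('a \<Rightarrow> real) \<Rightarrow> ('a \<Rightarrow> 'a \<Rightarrow> real) \<Rightarrow> bool" where
  "intrinsic b m d \<longleftrightarrow>
     (\<forall>x. (\<lambda>y. b x y * (d x y)\<^sup>2) summable_on UNIV \<and>
          (\<Sum>\<^sub>\<infinity>y. b x y * (d x y)\<^sup>2) \<le> m x)"

definition dist_ball :: "('a \<Rightarrow> 'a \<Rightarrow> real) \<Rightarrow> 'a \<Rightarrow> real \<Rightarrow> 'a set" where
  "dist_ball d p r = {y. d p y \<le> r}"

definition mass_of :: "('a \<Rightarrow> real) \<Rightarrow> 'a set \<Rightarrow> real" where
  "mass_of m A = measure (point_measure UNIV (\<lambda>x. ennreal (m x))) A"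

definition log_sharp :: "real \<Rightarrow> real" where
  "log_sharp x = max (ln x) 1"


section \<open>The Dirichlet form and its operator\<close>

definition ell2 :: "('a \<Rightarrow> real) \<Rightarrow> ('a \<Rightarrow> real) set" where
  "ell2 m = {f. (\<lambda>x. m x * (f x)\<^sup>2) summable_on UNIV}"

definition ell2_inner :: "('a \<Rightarrow> real) \<Rightarrow> ('a \<Rightarrow> real) \<Rightarrow> ('a \<Rightarrow> real) \<Rightarrow> real" where
  "ell2_inner m f g = (\<Sum>\<^sub>\<infinity>x. m x * f x * g x)"

definition ell2_norm :: "('a \<Rightarrow> real) \<Rightarrow> ('a \<Rightarrow> real) \<Rightarrow> real" where
  "ell2_norm m f = sqrt (ell2_inner m f f)"

definition finitely_supported :: "('a \<Rightarrow> real) set" where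
  "finitely_supported = {f. finite {x. f x \<noteq> 0}}"

definition finite_energy :: "('a \<Rightarrow> 'a \<Rightarrow> real) \<Rightarrow> ('a \<Rightarrow> real) set" where
  "finite_energy b = {f. (\<lambda>(x, y). b x y * (f x - f y)\<^sup>2) summable_on UNIV}"

definition energy_form ::
  "('a \<Rightarrow> 'a \<Rightarrow> real) \<Rightarrow> ('a \<Rightarrow> real) \<Rightarrow> ('a \<Rightarrow> real) \<Rightarrow> real" where
  "energy_form b f g = 1/2 * (\<Sum>\<^sub>\<infinity>(x, y). b x y * (f x - f y) * (g x - g y))"

definition form_norm :: "('a \<Rightarrow> 'a \<Rightarrow> real) \<Rightarrow> ('a \<Rightarrow> real) \<Rightarrow> ('a \<Rightarrow> real) \<Rightarrow> real" where
  "form_norm b m f = sqrt (energy_form b f f + (ell2_norm m f)\<^sup>2)"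

text \<open>The closure of the finitely supported functions with respect to \<^term>\<open>form_norm b m\<close>, taken
  inside the functions for which this norm is finite; \<open>infsum\<close> is \<open>0\<close> on non-summable families, so
  finiteness has to be demanded separately.\<close>

definition form_domain :: "('a \<Rightarrow> 'a \<Rightarrow> real) \<Rightarrow> ('a \<Rightarrow> real) \<Rightarrow> ('a \<Rightarrow> real) set" where
  "form_domain b m =
     {f \<in> ell2 m \<inter> finite_energy b.
        \<forall>\<epsilon>>0. \<exists>g\<in>finitely_supported. form_norm b m (\<lambda>x. f x - g x) < \<epsilon>}"

text \<open>The graph \<open>{(f, L f) | f \<in> D(L)}\<close> of the self-adjoint operator \<open>L\<close> associated with the
  form. It is single-valued because the form domain is dense in \<open>\<ell>\<^sup>2\<close>.\<close>

definition form_operator ::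
  "('a \<Rightarrow> 'a \<Rightarrow> real) \<Rightarrow> ('a \<Rightarrow> real) \<Rightarrow> (('a \<Rightarrow> real) \<times> ('a \<Rightarrow> real)) set" where
  "form_operator b m =
     {(f, g). f \<in> form_domain b m \<and> g \<in> ell2 m \<and>
              (\<forall>h\<in>form_domain b m. energy_form b f h = ell2_inner m g h)}"


section \<open>The heat semigroup and stochastic completeness\<close>

definition C0_semigroup :: "('a \<Rightarrow> real) \<Rightarrow> (real \<Rightarrow> ('a \<Rightarrow> real) \<Rightarrow> 'a \<Rightarrow> real) \<Rightarrow> bool" where
  "C0_semigroup m T \<longleftrightarrow>
     (\<forall>t\<ge>0. \<forall>f\<in>ell2 m. T t f \<in> ell2 m) \<and>
     (\<forall>t\<ge>0. \<forall>f\<in>ell2 m. \<forall>g\<in>ell2 m. \<forall>\<alpha> \<beta>.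
        T t (\<lambda>x. \<alpha> * f x + \<beta> * g x) = (\<lambda>x. \<alpha> * T t f x + \<beta> * T t g x)) \<and>
     (\<forall>t\<ge>0. \<exists>C. \<forall>f\<in>ell2 m. ell2_norm m (T t f) \<le> C * ell2_norm m f) \<and>
     (\<forall>f\<in>ell2 m. T 0 f = f) \<and>
     (\<forall>s\<ge>0. \<forall>t\<ge>0. \<forall>f\<in>ell2 m. T (s + t) f = T s (T t f)) \<and>
     (\<forall>f\<in>ell2 m. ((\<lambda>t. ell2_norm m (\<lambda>x. T t f x - f x)) \<longlongrightarrow> 0) (at_right 0))"

text \<open>The graph of the infinitesimal generator.\<close>

definition semigroup_generator ::
  "('a \<Rightarrow> real) \<Rightarrow> (real \<Rightarrow> ('a \<Rightarrow> real) \<Rightarrow> 'a \<Rightarrow> real) \<Rightarrow> (('a \<Rightarrow> real) \<times> ('a \<Rightarrow> real)) set" where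
  "semigroup_generator m T =
     {(f, g). f \<in> ell2 m \<and> g \<in> ell2 m \<and>
        ((\<lambda>t. ell2_norm m (\<lambda>x. (T t f x - f x) / t - g x)) \<longlongrightarrow> 0) (at_right 0)}"

text \<open>\<open>heat_semigroup b m t\<close> is \<open>e\<^sup>-\<^sup>t\<^sup>L\<close>, that is, the strongly continuous semigroup on \<open>\<ell>\<^sup>2\<close> with
  generator \<open>-L\<close>. A strongly continuous semigroup is determined by its generator, so the choice
  operator leaves freedom only for arguments outside \<open>\<ell>\<^sup>2\<close> and for negative times.\<close>

definition heat_semigroup ::
  "('a \<Rightarrow> 'a \<Rightarrow> real) \<Rightarrow> ('a \<Rightarrow> real) \<Rightarrow> real \<Rightarrow> ('a \<Rightarrow> real) \<Rightarrow> 'a \<Rightarrow> real" where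
  "heat_semigroup b m =
     (SOME T. C0_semigroup m T \<and>
        semigroup_generator m T = {(f, \<lambda>x. - g x) | f g. (f, g) \<in> form_operator b m})"

text \<open>The extension of the semigroup to bounded functions \<open>f \<ge> 0\<close>: the common pointwise limit of
  \<open>e\<^sup>-\<^sup>t\<^sup>L f\<^sub>n\<close> along all sequences \<open>0 \<le> f\<^sub>n \<in> \<ell>\<^sup>2\<close> increasing pointwise to \<open>f\<close>. Such sequences
  exist since the space is countable, hence the limit function is unique.\<close>

definition heat_semigroup_bounded ::
  "('a \<Rightarrow> 'a \<Rightarrow> real) \<Rightarrow> ('a \<Rightarrow> real) \<Rightarrow> real \<Rightarrow> ('a \<Rightarrow> real) \<Rightarrow> 'a \<Rightarrow> real" where
  "heat_semigroup_bounded b m t f =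
     (THE u. \<forall>F :: nat \<Rightarrow> 'a \<Rightarrow> real.
        (\<forall>n. F n \<in> ell2 m \<and> (\<forall>x. 0 \<le> F n x)) \<longrightarrow>
        (\<forall>x. incseq (\<lambda>n. F n x) \<and> (\<lambda>n. F n x) \<longlonglongrightarrow> f x) \<longrightarrow>
        (\<forall>x. (\<lambda>n. heat_semigroup b m t (F n) x) \<longlonglongrightarrow> u x))"

text \<open>Requiring \<open>e\<^sup>-\<^sup>t\<^sup>L 1 = 1\<close> for all \<open>t > 0\<close> is equivalent to requiring it for some \<open>t > 0\<close>.\<close>

definition stochastically_complete :: "('a \<Rightarrow> 'a \<Rightarrow> real) \<Rightarrow> ('a \<Rightarrow> real) \<Rightarrow> bool" where
  "stochastically_complete b m \<longleftrightarrow> (\<forall>t>0. heat_semigroup_bounded b m t (\<lambda>_. 1) = (\<lambda>_. 1))"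

end

theory Submission
  imports Defs
begin

text \<open>
  Let \<open>L\<close> be the form operator, \<open>G = (L + 1)\<^sup>-\<^sup>1\<close>, and let \<open>e\<^sub>n\<close> be the indicators of an exhaustion by
  finite sets. The functions \<open>g\<^sub>n = G e\<^sub>n\<close> increase to some \<open>w \<le> 1\<close>, and \<open>u = 1 - w\<close> satisfies
  \<open>0 \<le> u \<le> 1\<close> and \<open>\<Sum>y. b x y (u y - u x) = m x u x\<close>. The proof has two halves: the volume growth
  forces \<open>u = 0\<close> (\<open>bounded_subharmonic_zero\<close>), and \<open>w = 1\<close> forces \<open>e\<^sup>-\<^sup>t\<^sup>L 1 = 1\<close>.

  First half. Test the equation for \<open>u\<close> with \<open>\<phi>\<^sup>2 g\<close>, where \<open>\<phi>\<close> is a cutoff and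
  \<open>g = exp (u - q\<^sup>2 / (c (u - s')))\<close> on \<open>{u > s'}\<close>, \<open>g = 0\<close> elsewhere, \<open>q\<close> being the distance to a
  ball. This is the Gaussian weight used for the heat equation on manifolds with the \<^emph>\<open>value\<close> of
  \<open>u\<close> in the role of the time variable. The convexity inequality
  \<open>(q + l)\<^sup>2 / (w + h) \<le> q\<^sup>2 / w + l\<^sup>2 / h\<close> shows that along an edge of length \<open>l\<close> on which \<open>u\<close> drops by \<open>h\<close>
  the weight cannot grow by more than a factor \<open>exp (l\<^sup>2 / (c h))\<close>. Multiplied by \<open>h\<close>, this costs at
  most \<open>l\<^sup>2 / c\<close>, and \<open>\<Sum>y. b x y (d x y)\<^sup>2 \<le> m x\<close> turns it into a small multiple of the zeroth order
  term. The inequality holds for every \<open>l\<close>, so long edges are treated like short ones. The result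
  (\<open>level_set_decay\<close>) is
  \[ m(B_{R/2} \cap \{u > s'\}) \le m(B_R \cap \{u > s\}) + m(B_R) \exp(-R^2/(256(s-s'))). \]
  With \<open>R = 2\<^sup>k\<close> and \<open>s - s'\<close> of order \<open>4\<^sup>k / (log\<^sup>\<sharp> m(B\<^sub>R) + k)\<close> the last term is at most \<open>e\<^sup>-\<^sup>k\<close>.
  Start at a huge radius with \<open>s = 1\<close>, where the level set is empty, and go inwards: as the
  steps \<open>s - s'\<close> have infinite sum, the level \<open>1/2\<close> is reached before the radius \<open>2\<^sup>k\<close>, for every fixed
  \<open>k\<close>, and the total error is at most \<open>2\<^sup>-\<^sup>k\<close>. So \<open>{u > 1/2}\<close> has measure \<open>0\<close>, after scaling \<open>u\<close> so that its
  supremum is \<open>1\<close>.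

  Second half. The semigroup is specified only through its generator, so it has to be
  constructed and shown to be unique. For \<open>f \<ge> 0\<close> the resolvent \<open>(L + \<alpha>)\<^sup>-\<^sup>1 f\<close> is the limit of an
  increasing sequence of finitely supported functions, which makes positivity and the bound by
  \<open>sup f / \<alpha>\<close> visible and shows at once that the limit lies in the closure of the finitely
  supported functions. The theorem of Hille and Yosida produces a semigroup from the resolvents, and
  its approximants are Poisson averages of powers of \<open>n (L + n)\<^sup>-\<^sup>1\<close>, so it is Markovian. A strongly
  continuous semigroup with dissipative generator is determined by the generator. Finally
  \<open>d/ds (e\<^sup>-\<^sup>s e\<^sup>-\<^sup>s\<^sup>L g\<^sub>n) = - e\<^sup>-\<^sup>s e\<^sup>-\<^sup>s\<^sup>L e\<^sub>n \<ge> - e\<^sup>-\<^sup>s\<close> gives \<open>e\<^sup>-\<^sup>t e\<^sup>-\<^sup>t\<^sup>L g\<^sub>n \<ge> g\<^sub>n - (1 - e\<^sup>-\<^sup>t)\<close>, and the right-hand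
  side tends to \<open>e\<^sup>-\<^sup>t\<close> when \<open>w = 1\<close>.
\<close>

section \<open>Square-summable families\<close>

lemma summable_on_real_comparison:
  fixes f g :: "'b \<Rightarrow> real"
  assumes "g summable_on A" "\<And>x. x \<in> A \<Longrightarrow> \<bar>f x\<bar> \<le> g x"
  shows "f summable_on A"
proof (rule Infinite_Sum.abs_summable_summable,
    rule Infinite_Sum.abs_summable_on_comparison_test[where g = g])
  have "g x = norm (g x)" if "x \<in> A" for x using assms(2)[OF that] by simp
  then show "(\<lambda>x. norm (g x)) summable_on A" using assms(1) by (simp cong: summable_on_cong)
  show "norm (f x) \<le> norm (g x)" if "x \<in> A" for x using assms(2)[OF that] by simp
qed

lemma infsum_dominated_convergence:
  fixes f :: "nat \<Rightarrow> 'b \<Rightarrow> real"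
  assumes g: "g summable_on UNIV"
    and dom: "\<And>n x. \<bar>f n x\<bar> \<le> g x"
    and lim: "\<And>x. (\<lambda>n. f n x) \<longlonglongrightarrow> l x"
  shows "(\<lambda>n. infsum (f n) UNIV) \<longlonglongrightarrow> infsum l UNIV"
proof -
  have g0: "0 \<le> g x" for x using dom[of 0 x] by linarith
  have ldom: "\<bar>l x\<bar> \<le> g x" for x
    using LIMSEQ_le_const2[OF tendsto_rabs[OF lim[of x]], of "g x"] dom by blast
  have gA: "g summable_on A" for A by (rule summable_on_subset_banach[OF g]) simp
  have dsum: "h summable_on A" if "\<And>x. \<bar>h x\<bar> \<le> g x" for h :: "'b \<Rightarrow> real" and A
    using gA that by (rule summable_on_real_comparison)
  show ?thesis
  proof (rule LIMSEQ_I)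
    fix e :: real assume e: "0 < e"
    obtain F where F: "finite F" "norm (sum g F - infsum g UNIV) \<le> e/4"
      using infsum_finite_approximation[OF g, of "e/4"] e by (auto simp: dist_norm)
    have tail: "\<bar>infsum h UNIV - sum h F\<bar> \<le> e/4" if h: "\<And>x. \<bar>h x\<bar> \<le> g x" for h :: "'b \<Rightarrow> real"
    proof -
      have "infsum k UNIV = sum k F + infsum k (-F)" if "\<And>A. k summable_on A" for k :: "'b \<Rightarrow> real"
        using infsum_Un_disjoint[OF that[of F] that[of "-F"]] F(1) by simp
      note split = this
      have "\<bar>infsum h UNIV - sum h F\<bar> = \<bar>infsum h (-F)\<bar>"
        using split[of h] dsum[OF h] by simp
      also have "\<dots> \<le> infsum g (-F)"
      proof -
        have "infsum h (-F) \<le> infsum g (-F)" "infsum (\<lambda>x. - h x) (-F) \<le> infsum g (-F)"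
          using h by (auto intro!: infsum_mono gA dsum simp: abs_le_iff)
        then show ?thesis by (simp add: infsum_uminus)
      qed
      also have "\<dots> \<le> e/4" using F(2) split[of g] gA by simp
      finally show ?thesis .
    qed
    have "(\<lambda>n. sum (f n) F) \<longlonglongrightarrow> sum l F" by (intro tendsto_sum lim)
    then obtain N where N: "\<And>n. n \<ge> N \<Longrightarrow> norm (sum (f n) F - sum l F) < e/4"
      using LIMSEQ_D[of _ _ "e/4"] e by force
    show "\<exists>N. \<forall>n\<ge>N. norm (infsum (f n) UNIV - infsum l UNIV) < e"
    proof (intro exI allI impI)
      fix n assume "N \<le> n"
      then show "norm (infsum (f n) UNIV - infsum l UNIV) < e"
        using tail[of "f n", OF dom] tail[of l, OF ldom] N[of n] e
          unfolding real_norm_def by linarith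
    qed
  qed
qed

text \<open>The weighted space \<open>\<ell>\<^sup>2(X, m)\<close> depends on the term \<open>m\<close> and cannot be a type. Multiplication by
  \<open>\<surd>m\<close> maps it isometrically onto the unweighted space below, a single type that can be an
  instance of the class of complete inner product spaces. Energies live in the same type over the index set \<open>X \<times> X\<close>.\<close>

typedef 'b l2 = "{f :: 'b \<Rightarrow> real. (\<lambda>x. (f x)\<^sup>2) summable_on UNIV}"
  morphisms coord mk_l2
  by (rule exI[of _ "\<lambda>_. 0"]) simp

lemma coord_mk_l2: "(\<lambda>x. (f x)\<^sup>2) summable_on UNIV \<Longrightarrow> coord (mk_l2 f) = f"
  by (simp add: mk_l2_inverse)

lemma square_summable: "(\<lambda>x. (coord v x)\<^sup>2) summable_on UNIV"
  using coord[of v] by simp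

lemma l2_eqI: "(\<And>x. coord v x = coord w x) \<Longrightarrow> v = w"
  by (simp add: coord_inject[symmetric] fun_eq_iff)

lemma product_summable:
  fixes f g :: "'b \<Rightarrow> real"
  assumes "(\<lambda>x. (f x)\<^sup>2) summable_on UNIV" "(\<lambda>x. (g x)\<^sup>2) summable_on UNIV"
  shows "(\<lambda>x. f x * g x) summable_on UNIV"
proof (rule summable_on_real_comparison)
  show "(\<lambda>x. (f x)\<^sup>2 + (g x)\<^sup>2) summable_on UNIV" by (intro summable_on_add assms)
  fix x
  have "2 * \<bar>f x * g x\<bar> \<le> (f x)\<^sup>2 + (g x)\<^sup>2"
    using sum_squares_bound[of "\<bar>f x\<bar>" "\<bar>g x\<bar>"] by (simp add: abs_mult)
  then show "\<bar>f x * g x\<bar> \<le> (f x)\<^sup>2 + (g x)\<^sup>2" by linarith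
qed

lemma square_summable_lincomb:
  fixes f g :: "'b \<Rightarrow> real"
  assumes "(\<lambda>x. (f x)\<^sup>2) summable_on UNIV" "(\<lambda>x. (g x)\<^sup>2) summable_on UNIV"
  shows "(\<lambda>x. (\<alpha> * f x + \<beta> * g x)\<^sup>2) summable_on UNIV"
proof -
  have "(\<lambda>x. \<alpha>\<^sup>2 * (f x)\<^sup>2 + \<beta>\<^sup>2 * (g x)\<^sup>2 + (2 * \<alpha> * \<beta>) * (f x * g x)) summable_on UNIV"
    by (intro summable_on_add summable_on_cmult_right assms product_summable)
  then show ?thesis by (simp add: power2_eq_square algebra_simps)
qed

instantiation l2 :: (type) real_vector
begin
definition "0 = mk_l2 (\<lambda>_. 0)"
definition "v + w = mk_l2 (\<lambda>x. coord v x + coord w x)"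
definition "v - w = mk_l2 (\<lambda>x. coord v x - coord w x)"
definition "- v = mk_l2 (\<lambda>x. - coord v x)"
definition "r *\<^sub>R v = mk_l2 (\<lambda>x. r * coord v x)"

lemma coord_zero [simp]: "coord 0 x = 0"
  and coord_add [simp]: "coord (v + w) x = coord v x + coord w x"
  and coord_diff [simp]: "coord (v - w) x = coord v x - coord w x"
  and coord_uminus [simp]: "coord (- v) x = - coord v x"
  and coord_scaleR [simp]: "coord (r *\<^sub>R v) x = r * coord v x"
  using square_summable_lincomb[OF square_summable[of v] square_summable[of w], of 1 1]
    square_summable_lincomb[OF square_summable[of v] square_summable[of w], of 1 "-1"]
    square_summable_lincomb[OF square_summable[of v] square_summable[of w], of r 0]
    square_summable[of v]
  by (simp_all add: zero_l2_def plus_l2_def minus_l2_def uminus_l2_def scaleR_l2_def coord_mk_l2)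

instance
  by standard (auto intro!: l2_eqI simp: algebra_simps)
end

instantiation l2 :: (type) real_inner
begin
definition inner_l2_def: "inner v w = (\<Sum>\<^sub>\<infinity>x. coord v x * coord w x)"
definition norm_l2_def: "norm (v :: 'a l2) = sqrt (inner v v)"
definition sgn_l2_def: "sgn (v :: 'a l2) = v /\<^sub>R norm v"
definition dist_l2_def: "dist (v :: 'a l2) w = norm (v - w)"
definition uniformity_l2_def:
  "(uniformity :: ('a l2 \<times> 'a l2) filter) = (INF e\<in>{0<..}. principal {(x, y). dist x y < e})"
definition open_l2_def:
  "open (U :: 'a l2 set) \<longleftrightarrow> (\<forall>x\<in>U. eventually (\<lambda>(x', y). x' = x \<longrightarrow> y \<in> U) uniformity)"

instance
proof
  fix u v w :: "'a l2" and r :: real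
  have ps: "(\<lambda>x. coord v x * coord w x) summable_on UNIV" for v w :: "'a l2"
    by (intro product_summable square_summable)
  show "dist v w = norm (v - w)" by (rule dist_l2_def)
  show "sgn v = v /\<^sub>R norm v" by (rule sgn_l2_def)
  show "(uniformity :: ('a l2 \<times> 'a l2) filter) = (INF e\<in>{0<..}. principal {(x, y). dist x y < e})"
    by (rule uniformity_l2_def)
  show "open U \<longleftrightarrow> (\<forall>x\<in>U. eventually (\<lambda>(x', y). x' = x \<longrightarrow> y \<in> U) uniformity)" for U :: "'a l2 set"
    by (rule open_l2_def)
  show "inner v w = inner w v" by (simp add: inner_l2_def mult.commute)
  show "inner (u + v) w = inner u w + inner v w"
    by (simp add: inner_l2_def distrib_right infsum_add ps)
  show "inner (r *\<^sub>R v) w = r * inner v w"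
    by (simp add: inner_l2_def infsum_cmult_right' mult.assoc)
  show "0 \<le> inner v v"
    by (simp add: inner_l2_def infsum_nonneg)
  show "inner v v = 0 \<longleftrightarrow> v = 0"
  proof
    assume "inner v v = 0"
    then have "coord v x * coord v x = 0" for x
      using nonneg_infsum_le_0D[of "\<lambda>x. coord v x * coord v x" UNIV x] ps[of v v]
      by (simp add: inner_l2_def)
    then show "v = 0" by (intro l2_eqI) simp
  qed (simp add: inner_l2_def)
  show "norm v = sqrt (inner v v)" by (rule norm_l2_def)
qed
end

lemma norm_l2_square: "(norm v)\<^sup>2 = (\<Sum>\<^sub>\<infinity>x. (coord v x)\<^sup>2)"
  unfolding power2_norm_eq_inner inner_l2_def by (simp add: power2_eq_square)

lemma sum_square_le_norm: "finite F \<Longrightarrow> (\<Sum>x\<in>F. (coord v x)\<^sup>2) \<le> (norm v)\<^sup>2"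
  unfolding norm_l2_square by (intro finite_sum_le_infsum square_summable) auto

lemma abs_coord_le_norm: "\<bar>coord v x\<bar> \<le> norm v"
  using sum_square_le_norm[of "{x}" v] by (simp add: abs_le_square_iff[symmetric])

lemma bounded_linear_coord: "bounded_linear (\<lambda>v. coord v x)"
  by (rule bounded_linear_intro[where K = 1]) (auto simp: abs_coord_le_norm)

text \<open>The varying bounds \<open>c n\<close> matter: for energies the limit of the bounds is known, while a uniform
  bound would be too large.\<close>

lemma l2_fatou:
  assumes lim: "\<And>x. (\<lambda>n. coord (v n) x) \<longlonglongrightarrow> f x"
    and bound: "\<And>n. (norm (v n))\<^sup>2 \<le> c n" and c: "c \<longlonglongrightarrow> C"
  shows "(\<lambda>x. (f x)\<^sup>2) summable_on UNIV" "(norm (mk_l2 f))\<^sup>2 \<le> C"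
proof -
  have le: "(\<Sum>x\<in>F. (f x)\<^sup>2) \<le> C" if "finite F" for F
  proof (rule LIMSEQ_le[OF _ c])
    show "(\<lambda>n. \<Sum>x\<in>F. (coord (v n) x)\<^sup>2) \<longlonglongrightarrow> (\<Sum>x\<in>F. (f x)\<^sup>2)"
      by (intro tendsto_sum tendsto_power lim)
    show "\<exists>N. \<forall>n\<ge>N. (\<Sum>x\<in>F. (coord (v n) x)\<^sup>2) \<le> c n"
      using order_trans[OF sum_square_le_norm[OF that] bound] by blast
  qed
  show s: "(\<lambda>x. (f x)\<^sup>2) summable_on UNIV"
    by (rule nonneg_bdd_above_summable_on) (auto simp: bdd_above_def intro!: le)
  show "(norm (mk_l2 f))\<^sup>2 \<le> C"
    unfolding norm_l2_square coord_mk_l2[OF s] by (intro infsum_le_finite_sums s le)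
qed

lemma l2_dominated_convergence:
  fixes v :: "nat \<Rightarrow> 'b l2"
  assumes dom: "\<And>n x. \<bar>coord (v n) x\<bar> \<le> \<bar>coord w x\<bar>"
    and lim: "\<And>x. (\<lambda>n. coord (v n) x) \<longlonglongrightarrow> coord u x"
  shows "v \<longlonglongrightarrow> u"
proof -
  have udom: "\<bar>coord u x\<bar> \<le> \<bar>coord w x\<bar>" for x
    using LIMSEQ_le_const2[OF tendsto_rabs[OF lim[of x]], of "\<bar>coord w x\<bar>"] dom by blast
  have "(\<lambda>n. \<Sum>\<^sub>\<infinity>x. (coord (v n - u) x)\<^sup>2) \<longlonglongrightarrow> (\<Sum>\<^sub>\<infinity>(x::'b). 0)"
  proof (rule infsum_dominated_convergence)
    show "(\<lambda>x. 4 * (coord w x)\<^sup>2) summable_on UNIV"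
      by (intro summable_on_cmult_right square_summable)
    fix n x
    have "\<bar>coord (v n - u) x\<bar> \<le> 2 * \<bar>coord w x\<bar>" using dom[of n x] udom[of x] by simp
    then have "\<bar>coord (v n - u) x\<bar>\<^sup>2 \<le> (2 * \<bar>coord w x\<bar>)\<^sup>2" by (rule power_mono) simp
    then show "\<bar>(coord (v n - u) x)\<^sup>2\<bar> \<le> 4 * (coord w x)\<^sup>2" by (simp add: power_mult_distrib)
  next
    fix x
    have "(\<lambda>n. (coord (v n) x - coord u x)\<^sup>2) \<longlonglongrightarrow> (coord u x - coord u x)\<^sup>2"
      by (intro tendsto_intros lim)
    then show "(\<lambda>n. (coord (v n - u) x)\<^sup>2) \<longlonglongrightarrow> 0" by simp
  qed
  then have "(\<lambda>n. sqrt ((norm (v n - u))\<^sup>2)) \<longlonglongrightarrow> sqrt 0"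
    by (intro tendsto_real_sqrt) (simp add: norm_l2_square)
  then show ?thesis by (simp add: LIM_zero_iff tendsto_norm_zero_iff)
qed

instance l2 :: (type) complete_space
proof
  fix X :: "nat \<Rightarrow> 'a l2"
  assume X: "Cauchy X"
  have "convergent (\<lambda>n. coord (X n) x)" for x
    using bounded_linear.Cauchy[OF bounded_linear_coord X] by (simp add: Cauchy_convergent_iff)
  then obtain f where f: "\<And>x. (\<lambda>n. coord (X n) x) \<longlonglongrightarrow> f x"
    unfolding convergent_def by metis
  obtain B where B: "\<And>n. norm (X n) \<le> B"
    using cauchy_imp_bounded[OF X] by (auto simp: bounded_iff)
  have "(\<lambda>x. (f x)\<^sup>2) summable_on UNIV"
    by (rule l2_fatou(1)[OF f, of "\<lambda>_. B\<^sup>2" "B\<^sup>2"]) (auto intro!: power_mono B)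
  then have cf: "coord (mk_l2 f) = f" by (rule coord_mk_l2)
  have "X \<longlonglongrightarrow> mk_l2 f"
  proof (rule LIMSEQ_I)
    fix e :: real assume e: "0 < e"
    then obtain M where M: "\<And>m n. m \<ge> M \<Longrightarrow> n \<ge> M \<Longrightarrow> norm (X m - X n) < e/2"
      using CauchyD[OF X, of "e/2"] by auto
    show "\<exists>N. \<forall>n\<ge>N. norm (X n - mk_l2 f) < e"
    proof (intro exI[of _ M] allI impI)
      fix n assume n: "M \<le> n"
      have "(norm (mk_l2 (\<lambda>x. coord (X n) x - f x)))\<^sup>2 \<le> (e/2)\<^sup>2"
      proof (rule l2_fatou(2))
        show "(\<lambda>k. coord (X n - X (k + M)) x) \<longlonglongrightarrow> coord (X n) x - f x" for x
          by (simp, intro tendsto_intros LIMSEQ_ignore_initial_segment f)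
        show "(norm (X n - X (k + M)))\<^sup>2 \<le> (\<lambda>_. (e/2)\<^sup>2) k" for k
          using M[OF n, of "k + M"] by (simp add: power_mono less_imp_le)
      qed simp
      moreover have "mk_l2 (\<lambda>x. coord (X n) x - f x) = X n - mk_l2 f"
        by (simp add: minus_l2_def cf)
      ultimately have "norm (X n - mk_l2 f) \<le> e/2"
        using e by (simp add: power_mono_iff)
      then show "norm (X n - mk_l2 f) < e" using e by simp
    qed
  qed
  then show "convergent X" by (rule convergentI)
qed

section \<open>Strongly continuous semigroups on a Hilbert space\<close>

instance l2 :: (type) banach ..

text \<open>The conditions of \<^const>\<open>C0_semigroup\<close> on an abstract space. As there, the operator norms are not
  assumed to be locally bounded in time; this follows from the category theorem.\<close>

definition c0_semigroup :: "(real \<Rightarrow> 'h::real_normed_vector \<Rightarrow> 'h) \<Rightarrow> bool" where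
  "c0_semigroup T \<longleftrightarrow>
     (\<forall>t\<ge>0. bounded_linear (T t)) \<and> (\<forall>f. T 0 f = f) \<and>
     (\<forall>s\<ge>0. \<forall>t\<ge>0. \<forall>f. T (s + t) f = T s (T t f)) \<and>
     (\<forall>f. ((\<lambda>t. T t f) \<longlongrightarrow> f) (at_right 0))"

definition generator :: "(real \<Rightarrow> 'h::real_normed_vector \<Rightarrow> 'h) \<Rightarrow> ('h \<times> 'h) set" where
  "generator T = {(f, g). ((\<lambda>t. (T t f - f) /\<^sub>R t) \<longlongrightarrow> g) (at_right 0)}"

lemma c0_semigroupD:
  assumes "c0_semigroup T"
  shows "0 \<le> t \<Longrightarrow> bounded_linear (T t)" "T 0 f = f"
    "0 \<le> s \<Longrightarrow> 0 \<le> t \<Longrightarrow> T (s + t) f = T s (T t f)"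
    "((\<lambda>t. T t f) \<longlongrightarrow> f) (at_right 0)"
  using assms by (auto simp: c0_semigroup_def)

text \<open>The closed sets of all \<open>f\<close> whose orbit stays below \<open>n\<close> up to time \<open>1/(n + 1)\<close> exhaust the space,
  since orbits are right continuous at \<open>0\<close>. By Baire one of them contains a ball, and linearity
  spreads its bound to all vectors.\<close>

lemma c0_semigroup_local_bound:
  fixes T :: "real \<Rightarrow> 'h::banach \<Rightarrow> 'h"
  assumes T: "c0_semigroup T"
  obtains \<delta> C where "0 < \<delta>" "0 \<le> C" "\<And>s f. 0 \<le> s \<Longrightarrow> s \<le> \<delta> \<Longrightarrow> norm (T s f) \<le> C * norm f"
proof -
  note D = c0_semigroupD[OF T]
  define F where "F n = {f. \<forall>s\<in>{0..inverse (real (Suc n))}. norm (T s f) \<le> real n}" for n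
  have cl: "closed (F n)" for n
  proof -
    have "F n = (\<Inter>s\<in>{0..inverse (real (Suc n))}. {f. norm (T s f) \<le> real n})"
      by (auto simp: F_def)
    also have "closed \<dots>"
      by (intro closed_INT ballI closed_Collect_le continuous_intros
          bounded_linear.continuous_on[OF D(1)]) auto
    finally show ?thesis .
  qed
  have cover: "\<exists>n. f \<in> F n" for f
  proof -
    have "\<forall>\<^sub>F t in at_right 0. dist (T t f) f < 1"
      using D(4)[of f] by (rule tendstoD) simp
    then obtain e where e: "0 < e" "\<And>t. 0 < t \<Longrightarrow> t < e \<Longrightarrow> dist (T t f) f < 1"
      by (auto simp: eventually_at_right_field)
    obtain n1 where n1: "inverse (real (Suc n1)) < e" using reals_Archimedean[OF e(1)] by blast
    define n where "n = max n1 (nat \<lceil>norm f + 1\<rceil>)"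
    have n: "inverse (real (Suc n)) \<le> inverse (real (Suc n1))" "norm f + 1 \<le> real n"
      unfolding n_def by (simp_all, linarith)
    have "norm (T s f) \<le> real n" if s: "0 \<le> s" "s \<le> inverse (real (Suc n))" for s
    proof (cases "s = 0")
      case True then show ?thesis using n(2) D(2)[of f] by simp
    next
      case False
      then have "norm (T s f - f) < 1" using e(2)[of s] s n(1) n1 by (simp add: dist_norm)
      then show ?thesis using norm_triangle_sub[of "T s f" f] n(2) by linarith
    qed
    then have "f \<in> F n" by (auto simp: F_def simp del: of_nat_Suc)
    then show ?thesis by blast
  qed
  have "\<exists>n. interior (F n) \<noteq> {}"
  proof (rule ccontr)
    assume "\<not> ?thesis"
    then have "euclidean interior_of \<Union> (range F) = {}"
      using Met_TC.metric_Baire_category_alt[where 'a='h and \<G> = "range F"] cl complete_UNIV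
      by auto
    moreover have "\<Union> (range F) = UNIV" using cover by blast
    ultimately show False by simp
  qed
  then obtain n x r where r: "0 < r" "ball x r \<subseteq> F n"
    by (metis all_not_in_conv mem_interior)
  define \<delta> where "\<delta> = inverse (real (Suc n))"
  have x: "x \<in> F n" using r by auto
  have bd: "norm (T s f) \<le> (4 * real n / r) * norm f" if s: "0 \<le> s" "s \<le> \<delta>" for s f
  proof (cases "f = 0")
    case True
    then show ?thesis using linear_0[OF bounded_linear.linear[OF D(1)[OF s(1)]]] by simp
  next
    case False
    define c where "c = r / (2 * norm f)"
    have c: "0 < c" using r False by (simp add: c_def)
    interpret bounded_linear "T s" by (rule D(1)[OF s(1)])
    have "x + c *\<^sub>R f \<in> F n" using r False c by (intro set_mp[OF r(2)]) (simp add: dist_norm c_def)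
    then have 1: "norm (T s (x + c *\<^sub>R f)) \<le> real n" using s by (auto simp: F_def \<delta>_def)
    have 2: "norm (T s x) \<le> real n" using x s by (auto simp: F_def \<delta>_def)
    have "c * norm (T s f) = norm (T s (x + c *\<^sub>R f) - T s x)"
      using c by (simp add: add scaleR)
    also have "\<dots> \<le> 2 * real n" using norm_triangle_ineq4[of "T s (x + c *\<^sub>R f)" "T s x"] 1 2 by simp
    finally show ?thesis using c r False by (simp add: c_def field_simps)
  qed
  show thesis
    by (rule that[of \<delta> "4 * real n / r"]) (use bd r in \<open>auto simp: \<delta>_def\<close>)
qed

lemma c0_semigroup_generator_invariant:
  assumes T: "c0_semigroup T" and fg: "(f, g) \<in> generator T" and t: "0 \<le> t"
  shows "(T t f, T t g) \<in> generator T"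
proof -
  note D = c0_semigroupD[OF T]
  interpret bounded_linear "T t" by (rule D(1)[OF t])
  have "((\<lambda>h. T t ((T h f - f) /\<^sub>R h)) \<longlongrightarrow> T t g) (at_right 0)"
    using fg by (intro tendsto) (simp add: generator_def)
  moreover have "\<forall>\<^sub>F h in at_right 0. T t ((T h f - f) /\<^sub>R h) = (T h (T t f) - T t f) /\<^sub>R h"
  proof (rule eventually_at_right_less[THEN eventually_mono])
    fix h :: real assume "0 < h"
    then show "T t ((T h f - f) /\<^sub>R h) = (T h (T t f) - T t f) /\<^sub>R h"
      using D(3)[of t h f] D(3)[of h t f] t by (simp add: scaleR diff add.commute)
  qed
  ultimately show ?thesis by (auto simp: generator_def elim: Lim_transform_eventually)
qed

lemma generator_linear:
  assumes T: "c0_semigroup T" and "(f, g) \<in> generator T" "(f', g') \<in> generator T"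
  shows "(f - f', g - g') \<in> generator T"
proof -
  have "((\<lambda>t. (T t f - f) /\<^sub>R t - (T t f' - f') /\<^sub>R t) \<longlongrightarrow> g - g') (at_right 0)"
    using assms by (intro tendsto_diff) (auto simp: generator_def)
  moreover have "\<forall>\<^sub>F t in at_right 0. (T t f - f) /\<^sub>R t - (T t f' - f') /\<^sub>R t = (T t (f - f') - (f - f')) /\<^sub>R t"
  proof (rule eventually_at_right_less[THEN eventually_mono])
    fix t :: real assume "0 < t"
    then interpret bounded_linear "T t" using c0_semigroupD(1)[OF T] by simp
    show "(T t f - f) /\<^sub>R t - (T t f' - f') /\<^sub>R t = (T t (f - f') - (f - f')) /\<^sub>R t"
      by (simp add: diff scaleR_diff_right)
  qed
  ultimately show ?thesis by (auto simp: generator_def elim: Lim_transform_eventually)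
qed

lemma has_vector_derivative_quotientI:
  assumes "((\<lambda>s. (F s - F t) /\<^sub>R (s - t) - v) \<longlongrightarrow> 0) (at t within S)"
  shows "(F has_vector_derivative v) (at t within S)"
  unfolding has_vector_derivative_def has_derivative_within
proof (rule conjI[OF bounded_linear_scaleR_left], rule tendsto_norm_zero_cancel)
  have "((\<lambda>s. norm ((F s - F t) /\<^sub>R (s - t) - v)) \<longlongrightarrow> 0) (at t within S)"
    by (rule tendsto_norm_zero[OF assms])
  moreover have "\<forall>\<^sub>F s in at t within S. norm ((F s - F t) /\<^sub>R (s - t) - v)
      = norm ((1 / norm (s - t)) *\<^sub>R (F s - (F t + (s - t) *\<^sub>R v)))"
    unfolding eventually_at_filter
  proof (intro always_eventually allI impI)
    fix s assume "s \<noteq> t"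
    then have "F s - (F t + (s - t) *\<^sub>R v) = (s - t) *\<^sub>R ((F s - F t) /\<^sub>R (s - t) - v)"
      by (simp add: scaleR_diff_right)
    then show "norm ((F s - F t) /\<^sub>R (s - t) - v)
      = norm ((1 / norm (s - t)) *\<^sub>R (F s - (F t + (s - t) *\<^sub>R v)))"
      using \<open>s \<noteq> t\<close> by simp
  qed
  ultimately show "((\<lambda>s. norm ((1 / norm (s - t)) *\<^sub>R (F s - (F t + (s - t) *\<^sub>R v)))) \<longlongrightarrow> 0) (at t within S)"
    by (rule Lim_transform_eventually)
qed

text \<open>The right derivative is immediate from the generator. For the left one, \<open>T t f - T s f\<close> is
  \<open>T s\<close> applied to an increment at time \<open>0\<close>, with \<open>s\<close> varying; the local bound controls this.
  Both sides are treated at once by applying \<open>T (min s t)\<close>.\<close>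

lemma orbit_derivative:
  fixes T :: "real \<Rightarrow> 'h::banach \<Rightarrow> 'h"
  assumes T: "c0_semigroup T" and fg: "(f, g) \<in> generator T" and t: "0 \<le> t"
  shows "((\<lambda>t. T t f) has_vector_derivative T t g) (at t within {0..})"
proof -
  note D = c0_semigroupD[OF T]
  obtain \<delta> C0 where \<delta>: "0 < \<delta>" "0 \<le> C0" "\<And>s f. 0 \<le> s \<Longrightarrow> s \<le> \<delta> \<Longrightarrow> norm (T s f) \<le> C0 * norm f"
    using c0_semigroup_local_bound[OF T] by blast
  \<comment> \<open>just below t the operators are uniformly bounded, which makes left limits harmless\<close>
  define \<eta> where "\<eta> = min t \<delta>"
  obtain B where B: "0 \<le> B" "\<And>f. norm (T (t - \<eta>) f) \<le> norm f * B"
    using bounded_linear.nonneg_bounded[OF D(1)[of "t - \<eta>"]] by (auto simp: \<eta>_def)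
  have bound: "norm (T (min s t) z) \<le> B * C0 * norm z" if "0 \<le> s" "\<bar>s - t\<bar> < \<delta>" for s z
  proof -
    have s: "0 \<le> min s t - (t - \<eta>)" "min s t - (t - \<eta>) \<le> \<delta>" "0 \<le> t - \<eta>"
      using that t by (auto simp: \<eta>_def)
    have "T (min s t) z = T (t - \<eta>) (T (min s t - (t - \<eta>)) z)"
      using D(3)[of "t - \<eta>" "min s t - (t - \<eta>)" z] s by simp
    also have "norm \<dots> \<le> norm (T (min s t - (t - \<eta>)) z) * B" by (rule B)
    also have "\<dots> \<le> (C0 * norm z) * B" by (intro mult_right_mono \<delta>(3) s B)
    finally show ?thesis by (simp add: mult_ac)
  qed
  have absgt: "filterlim (\<lambda>s. \<bar>s - t\<bar>) (at_right 0) (at t within {0..})"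
    unfolding filterlim_at
  proof
    show "((\<lambda>s. \<bar>s - t\<bar>) \<longlongrightarrow> 0) (at t within {0..})"
    proof (rule tendsto_eq_rhs)
      show "((\<lambda>s. \<bar>s - t\<bar>) \<longlongrightarrow> \<bar>t - t\<bar>) (at t within {0..})" by (intro tendsto_intros)
    qed simp
    show "\<forall>\<^sub>F s in at t within {0..}. \<bar>s - t\<bar> \<in> {0<..} \<and> \<bar>s - t\<bar> \<noteq> 0"
      by (auto simp: eventually_at_filter)
  qed
  define q where "q h = (T h f - f) /\<^sub>R h" for h
  have l1: "((\<lambda>s. q \<bar>s - t\<bar>) \<longlongrightarrow> g) (at t within {0..})"
    using fg by (intro filterlim_compose[OF _ absgt]) (simp add: generator_def q_def)
  have l2: "((\<lambda>s. T \<bar>s - t\<bar> g) \<longlongrightarrow> g) (at t within {0..})"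
    by (intro filterlim_compose[OF _ absgt] D(4))
  have "((\<lambda>s. B * C0 * (norm (q \<bar>s - t\<bar> - g) + norm (T \<bar>s - t\<bar> g - g))) \<longlongrightarrow> B * C0 * (norm (g - g) + norm (g - g)))
      (at t within {0..})"
    by (intro tendsto_intros l1 l2)
  then have "((\<lambda>s. B * C0 * (norm (q \<bar>s - t\<bar> - g) + norm (T \<bar>s - t\<bar> g - g))) \<longlongrightarrow> 0) (at t within {0..})"
    by simp
  moreover have "\<forall>\<^sub>F s in at t within {0..}. norm ((T s f - T t f) /\<^sub>R (s - t) - T t g)
      \<le> B * C0 * (norm (q \<bar>s - t\<bar> - g) + norm (T \<bar>s - t\<bar> g - g))"
    unfolding eventually_at
  proof (intro exI[of _ \<delta>] conjI ballI impI)
    fix s :: real assume s: "s \<in> {0..}" and "s \<noteq> t \<and> dist s t < \<delta>"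
    then have st: "s \<noteq> t" "\<bar>s - t\<bar> < \<delta>" "0 \<le> s" by (auto simp: dist_real_def)
    interpret M: bounded_linear "T (min s t)" using D(1)[of "min s t"] st t by simp
    have quot: "(T s f - T t f) /\<^sub>R (s - t) = T (min s t) (q \<bar>s - t\<bar>)"
    proof (cases "t < s")
      case True
      then have m: "min s t = t" by simp
      show ?thesis using D(3)[of t "s - t" f] t True
        by (simp add: q_def m M.scaleR[unfolded m] M.diff[unfolded m])
    next
      case False
      then have "s < t" and m: "min s t = s" using st by auto
      then have "T (min s t) (q \<bar>s - t\<bar>) = (T t f - T s f) /\<^sub>R (t - s)"
        using D(3)[of s "t - s" f] st by (simp add: q_def m M.scaleR[unfolded m] M.diff[unfolded m])
      also have "\<dots> = - ((T s f - T t f) /\<^sub>R - (s - t))"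
        by (simp only: scaleR_minus_right[symmetric] minus_diff_eq)
      also have "\<dots> = (T s f - T t f) /\<^sub>R (s - t)"
        by (simp only: inverse_minus_eq scaleR_minus_left minus_minus)
      finally show ?thesis by simp
    qed
    have cont: "norm (T (min s t) g - T t g) \<le> B * C0 * norm (T \<bar>s - t\<bar> g - g)"
    proof (cases "t < s")
      case True
      then show ?thesis using B \<delta>(2) by (simp add: min_absorb2)
    next
      case False
      then have "T t g = T (min s t) (T \<bar>s - t\<bar> g)" using D(3)[of s "t - s" g] st by simp
      then have "norm (T (min s t) g - T t g) = norm (T (min s t) (g - T \<bar>s - t\<bar> g))" by (simp add: M.diff)
      also have "\<dots> \<le> B * C0 * norm (g - T \<bar>s - t\<bar> g)" using st by (intro bound) auto
      finally show ?thesis by (simp add: norm_minus_commute)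
    qed
    have "(T s f - T t f) /\<^sub>R (s - t) - T t g = T (min s t) (q \<bar>s - t\<bar> - g) + (T (min s t) g - T t g)"
      by (simp add: quot M.diff)
    also have "norm \<dots> \<le> norm (T (min s t) (q \<bar>s - t\<bar> - g)) + norm (T (min s t) g - T t g)"
      by (rule norm_triangle_ineq)
    also have "\<dots> \<le> B * C0 * norm (q \<bar>s - t\<bar> - g) + B * C0 * norm (T \<bar>s - t\<bar> g - g)"
      using st by (intro add_mono bound cont) auto
    finally show "norm ((T s f - T t f) /\<^sub>R (s - t) - T t g)
        \<le> B * C0 * (norm (q \<bar>s - t\<bar> - g) + norm (T \<bar>s - t\<bar> g - g))"
      by (simp add: distrib_left)
  qed (rule \<delta>(1))
  ultimately have "((\<lambda>s. (T s f - T t f) /\<^sub>R (s - t) - T t g) \<longlongrightarrow> 0) (at t within {0..})"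
    by (rule Lim_null_comparison[rotated])
  then show ?thesis by (rule has_vector_derivative_quotientI)
qed

text \<open>Gronwall's inequality for \<open>\<parallel>w\<parallel>\<^sup>2\<close>, using \<open>2 \<epsilon> \<parallel>w\<parallel> \<le> \<epsilon>\<^sup>2 + \<parallel>w\<parallel>\<^sup>2\<close> to avoid differentiating the norm
  at \<open>0\<close>. With \<open>\<epsilon> = 0\<close> it is the uniqueness argument for dissipative evolutions; with \<open>\<epsilon> > 0\<close> it
  compares two Yosida approximations.\<close>

lemma dissipative_growth:
  fixes w :: "real \<Rightarrow> 'h::real_inner"
  assumes w: "\<And>t. 0 \<le> t \<Longrightarrow> (w has_vector_derivative w' t) (at t within {0..})"
    and diss: "\<And>t. 0 \<le> t \<Longrightarrow> inner (w' t) (w t) \<le> \<epsilon> * norm (w t)"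
    and w0: "w 0 = 0" and t: "0 \<le> t"
  shows "(norm (w t))\<^sup>2 \<le> exp t * t * \<epsilon>\<^sup>2"
proof -
  define \<phi> where "\<phi> t = exp (- t) * inner (w t) (w t) - \<epsilon>\<^sup>2 * t" for t
  have "\<phi> t \<le> \<phi> 0"
  proof (rule DERIV_nonpos_imp_decreasing_open[of 0 t \<phi>, OF t])
    fix x :: real assume x: "0 < x" "x < t"
    have "(w has_vector_derivative w' x) (at x within {0<..})"
      by (rule has_vector_derivative_within_subset[OF w]) (use x in auto)
    then have wx: "(w has_vector_derivative w' x) (at x)"
      using at_within_open[of x "{0<..}"] x by simp
    have d: "((\<lambda>x. inner (w x) (w x)) has_real_derivative 2 * inner (w' x) (w x)) (at x)"
      unfolding has_real_derivative_iff_has_vector_derivative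
      using bounded_bilinear.has_vector_derivative[OF bounded_bilinear_inner wx wx]
      by (simp add: inner_commute)
    have "(\<phi> has_real_derivative exp (- x) * (2 * inner (w' x) (w x)) - exp (- x) * inner (w x) (w x) - \<epsilon>\<^sup>2) (at x)"
      unfolding \<phi>_def by (auto intro!: derivative_eq_intros d)
    moreover have "exp (- x) * (2 * inner (w' x) (w x)) - exp (- x) * inner (w x) (w x) - \<epsilon>\<^sup>2 \<le> 0"
    proof -
      have "2 * inner (w' x) (w x) - inner (w x) (w x) \<le> \<epsilon>\<^sup>2"
        using diss[of x] x sum_squares_bound[of \<epsilon> "norm (w x)"]
        by (simp add: power2_norm_eq_inner[symmetric])
      then have "exp (- x) * (2 * inner (w' x) (w x) - inner (w x) (w x)) \<le> exp (- x) * \<epsilon>\<^sup>2"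
        by (rule mult_left_mono) simp
      also have "\<dots> \<le> 1 * \<epsilon>\<^sup>2" using x by (intro mult_right_mono) auto
      finally show ?thesis by (simp add: right_diff_distrib)
    qed
    ultimately show "\<exists>y. (\<phi> has_real_derivative y) (at x) \<and> y \<le> 0" by blast
  next
    have "continuous_on {0..} w"
      unfolding continuous_on_eq_continuous_within 
      by (auto intro: has_vector_derivative_continuous[OF w])
    then have "continuous_on {0..t} w" by (rule continuous_on_subset) auto
    then show "continuous_on {0..t} \<phi>" unfolding \<phi>_def by (intro continuous_intros)
  qed
  then have "exp (- t) * (norm (w t))\<^sup>2 \<le> \<epsilon>\<^sup>2 * t" by (simp add: \<phi>_def w0 power2_norm_eq_inner)
  then have "exp t * (exp (- t) * (norm (w t))\<^sup>2) \<le> exp t * (\<epsilon>\<^sup>2 * t)" by (intro mult_left_mono) auto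
  moreover have "exp t * (exp (- t) * (norm (w t))\<^sup>2) = (norm (w t))\<^sup>2"
    by (simp add: mult.assoc[symmetric] exp_add[symmetric])
  ultimately show ?thesis by (simp add: mult_ac)
qed

text \<open>On the domain the difference of two orbits solves \<open>w' = A w\<close> with \<open>w 0 = 0\<close>, and a dissipative \<open>A\<close>
  forces \<open>w = 0\<close>; density does the rest.\<close>

theorem c0_semigroup_unique:
  fixes T S :: "real \<Rightarrow> 'h::{real_inner,banach} \<Rightarrow> 'h"
  assumes T: "c0_semigroup T" and S: "c0_semigroup S" and gen: "generator T = generator S"
    and diss: "\<And>f g. (f, g) \<in> generator S \<Longrightarrow> inner g f \<le> 0"
    and dense: "\<And>f. \<exists>F. (\<forall>n. F n \<in> Domain (generator S)) \<and> F \<longlonglongrightarrow> f"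
    and t: "0 \<le> t"
  shows "T t f = S t f"
proof -
  have eq: "T t f = S t f" if f: "f \<in> Domain (generator S)" for f
  proof -
    obtain g where fg: "(f, g) \<in> generator S" using f by blast
    have "(norm (T t f - S t f))\<^sup>2 \<le> exp t * t * 0\<^sup>2"
    proof (rule dissipative_growth[OF _ _ _ t])
      fix s :: real assume s: "0 \<le> s"
      show "((\<lambda>s. T s f - S s f) has_vector_derivative T s g - S s g) (at s within {0..})"
        using fg gen by (intro has_vector_derivative_diff orbit_derivative[OF T _ s] orbit_derivative[OF S _ s]) auto
      have "(T s f - S s f, T s g - S s g) \<in> generator S"
        using fg gen c0_semigroup_generator_invariant[OF T, of f g s] s
        by (intro generator_linear[OF S] c0_semigroup_generator_invariant[OF S]) auto
      then show "inner (T s g - S s g) (T s f - S s f) \<le> 0 * norm (T s f - S s f)"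
        using diss by simp
    qed (use c0_semigroupD(2)[OF T] c0_semigroupD(2)[OF S] in simp)
    then show ?thesis by simp
  qed
  obtain F where F: "\<And>n. F n \<in> Domain (generator S)" "F \<longlonglongrightarrow> f" using dense by blast
  have "(\<lambda>n. T t (F n)) \<longlonglongrightarrow> T t f" "(\<lambda>n. S t (F n)) \<longlonglongrightarrow> S t f"
    using bounded_linear.tendsto[OF c0_semigroupD(1)[OF T t] F(2)]
      bounded_linear.tendsto[OF c0_semigroupD(1)[OF S t] F(2)] by auto
  then show ?thesis using eq[OF F(1)] LIMSEQ_unique by simp
qed

lemma contraction_generator_dissipative:
  fixes S :: "real \<Rightarrow> 'h::real_inner \<Rightarrow> 'h"
  assumes contr: "\<And>t f. 0 \<le> t \<Longrightarrow> norm (S t f) \<le> norm f" and fg: "(f, g) \<in> generator S"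
  shows "inner g f \<le> 0"
proof (rule tendsto_upperbound)
  show "((\<lambda>t. inner ((S t f - f) /\<^sub>R t) f) \<longlongrightarrow> inner g f) (at_right 0)"
    using fg by (intro tendsto_inner[OF _ tendsto_const]) (simp add: generator_def)
  show "\<forall>\<^sub>F t in at_right 0. inner ((S t f - f) /\<^sub>R t) f \<le> 0"
  proof (rule eventually_at_right_less[THEN eventually_mono])
    fix t :: real assume t: "0 < t"
    have "inner (S t f) f \<le> norm (S t f) * norm f" by (rule norm_cauchy_schwarz)
    also have "\<dots> \<le> norm f * norm f" using t by (intro mult_right_mono contr) auto
    finally have "inner (S t f - f) f \<le> 0"
      by (simp add: inner_diff_left dot_square_norm power2_eq_square)
    then show "inner ((S t f - f) /\<^sub>R t) f \<le> 0"
      using t by (simp add: mult_nonneg_nonpos)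
  qed
qed simp

section \<open>Generation from a resolvent family\<close>

definition exp_coeff :: "real \<Rightarrow> nat \<Rightarrow> real" where
  "exp_coeff t k = t ^ k / fact k"

lemma exp_coeff_sums: "exp_coeff t sums exp t"
  using exp_converges[of t] by (simp add: exp_coeff_def[abs_def] divide_inverse mult.commute)

lemma exp_coeff_summable: "summable (exp_coeff t)"
  using exp_coeff_sums by (rule sums_summable)

lemma exp_coeff_suminf_mult: "(\<Sum>k. exp_coeff t k * c) = exp t * c"
  using sums_unique[OF exp_coeff_sums] by (simp add: suminf_mult2[OF exp_coeff_summable, symmetric])

lemma exp_coeff_abs: "\<bar>exp_coeff t k\<bar> = exp_coeff \<bar>t\<bar> k"
  by (simp add: exp_coeff_def power_abs)

lemma exp_coeff_nonneg: "0 \<le> t \<Longrightarrow> 0 \<le> exp_coeff t k"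
  by (simp add: exp_coeff_def)

lemma exp_coeff_mono: "0 \<le> s \<Longrightarrow> s \<le> t \<Longrightarrow> exp_coeff s k \<le> exp_coeff t k"
  by (simp add: exp_coeff_def divide_right_mono power_mono)

text \<open>\<open>exp (t (K - 1))\<close>, written as an average of powers of \<open>K\<close> with Poisson weights: bounds shared
  by all powers of \<open>K\<close> are inherited.\<close>

definition poisson_semigroup :: "('h::banach \<Rightarrow> 'h) \<Rightarrow> real \<Rightarrow> 'h \<Rightarrow> 'h" where
  "poisson_semigroup K t f = exp (- t) *\<^sub>R (\<Sum>k. exp_coeff t k *\<^sub>R (K ^^ k) f)"

locale contraction_operator =
  fixes K :: "'h::{real_inner,banach} \<Rightarrow> 'h"
  assumes K_linear: "bounded_linear K" and K_contr: "norm (K f) \<le> norm f"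
begin

lemma iter_linear: "bounded_linear (K ^^ k)"
proof (induction k)
  case (Suc k)
  then show ?case using bounded_linear_compose[OF K_linear Suc] by (simp add: o_def)
qed simp

lemma iter_contr: "norm ((K ^^ k) f) \<le> norm f"
  by (induction k) (auto intro: order_trans[OF K_contr])

lemma term_bound: "norm (exp_coeff t k *\<^sub>R (K ^^ k) f) \<le> exp_coeff \<bar>t\<bar> k * norm f"
  by (simp add: iter_contr mult_left_mono exp_coeff_abs exp_coeff_nonneg)

lemma summable_bound: "summable (\<lambda>k. exp_coeff \<bar>t\<bar> k * c)" for t c :: real
  by (intro summable_mult2 exp_coeff_summable)

lemma summable_terms: "summable (\<lambda>k. exp_coeff t k *\<^sub>R (K ^^ k) f)"
  by (rule summable_comparison_test'[OF summable_bound, of 0]) (rule term_bound)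

lemma poisson_0: "poisson_semigroup K 0 f = f"
proof -
  have "(\<lambda>k. exp_coeff 0 k *\<^sub>R (K ^^ k) f) = (\<lambda>k. if k = 0 then f else 0)"
    by (auto simp: fun_eq_iff exp_coeff_def)
  moreover have "(\<Sum>k. if k = 0 then f else 0) = f"
    using sums_unique[OF sums_If_finite_set[of "{0::nat}" "\<lambda>_. f"]] by simp
  ultimately show ?thesis by (simp add: poisson_semigroup_def)
qed

lemma poisson_commute:
  assumes M: "bounded_linear M" and comm: "\<And>f. M (K f) = K (M f)"
  shows "M (poisson_semigroup K t f) = poisson_semigroup K t (M f)"
proof -
  interpret M: bounded_linear M by (rule M)
  have "M ((K ^^ k) f) = (K ^^ k) (M f)" for k by (induction k) (simp_all add: comm)
  then show ?thesis
    by (simp add: poisson_semigroup_def M.scaleR M.suminf[OF summable_terms])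
qed

lemma poisson_contr:
  assumes "0 \<le> t" shows "norm (poisson_semigroup K t f) \<le> norm f"
proof -
  have "norm (\<Sum>k. exp_coeff t k *\<^sub>R (K ^^ k) f) \<le> (\<Sum>k. exp_coeff \<bar>t\<bar> k * norm f)"
    by (rule norm_suminf_le[OF term_bound summable_bound])
  also have "\<dots> = exp t * norm f"
    using assms by (simp add: exp_coeff_suminf_mult)
  finally have "exp (- t) * norm (\<Sum>k. exp_coeff t k *\<^sub>R (K ^^ k) f) \<le> exp (- t) * (exp t * norm f)"
    by (rule mult_left_mono) simp
  then show ?thesis by (simp add: poisson_semigroup_def mult.assoc[symmetric] exp_add[symmetric])
qed

lemma poisson_add: "poisson_semigroup K t (f + g) = poisson_semigroup K t f + poisson_semigroup K t g"
proof -
  have "(K ^^ k) (f + g) = (K ^^ k) f + (K ^^ k) g" for k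
    by (rule linear_add[OF bounded_linear.linear[OF iter_linear]])
  then show ?thesis
    by (simp add: poisson_semigroup_def scaleR_add_right suminf_add[OF summable_terms summable_terms, symmetric])
qed

lemma poisson_scaleR: "poisson_semigroup K t (r *\<^sub>R f) = r *\<^sub>R poisson_semigroup K t f"
proof -
  have "(K ^^ k) (r *\<^sub>R f) = r *\<^sub>R (K ^^ k) f" for k
    by (rule linear_scale[OF bounded_linear.linear[OF iter_linear]])
  then have "(\<Sum>k. exp_coeff t k *\<^sub>R (K ^^ k) (r *\<^sub>R f)) = (\<Sum>k. r *\<^sub>R (exp_coeff t k *\<^sub>R (K ^^ k) f))"
    by (simp add: mult_ac)
  also have "\<dots> = r *\<^sub>R (\<Sum>k. exp_coeff t k *\<^sub>R (K ^^ k) f)"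
    by (rule suminf_scaleR_right[OF summable_terms, symmetric])
  finally show ?thesis by (simp add: poisson_semigroup_def mult_ac)
qed

lemma poisson_diff: "poisson_semigroup K t (f - g) = poisson_semigroup K t f - poisson_semigroup K t g"
  using poisson_add[of t "f - g" g] by simp

text \<open>Term-by-term differentiation; the tails of the differentiated series are dominated, uniformly on
  \<open>\<bar>x\<bar> < r\<close>, by those of \<open>exp r\<close>.\<close>

lemma series_derivative:
  "((\<lambda>t. \<Sum>k. exp_coeff t k *\<^sub>R (K ^^ k) f) has_vector_derivative
     (\<Sum>k. exp_coeff t k *\<^sub>R (K ^^ k) (K f))) (at t)"
proof -
  define a where "a k = (K ^^ k) f /\<^sub>R fact k" for k
  define r where "r = \<bar>t\<bar> + 1"
  define S where "S = {-r<..<r}"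
  define G where "G t = (\<Sum>k. exp_coeff t k *\<^sub>R (K ^^ k) (K f))" for t
  have t: "t \<in> S" by (simp add: S_def r_def, linarith)
  have "\<exists>g. \<forall>x\<in>S. (\<lambda>n. x ^ n *\<^sub>R a n) sums g x \<and> (g has_derivative (\<lambda>h. h *\<^sub>R G x)) (at x within S)"
  proof (rule has_derivative_series[where f' = "\<lambda>n x h. h *\<^sub>R ((real n * x ^ (n - 1)) *\<^sub>R a n)" and x = 0])
    show "convex S" by (simp add: S_def)
    show "((\<lambda>x. x ^ n *\<^sub>R a n) has_derivative (\<lambda>h. h *\<^sub>R (real n * x ^ (n - 1)) *\<^sub>R a n)) (at x within S)" for n x
      by (auto intro!: derivative_eq_intros simp: fun_eq_iff mult_ac)
    show "(0::real) \<in> S" unfolding S_def r_def greaterThanLessThan_iff by linarith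
    show "(\<lambda>n. 0 ^ n *\<^sub>R a n) sums a 0"
      using sums_If_finite_set[of "{0}" a] by (auto simp: power_0_left if_distrib if_distribR cong: if_cong)
    fix e :: real assume e: "0 < e"
    define c where "c k = exp_coeff \<bar>r\<bar> k * norm (K f)" for k
    have sc: "summable c" unfolding c_def by (rule summable_bound)
    have "(\<lambda>N. \<Sum>k. c (k + N)) \<longlonglongrightarrow> 0" using suminf_exist_split2[OF sc] .
    then have "\<forall>\<^sub>F N in sequentially. (\<Sum>k. c (k + N)) < e" by (rule order_tendstoD) (rule e)
    then have "\<forall>\<^sub>F n in sequentially. (\<Sum>k. c (k + (n - 1))) < e"
      by (rule eventually_compose_filterlim) (rule filterlim_minus_const_nat_at_top)
    then show "\<forall>\<^sub>F n in sequentially. \<forall>x\<in>S. \<forall>h.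
        norm ((\<Sum>i<n. h *\<^sub>R (real i * x ^ (i - 1)) *\<^sub>R a i) - h *\<^sub>R G x) \<le> e * norm h"
      using eventually_ge_at_top[of 1]
    proof eventually_elim
      case (elim n)
      show ?case
      proof (intro ballI allI)
        fix x h :: real assume x: "x \<in> S"
        obtain N where n: "n = Suc N" using elim(2) by (cases n) auto
        define y where "y k = exp_coeff x k *\<^sub>R (K ^^ k) (K f)" for k
        have sy: "summable y" unfolding y_def by (rule summable_terms)
        have "(real (Suc i) * x ^ i) *\<^sub>R a (Suc i) = y i" for i
          by (simp add: a_def y_def exp_coeff_def funpow_swap1 field_simps del: of_nat_Suc)
        then have "(\<Sum>i<n. h *\<^sub>R (real i * x ^ (i - 1)) *\<^sub>R a i) = h *\<^sub>R sum y {..<N}"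
          unfolding n sum.lessThan_Suc_shift by (simp add: scaleR_sum_right del: of_nat_Suc)
        then have "(\<Sum>i<n. h *\<^sub>R (real i * x ^ (i - 1)) *\<^sub>R a i) - h *\<^sub>R G x = - (h *\<^sub>R (G x - sum y {..<N}))"
          by (simp add: scaleR_diff_right)
        also have "G x - sum y {..<N} = (\<Sum>k. y (k + N))"
          unfolding G_def y_def[symmetric] by (rule suminf_minus_initial_segment[OF sy, symmetric])
        also have "norm (- (h *\<^sub>R (\<Sum>k. y (k + N)))) = \<bar>h\<bar> * norm (\<Sum>k. y (k + N))" by simp
        also have "\<dots> \<le> \<bar>h\<bar> * (\<Sum>k. c (k + N))"
        proof (rule mult_left_mono[OF norm_suminf_le])
          fix k
          have "norm (y k) \<le> exp_coeff \<bar>x\<bar> k * norm (K f)" for k unfolding y_def by (rule term_bound)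
          also have "exp_coeff \<bar>x\<bar> k * norm (K f) \<le> c k" for k
            unfolding c_def using x by (intro mult_right_mono exp_coeff_mono) (auto simp: S_def)
          finally show "norm (y (k + N)) \<le> c (k + N)" .
        next
          show "summable (\<lambda>k. c (k + N))" using sc by (rule summable_ignore_initial_segment)
        qed simp
        also have "\<dots> \<le> \<bar>h\<bar> * e" using elim(1) n by (intro mult_left_mono) auto
        finally show "norm ((\<Sum>i<n. h *\<^sub>R (real i * x ^ (i - 1)) *\<^sub>R a i) - h *\<^sub>R G x) \<le> e * norm h"
          by (simp add: mult.commute)
      qed
    qed
  qed
  then obtain g where g: "\<And>x. x \<in> S \<Longrightarrow> (\<lambda>n. x ^ n *\<^sub>R a n) sums g x"
    "\<And>x. x \<in> S \<Longrightarrow> (g has_derivative (\<lambda>h. h *\<^sub>R G x)) (at x within S)" by blast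
  have geq: "g x = (\<Sum>k. exp_coeff x k *\<^sub>R (K ^^ k) f)" if "x \<in> S" for x
    using sums_unique[OF g(1)[OF that]] by (simp add: a_def exp_coeff_def divide_inverse)
  have "(g has_vector_derivative G t) (at t)"
    using g(2)[OF t] t at_within_open[of t S] by (simp add: has_vector_derivative_def S_def)
  then have "((\<lambda>x. \<Sum>k. exp_coeff x k *\<^sub>R (K ^^ k) f) has_vector_derivative G t) (at t)"
    by (rule has_vector_derivative_transform_within_open[of _ _ _ S]) (use t geq in \<open>auto simp: S_def\<close>)
  then show ?thesis by (simp add: G_def)
qed

lemma poisson_derivative:
  "((\<lambda>t. poisson_semigroup K t f) has_vector_derivative poisson_semigroup K t (K f - f)) (at t)"
proof -
  have "((\<lambda>t. exp (- t)) has_real_derivative - exp (- t)) (at t)"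
    by (auto intro!: derivative_eq_intros)
  from has_vector_derivative_scaleR[OF this series_derivative[of f t]]
  show ?thesis unfolding poisson_diff by (simp add: poisson_semigroup_def)
qed

lemma poisson_functional_bound:
  fixes \<phi> :: "'h \<Rightarrow> real"
  assumes \<phi>: "bounded_linear \<phi>" and le: "\<And>k. \<phi> ((K ^^ k) f) \<le> c" and t: "0 \<le> t"
  shows "\<phi> (poisson_semigroup K t f) \<le> c"
proof -
  interpret \<phi>: bounded_linear \<phi> by (rule \<phi>)
  have "\<phi> (\<Sum>k. exp_coeff t k *\<^sub>R (K ^^ k) f) = (\<Sum>k. exp_coeff t k * \<phi> ((K ^^ k) f))"
    by (simp add: \<phi>.suminf[OF summable_terms] \<phi>.scaleR)
  also have "\<dots> \<le> (\<Sum>k. exp_coeff t k * c)"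
  proof (rule suminf_le)
    show "exp_coeff t k * \<phi> ((K ^^ k) f) \<le> exp_coeff t k * c" for k
      using t by (intro mult_left_mono le exp_coeff_nonneg)
    show "summable (\<lambda>k. exp_coeff t k * \<phi> ((K ^^ k) f))"
      using \<phi>.summable[OF summable_terms[of t f]] by (simp add: \<phi>.scaleR)
    show "summable (\<lambda>k. exp_coeff t k * c)" by (intro summable_mult2 exp_coeff_summable)
  qed
  also have "\<dots> = exp t * c" by (rule exp_coeff_suminf_mult)
  finally have "exp (- t) * \<phi> (\<Sum>k. exp_coeff t k *\<^sub>R (K ^^ k) f) \<le> exp (- t) * (exp t * c)"
    by (rule mult_left_mono) simp
  then show ?thesis
    by (simp add: poisson_semigroup_def \<phi>.scaleR mult.assoc[symmetric] exp_add[symmetric])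
qed

end

text \<open>The input of the theorem of Hille and Yosida: \<open>J \<alpha>\<close> plays the role of \<open>(\<alpha> - A)\<^sup>-\<^sup>1\<close> for the
  generator \<open>A\<close> to be found.\<close>

locale resolvent_family =
  fixes J :: "real \<Rightarrow> 'h::{real_inner,banach} \<Rightarrow> 'h"
  assumes J_linear: "0 < \<alpha> \<Longrightarrow> bounded_linear (J \<alpha>)"
    and J_contr: "0 < \<alpha> \<Longrightarrow> \<alpha> * norm (J \<alpha> f) \<le> norm f"
    and J_resolvent: "0 < \<alpha> \<Longrightarrow> 0 < \<mu> \<Longrightarrow> J \<alpha> f - J \<mu> f = (\<mu> - \<alpha>) *\<^sub>R J \<alpha> (J \<mu> f)"
    and J_approx: "(\<lambda>n. real (Suc n) *\<^sub>R J (real (Suc n)) f) \<longlonglongrightarrow> f"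
begin

text \<open>Write \<open>\<alpha> = n + 1\<close>. Below, \<open>K n = \<alpha> J \<alpha>\<close> is a contraction, \<open>A n\<close> is the Yosida approximation
  of the generator, and \<open>E n t = exp (t A n)\<close>.\<close>

definition K :: "nat \<Rightarrow> 'h \<Rightarrow> 'h" where
  "K n f = real (Suc n) *\<^sub>R J (real (Suc n)) f"

definition A :: "nat \<Rightarrow> 'h \<Rightarrow> 'h" where
  "A n f = real (Suc n) *\<^sub>R (K n f - f)"

definition E :: "nat \<Rightarrow> real \<Rightarrow> 'h \<Rightarrow> 'h" where
  "E n t = poisson_semigroup (K n) (real (Suc n) * t)"

sublocale K: contraction_operator "K n" for n
proof (rule contraction_operator.intro)
  show "bounded_linear (K n)" unfolding K_def[abs_def]
    by (intro bounded_linear_compose[OF bounded_linear_scaleR_right] J_linear) simp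
  show "norm (K n f) \<le> norm f" for f
    using J_contr[of "real (Suc n)" f] by (simp add: K_def)
qed

lemma J_commute:
  assumes pos: "0 < \<alpha>" "0 < \<mu>"
  shows "J \<alpha> (J \<mu> f) = J \<mu> (J \<alpha> f)"
proof (cases "\<alpha> = \<mu>")
  case False
  have "(\<mu> - \<alpha>) *\<^sub>R J \<alpha> (J \<mu> f) = - (J \<mu> f - J \<alpha> f)"
    using J_resolvent[OF pos, of f] by simp
  also have "\<dots> = (\<mu> - \<alpha>) *\<^sub>R J \<mu> (J \<alpha> f)"
    using J_resolvent[OF pos(2,1), of f] by (simp add: scaleR_minus_left[symmetric] del: scaleR_minus_left)
  finally show ?thesis using False by simp
qed simp

lemma K_commute: "K n (K k f) = K k (K n f)"
proof -
  have "J (real (Suc n)) (r *\<^sub>R f) = r *\<^sub>R J (real (Suc n)) f" for n r f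
    by (rule linear_scale[OF bounded_linear.linear[OF J_linear]]) simp
  then show ?thesis
    unfolding K_def by (simp add: J_commute[of "real (Suc n)" "real (Suc k)"] mult.commute del: of_nat_Suc)
qed

lemma A_linear: "bounded_linear (A n)"
  unfolding A_def[abs_def]
  by (intro bounded_linear_compose[OF bounded_linear_scaleR_right] bounded_linear_sub K.K_linear bounded_linear_ident)

lemma A_diff: "A n (f - g) = A n f - A n g"
  by (rule linear_diff[OF bounded_linear.linear[OF A_linear]])

lemma E_diff: "E n t (f - g) = E n t f - E n t g"
  unfolding E_def by (rule K.poisson_diff)

lemma E_contr: "0 \<le> t \<Longrightarrow> norm (E n t f) \<le> norm f"
  unfolding E_def by (intro K.poisson_contr) simp

lemma E_0: "E n 0 f = f"
  by (simp add: E_def K.poisson_0)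

lemma A_commutes_E: "A k (E n t f) = E n t (A k f)"
proof -
  have K: "K k (E n t f) = E n t (K k f)"
    unfolding E_def by (rule K.poisson_commute[OF K.K_linear]) (rule K_commute)
  show ?thesis unfolding A_def K E_diff[symmetric]
    unfolding E_def by (rule K.poisson_scaleR[symmetric])
qed

lemma E_derivative: "((\<lambda>t. E n t f) has_vector_derivative E n t (A n f)) (at t within S)"
proof -
  have 1: "((\<lambda>t. real (Suc n) * t) has_vector_derivative real (Suc n)) (at t)"
    by (auto intro!: derivative_eq_intros simp: has_real_derivative_iff_has_vector_derivative[symmetric])
  have "((poisson_semigroup_orbit \<circ> (\<lambda>t. real (Suc n) * t)) has_vector_derivative
      real (Suc n) *\<^sub>R poisson_semigroup (K n) (real (Suc n) * t) (K n f - f)) (at t)"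
    if "poisson_semigroup_orbit = (\<lambda>t. poisson_semigroup (K n) t f)" for poisson_semigroup_orbit
    unfolding that by (rule vector_diff_chain_at[OF 1 K.poisson_derivative])
  then have "((\<lambda>t. E n t f) has_vector_derivative E n t (A n f)) (at t)"
    by (simp add: E_def A_def o_def K.poisson_scaleR del: of_nat_Suc)
  then show ?thesis by (rule has_vector_derivative_at_within)
qed

lemma A_dissipative: "inner (A n f) f \<le> 0"
proof -
  have "inner (K n f) f \<le> norm (K n f) * norm f" by (rule norm_cauchy_schwarz)
  also have "\<dots> \<le> norm f * norm f" by (intro mult_right_mono K.K_contr) auto
  finally have "inner (K n f - f) f \<le> 0"
    by (simp add: inner_diff_left dot_square_norm power2_eq_square)
  then show ?thesis by (simp add: A_def mult_nonneg_nonpos)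
qed

lemma E_semigroup:
  assumes "0 \<le> s" "0 \<le> t" shows "E n (s + t) f = E n s (E n t f)"
proof -
  have "(norm (E n (s + t) f - E n s (E n t f)))\<^sup>2 \<le> exp s * s * 0\<^sup>2"
  proof (rule dissipative_growth[OF _ _ _ assms(1)])
    fix s :: real assume "0 \<le> s"
    have "((\<lambda>s. s + t) has_vector_derivative 1) (at s)"
      by (auto intro!: derivative_eq_intros simp: has_real_derivative_iff_has_vector_derivative[symmetric])
    from vector_diff_chain_at[OF this E_derivative[of n f "s + t" UNIV]]
    have "((\<lambda>s. E n (s + t) f) has_vector_derivative A n (E n (s + t) f)) (at s within {0..})"
      by (auto simp: o_def A_commutes_E intro: has_vector_derivative_at_within)
    then show "((\<lambda>s. E n (s + t) f - E n s (E n t f)) has_vector_derivative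
        A n (E n (s + t) f - E n s (E n t f))) (at s within {0..})"
      unfolding A_diff using E_derivative[of n "E n t f" s "{0..}"]
      by (auto intro: has_vector_derivative_diff simp: A_commutes_E)
    show "inner (A n (E n (s + t) f - E n s (E n t f))) (E n (s + t) f - E n s (E n t f))
        \<le> 0 * norm (E n (s + t) f - E n s (E n t f))"
      using A_dissipative by simp
  qed (simp add: E_0)
  then show ?thesis by simp
qed

text \<open>On its domain the generator maps \<open>J 1 g\<close> to \<open>J 1 g - g\<close>. So the Yosida approximations
  converge there, since \<open>K n\<close> tends strongly to the identity.\<close>

lemma A_on_domain: "A n (J 1 g) = K n (J 1 g - g)"
proof -
  have "A n (J 1 g) = real (Suc n) *\<^sub>R (real (Suc n) *\<^sub>R J (real (Suc n)) (J 1 g) - J 1 g)"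
    by (simp add: A_def K_def)
  also have "real (Suc n) *\<^sub>R J (real (Suc n)) (J 1 g) - J 1 g = J (real (Suc n)) (J 1 g) - J (real (Suc n)) g"
    using J_resolvent[of "real (Suc n)" 1 g] by (simp add: algebra_simps)
  also have "\<dots> = J (real (Suc n)) (J 1 g - g)"
    by (rule linear_diff[OF bounded_linear.linear[OF J_linear], symmetric]) simp
  finally show ?thesis by (simp add: K_def)
qed

lemma J_range: "0 < \<alpha> \<Longrightarrow> J \<alpha> f = J 1 (f - (\<alpha> - 1) *\<^sub>R J \<alpha> f)"
proof -
  assume l: "0 < \<alpha>"
  interpret J1: bounded_linear "J 1" by (rule J_linear) simp
  show ?thesis using J_resolvent[of 1 \<alpha> f] l by (simp add: J1.diff J1.add J1.scaleR algebra_simps)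
qed

lemma domain_dense: "\<exists>F. (\<forall>n. F n \<in> range (J 1)) \<and> F \<longlonglongrightarrow> f"
proof (intro exI conjI allI)
  show "(\<lambda>n. K n f) \<longlonglongrightarrow> f" unfolding K_def by (rule J_approx)
  show "K n f \<in> range (J 1)" for n
  proof -
    interpret J1: bounded_linear "J 1" by (rule J_linear) simp
    show ?thesis unfolding K_def using J_range[of "real (Suc n)" f]
      by (metis J1.scaleR of_nat_0_less_iff rangeI zero_less_Suc)
  qed
qed

lemma domain_approx:
  assumes "0 < \<epsilon>" obtains g where "norm (f - J 1 g) < \<epsilon>"
proof -
  obtain F where F: "\<And>n. F n \<in> range (J 1)" "F \<longlonglongrightarrow> f" using domain_dense by blast
  obtain n where "norm (F n - f) < \<epsilon>" using LIMSEQ_D[OF F(2) assms] by blast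
  then show thesis using F(1)[of n] that by (auto simp: norm_minus_commute)
qed

text \<open>The approximating semigroups commute with each other's generators, so the difference \<open>w\<close> of two
  orbits satisfies \<open>w' = A n w + r\<close> with \<open>\<parallel>r\<parallel> \<le> \<parallel>A n f - A k f\<parallel>\<close>.\<close>

lemma E_Cauchy_domain:
  assumes t: "0 \<le> t" shows "(norm (E n t f - E k t f))\<^sup>2 \<le> exp t * t * (norm (A n f - A k f))\<^sup>2"
proof (rule dissipative_growth[OF _ _ _ t])
  fix s :: real assume s: "0 \<le> s"
  show "((\<lambda>s. E n s f - E k s f) has_vector_derivative E n s (A n f) - E k s (A k f)) (at s within {0..})"
    by (intro has_vector_derivative_diff E_derivative)
  have "E n s (A n f) - E k s (A k f) = A n (E n s f - E k s f) + E k s (A n f - A k f)"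
    by (simp add: A_diff E_diff A_commutes_E)
  then have "inner (E n s (A n f) - E k s (A k f)) (E n s f - E k s f)
     = inner (A n (E n s f - E k s f)) (E n s f - E k s f) + inner (E k s (A n f - A k f)) (E n s f - E k s f)"
    by (simp add: inner_add_left)
  also have "\<dots> \<le> 0 + norm (E k s (A n f - A k f)) * norm (E n s f - E k s f)"
    by (intro add_mono A_dissipative norm_cauchy_schwarz)
  also have "\<dots> \<le> norm (A n f - A k f) * norm (E n s f - E k s f)"
    using s by (auto intro!: mult_right_mono E_contr)
  finally show "inner (E n s (A n f) - E k s (A k f)) (E n s f - E k s f)
     \<le> norm (A n f - A k f) * norm (E n s f - E k s f)" .
qed (simp add: E_0)

lemma E_convergent:
  assumes t: "0 \<le> t" shows "convergent (\<lambda>n. E n t f)"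
proof -
  have dom: "Cauchy (\<lambda>n. E n t (J 1 g))" for g
  proof (rule CauchyI)
    fix e :: real assume e: "0 < e"
    define \<delta> where "\<delta> = e / sqrt (exp t * t + 1)"
    have pos: "0 < exp t * t + 1" using t by (simp add: add_nonneg_pos)
    have \<delta>: "0 < \<delta>" using e pos by (simp add: \<delta>_def)
    have "Cauchy (\<lambda>n. A n (J 1 g))"
      unfolding A_on_domain K_def by (rule LIMSEQ_imp_Cauchy[OF J_approx])
    then obtain M where M: "\<And>m n. M \<le> m \<Longrightarrow> M \<le> n \<Longrightarrow> norm (A m (J 1 g) - A n (J 1 g)) < \<delta>"
      using CauchyD \<delta> by blast
    show "\<exists>M. \<forall>m\<ge>M. \<forall>n\<ge>M. norm (E m t (J 1 g) - E n t (J 1 g)) < e"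
    proof (intro exI[of _ M] allI impI)
      fix m n assume mn: "M \<le> m" "M \<le> n"
      have "(norm (E m t (J 1 g) - E n t (J 1 g)))\<^sup>2 \<le> exp t * t * (norm (A m (J 1 g) - A n (J 1 g)))\<^sup>2"
        by (rule E_Cauchy_domain[OF t])
      also have "\<dots> \<le> exp t * t * \<delta>\<^sup>2"
        using M[OF mn] t by (intro mult_left_mono power_mono) auto
      also have "\<dots> < (exp t * t + 1) * \<delta>\<^sup>2" using \<delta> by (simp add: distrib_right)
      also have "\<dots> = e\<^sup>2" using pos by (simp add: \<delta>_def power_divide)
      finally show "norm (E m t (J 1 g) - E n t (J 1 g)) < e" using e by (simp add: power_less_imp_less_base)
    qed
  qed
  have "Cauchy (\<lambda>n. E n t f)"
  proof (rule CauchyI)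
    fix e :: real assume e: "0 < e"
    obtain g where g: "norm (f - J 1 g) < e / 3" using domain_approx[of "e / 3"] e by auto
    obtain M where M: "\<And>m n. M \<le> m \<Longrightarrow> M \<le> n \<Longrightarrow> norm (E m t (J 1 g) - E n t (J 1 g)) < e / 3"
      using CauchyD[OF dom[of g], of "e / 3"] e by auto
    show "\<exists>M. \<forall>m\<ge>M. \<forall>n\<ge>M. norm (E m t f - E n t f) < e"
    proof (intro exI[of _ M] allI impI)
      fix m n assume mn: "M \<le> m" "M \<le> n"
      have "E m t f - E n t f = E m t (f - J 1 g) + (E m t (J 1 g) - E n t (J 1 g)) - E n t (f - J 1 g)"
        by (simp add: E_diff)
      also have "norm \<dots> \<le> norm (E m t (f - J 1 g)) + norm (E m t (J 1 g) - E n t (J 1 g)) + norm (E n t (f - J 1 g))"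
        by (intro order_trans[OF norm_triangle_ineq4] add_mono norm_triangle_ineq order_refl)
      also have "\<dots> < e" using E_contr[OF t, of m "f - J 1 g"] E_contr[OF t, of n "f - J 1 g"] g M[OF mn] by linarith
      finally show "norm (E m t f - E n t f) < e" .
    qed
  qed
  then show ?thesis by (simp add: Cauchy_convergent_iff)
qed

definition T :: "real \<Rightarrow> 'h \<Rightarrow> 'h" where "T t f = lim (\<lambda>n. E n t f)"

lemma T_limit: "0 \<le> t \<Longrightarrow> (\<lambda>n. E n t f) \<longlonglongrightarrow> T t f"
  unfolding T_def using E_convergent by (simp add: convergent_LIMSEQ_iff)

lemma T_contr: "0 \<le> t \<Longrightarrow> norm (T t f) \<le> norm f"
  by (rule LIMSEQ_le_const2[OF tendsto_norm[OF T_limit]]) (auto intro: E_contr)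

lemma T_linear:
  assumes t: "0 \<le> t" shows "bounded_linear (T t)"
proof (rule bounded_linear_intro[where K = 1])
  fix f g :: 'h and r :: real
  have "(\<lambda>n. E n t (f + g)) \<longlonglongrightarrow> T t f + T t g"
    unfolding E_def K.poisson_add using T_limit[OF t, unfolded E_def] by (intro tendsto_add)
  then show "T t (f + g) = T t f + T t g" using T_limit[OF t] LIMSEQ_unique by blast
  have "(\<lambda>n. E n t (r *\<^sub>R f)) \<longlonglongrightarrow> r *\<^sub>R T t f"
    unfolding E_def K.poisson_scaleR using T_limit[OF t, unfolded E_def] by (intro tendsto_scaleR tendsto_const)
  then show "T t (r *\<^sub>R f) = r *\<^sub>R T t f" using T_limit[OF t] LIMSEQ_unique by blast
  show "norm (T t f) \<le> norm f * 1" using T_contr[OF t] by simp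
qed

lemma E_mean_value:
  assumes t: "0 \<le> t" and B: "\<And>s. 0 \<le> s \<Longrightarrow> s \<le> t \<Longrightarrow> norm (E n s (A n f) - v) \<le> B"
  shows "norm (E n t f - f - t *\<^sub>R v) \<le> t * B"
proof -
  define F where "F s = E n s f - s *\<^sub>R v" for s
  have "norm (F t - F 0) \<le> B * norm (t - 0)"
  proof (rule differentiable_bound[where S = "{0..t}"])
    fix s assume s: "s \<in> {0..t}"
    have "(F has_vector_derivative E n s (A n f) - v) (at s within {0..t})"
      unfolding F_def[abs_def] by (auto intro!: derivative_eq_intros E_derivative)
    then show "(F has_derivative (\<lambda>h. h *\<^sub>R (E n s (A n f) - v))) (at s within {0..t})"
      by (simp add: has_vector_derivative_def)
    show "onorm (\<lambda>h. h *\<^sub>R (E n s (A n f) - v)) \<le> B"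
    proof (rule onorm_le)
      fix h :: real
      show "norm (h *\<^sub>R (E n s (A n f) - v)) \<le> B * norm h"
        using B[of s] s mult_left_mono[of "norm (E n s (A n f) - v)" B "\<bar>h\<bar>"] by (simp add: mult.commute)
    qed
  qed (use t in auto)
  then show ?thesis using t by (simp add: F_def E_0 algebra_simps)
qed

text \<open>Uniformity in \<open>n\<close> is the point: it passes strong continuity, and below the value of the
  generator, to the limit.\<close>

lemma E_equicontinuous:
  assumes "0 < \<epsilon>"
  obtains \<delta> where "0 < \<delta>" "\<And>n t. 0 \<le> t \<Longrightarrow> t \<le> \<delta> \<Longrightarrow> norm (E n t f - f) \<le> \<epsilon>"
proof -
  obtain g where g: "norm (f - J 1 g) < \<epsilon> / 4" using domain_approx[of "\<epsilon> / 4"] assms by auto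
  define c where "c = norm (J 1 g - g)"
  define \<delta> where "\<delta> = \<epsilon> / (2 * (c + 1))"
  have c: "0 \<le> c" by (simp add: c_def)
  have "norm (E n t f - f) \<le> \<epsilon>" if t: "0 \<le> t" "t \<le> \<delta>" for n t
  proof -
    have "norm (E n t (J 1 g) - J 1 g - t *\<^sub>R 0) \<le> t * c"
    proof (rule E_mean_value[OF t(1)])
      fix s :: real assume "0 \<le> s"
      then have "norm (E n s (A n (J 1 g))) \<le> norm (A n (J 1 g))" by (rule E_contr)
      also have "\<dots> \<le> c" unfolding A_on_domain c_def by (rule K.K_contr)
      finally show "norm (E n s (A n (J 1 g)) - 0) \<le> c" by simp
    qed
    also have "t * c \<le> \<delta> * (c + 1)" using t c by (intro mult_mono) auto
    also have "\<dots> = \<epsilon> / 2" using c by (simp add: \<delta>_def field_simps)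
    finally have 1: "norm (E n t (J 1 g) - J 1 g) \<le> \<epsilon> / 2" by simp
    have "E n t f - f = E n t (f - J 1 g) + (E n t (J 1 g) - J 1 g) - (f - J 1 g)"
      by (simp add: E_diff)
    also have "norm \<dots> \<le> norm (E n t (f - J 1 g)) + norm (E n t (J 1 g) - J 1 g) + norm (f - J 1 g)"
      by (intro order_trans[OF norm_triangle_ineq4] add_mono norm_triangle_ineq order_refl)
    also have "\<dots> \<le> \<epsilon>" using E_contr[OF t(1), of n "f - J 1 g"] g 1 by linarith
    finally show ?thesis .
  qed
  moreover have "0 < \<delta>" using assms c by (simp add: \<delta>_def)
  ultimately show thesis using that by blast
qed

lemma T_c0: "c0_semigroup T"
  unfolding c0_semigroup_def
proof (intro conjI allI impI)
  show "bounded_linear (T t)" if "0 \<le> t" for t using that by (rule T_linear)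
  show "T 0 f = f" for f using T_limit[of 0 f] by (simp add: E_0 LIMSEQ_const_iff)
  fix f
  show "((\<lambda>t. T t f) \<longlongrightarrow> f) (at_right 0)"
  proof (rule tendstoI)
    fix e :: real assume e: "0 < e"
    obtain \<delta> where \<delta>: "0 < \<delta>" "\<And>n t. 0 \<le> t \<Longrightarrow> t \<le> \<delta> \<Longrightarrow> norm (E n t f - f) \<le> e / 2"
      using E_equicontinuous[of "e / 2" f] e by auto
    have "dist (T t f) f < e" if t: "0 < t" "t < \<delta>" for t
    proof -
      have "norm (T t f - f) \<le> e / 2"
      proof (rule LIMSEQ_le_const2)
        show "(\<lambda>n. norm (E n t f - f)) \<longlonglongrightarrow> norm (T t f - f)"
          using t by (intro tendsto_norm tendsto_diff T_limit tendsto_const) simp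
        show "\<exists>N. \<forall>n\<ge>N. norm (E n t f - f) \<le> e / 2" using \<delta>(2)[of t] t by simp
      qed
      then show ?thesis using e by (simp add: dist_norm)
    qed
    then show "\<forall>\<^sub>F t in at_right 0. dist (T t f) f < e"
      unfolding eventually_at_right_field using \<delta>(1) by blast
  qed
next
  fix s t :: real and f assume st: "0 \<le> s" "0 \<le> t"
  have "(\<lambda>n. E n s (E n t f) - E n s (T t f)) \<longlonglongrightarrow> 0"
  proof (rule Lim_null_comparison)
    show "\<forall>\<^sub>F n in sequentially. norm (E n s (E n t f) - E n s (T t f)) \<le> norm (E n t f - T t f)"
      using E_contr[OF st(1)] by (simp add: E_diff[symmetric])
    show "(\<lambda>n. norm (E n t f - T t f)) \<longlonglongrightarrow> 0"
      using T_limit[OF st(2), of f] by (simp add: LIM_zero tendsto_norm_zero)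
  qed
  from tendsto_add[OF this T_limit[OF st(1), of "T t f"]]
  have "(\<lambda>n. E n (s + t) f) \<longlonglongrightarrow> T s (T t f)" by (simp add: E_semigroup[OF st])
  then show "T (s + t) f = T s (T t f)" using T_limit[of "s + t" f] st LIMSEQ_unique by fastforce
qed

lemma domain_in_generator: "(J 1 g, J 1 g - g) \<in> generator T"
  unfolding generator_def mem_Collect_eq case_prod_conv
proof (rule tendstoI)
  fix e :: real assume e: "0 < e"
  define f v where "f = J 1 g" and "v = J 1 g - g"
  obtain \<delta> where \<delta>: "0 < \<delta>" "\<And>n t. 0 \<le> t \<Longrightarrow> t \<le> \<delta> \<Longrightarrow> norm (E n t v - v) \<le> e / 2"
    using E_equicontinuous[of "e / 2" v] e by auto
  have An: "(\<lambda>n. A n f) \<longlonglongrightarrow> v"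
    unfolding f_def A_on_domain K_def v_def by (rule J_approx)
  have "dist ((T t f - f) /\<^sub>R t) v < e" if t: "0 < t" "t < \<delta>" for t
  proof -
    have "norm (T t f - f - t *\<^sub>R v) \<le> t * (e / 2 + norm (v - v))"
    proof (rule tendsto_le[OF sequentially_bot])
      show "(\<lambda>n. norm (E n t f - f - t *\<^sub>R v)) \<longlonglongrightarrow> norm (T t f - f - t *\<^sub>R v)"
        using t by (intro tendsto_intros T_limit) auto
      show "(\<lambda>n. t * (e / 2 + norm (A n f - v))) \<longlonglongrightarrow> t * (e / 2 + norm (v - v))"
        by (intro tendsto_intros An)
      show "\<forall>\<^sub>F n in sequentially. norm (E n t f - f - t *\<^sub>R v) \<le> t * (e / 2 + norm (A n f - v))"
      proof (intro always_eventually allI E_mean_value)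
        fix n s assume s: "0 \<le> s" "s \<le> t"
        have "E n s (A n f) - v = (E n s v - v) + E n s (A n f - v)" by (simp add: E_diff)
        also have "norm \<dots> \<le> norm (E n s v - v) + norm (E n s (A n f - v))" by (rule norm_triangle_ineq)
        also have "\<dots> \<le> e / 2 + norm (A n f - v)" using s t by (intro add_mono \<delta>(2) E_contr) auto
        finally show "norm (E n s (A n f) - v) \<le> e / 2 + norm (A n f - v)" .
      qed (use t in auto)
    qed
    then have le: "norm (T t f - f - t *\<^sub>R v) / t \<le> e / 2" using t by (simp add: field_simps)
    have eq: "(T t f - f) /\<^sub>R t - v = (T t f - f - t *\<^sub>R v) /\<^sub>R t" using t by (simp add: scaleR_diff_right)
    have "norm ((T t f - f) /\<^sub>R t - v) = norm (T t f - f - t *\<^sub>R v) / t"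
      unfolding eq norm_scaleR using t by (simp add: divide_inverse_commute)
    then show ?thesis using le e unfolding dist_norm by linarith
  qed
  then have "\<forall>\<^sub>F t in at_right 0. dist ((T t f - f) /\<^sub>R t) v < e"
    unfolding eventually_at_right_field by (intro exI[of _ \<delta>]) (simp add: \<delta>(1))
  then show "\<forall>\<^sub>F t in at_right 0. dist ((T t (J 1 g) - J 1 g) /\<^sub>R t) (J 1 g - g) < e"
    unfolding f_def v_def .
qed

text \<open>The inclusion from right to left is \<open>domain_in_generator\<close>. Conversely, \<open>1 - A\<close> is already onto
  when restricted to the range of \<open>J 1\<close>, and it is injective on the whole domain because \<open>A\<close> is dissipative;
  so the domain cannot be larger.\<close>

theorem generator_T: "generator T = {(J 1 g, J 1 g - g) |g. True}"
proof (intro equalityI subsetI)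
  fix z assume "z \<in> generator T"
  then obtain f h where z: "z = (f, h)" and fh: "(f, h) \<in> generator T" by (cases z) auto
  define g where "g = f - h"
  have "(f - J 1 g, h - (J 1 g - g)) \<in> generator T"
    by (rule generator_linear[OF T_c0 fh domain_in_generator])
  then have "inner (h - (J 1 g - g)) (f - J 1 g) \<le> 0"
    using contraction_generator_dissipative[of T] T_contr by blast
  moreover have "h - (J 1 g - g) = f - J 1 g" by (simp add: g_def)
  ultimately have "(norm (f - J 1 g))\<^sup>2 \<le> 0" by (simp only: power2_norm_eq_inner)
  then have "f = J 1 g" by simp
  then show "z \<in> {(J 1 g, J 1 g - g) |g. True}" unfolding z by (auto simp: g_def)
qed (use domain_in_generator in auto)

theorem T_functional_bound:
  fixes \<phi> :: "'h \<Rightarrow> real"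
  assumes \<phi>: "bounded_linear \<phi>" and le: "\<And>n k. \<phi> ((K n ^^ k) f) \<le> c" and t: "0 \<le> t"
  shows "\<phi> (T t f) \<le> c"
proof (rule LIMSEQ_le_const2)
  show "(\<lambda>n. \<phi> (E n t f)) \<longlonglongrightarrow> \<phi> (T t f)"
    by (rule bounded_linear.tendsto[OF \<phi> T_limit[OF t]])
  show "\<exists>N. \<forall>n\<ge>N. \<phi> (E n t f) \<le> c"
    unfolding E_def using K.poisson_functional_bound[OF \<phi> le] t by auto
qed

end

section \<open>Form, Green formula and form operator\<close>

locale graph_measure =
  fixes b :: "'a::countable \<Rightarrow> 'a \<Rightarrow> real" and m :: "'a \<Rightarrow> real"
  assumes m_pos: "\<And>x. 0 < m x" and graph: "weighted_graph b"
begin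

lemma m_nonneg [simp]: "0 \<le> m x"
  using m_pos[of x] by simp

lemma m_nonzero [simp]: "m x \<noteq> 0"
  using m_pos[of x] by simp

lemma b_nonneg [simp]: "0 \<le> b x y" and b_commute: "b x y = b y x"   and b_summable: "b x summable_on UNIV"
  using graph by (auto simp: weighted_graph_def)

end

text \<open>Sums over pairs are reduced to sums over rows without absolute summability, because only
  finitely many rows are nonzero.\<close>

lemma has_sum_rows:
  fixes k :: "'b \<Rightarrow> 'b \<Rightarrow> real"
  assumes F: "finite F" and row: "\<And>x. x \<in> F \<Longrightarrow> (k x has_sum S x) UNIV"
    and out: "\<And>x y. x \<notin> F \<Longrightarrow> k x y = 0"
  shows "((\<lambda>(x, y). k x y) has_sum sum S F) UNIV"
proof -
  have "((\<lambda>(x, y). k x y) has_sum sum S F) (\<Union>x\<in>F. Pair x ` UNIV)"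
  proof (rule sum_has_sum[OF F])
    fix x assume "x \<in> F"
    then show "((\<lambda>(x, y). k x y) has_sum S x) (Pair x ` UNIV)"
      by (subst has_sum_reindex) (auto simp: inj_on_def o_def row)
  qed auto
  then show ?thesis
    by (subst (asm) has_sum_cong_neutral[where T = UNIV and g = "\<lambda>(x, y). k x y"]) (auto simp: image_iff intro: out)
qed

context graph_measure
begin

definition laplacian :: "('a \<Rightarrow> real) \<Rightarrow> 'a \<Rightarrow> real" where
  "laplacian u x = (\<Sum>\<^sub>\<infinity>y. b x y * (u x - u y))"

text \<open>The isometry onto the unweighted space and its inverse, and the gradient, which
  turns \<^const>\<open>energy_form\<close> into an inner product.\<close>

definition emb :: "('a \<Rightarrow> real) \<Rightarrow> 'a l2" where
  "emb f = mk_l2 (\<lambda>x. sqrt (m x) * f x)"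

definition prj :: "'a l2 \<Rightarrow> 'a \<Rightarrow> real" where
  "prj v = (\<lambda>x. coord v x / sqrt (m x))"

definition grad :: "('a \<Rightarrow> real) \<Rightarrow> ('a \<times> 'a) l2" where
  "grad f = mk_l2 (\<lambda>(x, y). sqrt (b x y / 2) * (f x - f y))"

lemma sqrt_m_pos [simp]: "0 < sqrt (m x)" "sqrt (m x) \<noteq> 0"
  using m_pos[of x] by auto

lemma ell2_iff: "f \<in> ell2 m \<longleftrightarrow> (\<lambda>x. (sqrt (m x) * f x)\<^sup>2) summable_on UNIV"
  by (simp add: ell2_def power_mult_distrib)

lemma coord_emb: "f \<in> ell2 m \<Longrightarrow> coord (emb f) x = sqrt (m x) * f x"
  by (simp add: emb_def ell2_iff coord_mk_l2)

lemma prj_ell2 [simp]: "prj v \<in> ell2 m"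
  by (simp add: ell2_iff prj_def square_summable)

lemma emb_prj [simp]: "emb (prj v) = v"
  by (rule l2_eqI) (simp add: coord_emb, simp add: prj_def)

lemma prj_emb: "f \<in> ell2 m \<Longrightarrow> prj (emb f) = f"
  by (simp add: prj_def coord_emb)

lemma prj_lincomb: "prj (\<alpha> *\<^sub>R v + \<beta> *\<^sub>R w) = (\<lambda>x. \<alpha> * prj v x + \<beta> * prj w x)"
  by (simp add: prj_def add_divide_distrib)

lemma ell2_lincomb:
  assumes "f \<in> ell2 m" "g \<in> ell2 m"
  shows "(\<lambda>x. \<alpha> * f x + \<beta> * g x) \<in> ell2 m"
    "emb (\<lambda>x. \<alpha> * f x + \<beta> * g x) = \<alpha> *\<^sub>R emb f + \<beta> *\<^sub>R emb g"
proof -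
  have "(\<lambda>x. \<alpha> * f x + \<beta> * g x) = prj (\<alpha> *\<^sub>R emb f + \<beta> *\<^sub>R emb g)"
    by (simp add: prj_lincomb prj_emb assms)
  then show "(\<lambda>x. \<alpha> * f x + \<beta> * g x) \<in> ell2 m"
    "emb (\<lambda>x. \<alpha> * f x + \<beta> * g x) = \<alpha> *\<^sub>R emb f + \<beta> *\<^sub>R emb g" by simp_all
qed

lemma ell2_diff:
  assumes "f \<in> ell2 m" "g \<in> ell2 m"
  shows "(\<lambda>x. f x - g x) \<in> ell2 m" "emb (\<lambda>x. f x - g x) = emb f - emb g"
  using ell2_lincomb[OF assms, of 1 "-1"] by simp_all

lemma ell2_inner_emb: "f \<in> ell2 m \<Longrightarrow> g \<in> ell2 m \<Longrightarrow> ell2_inner m f g = inner (emb f) (emb g)"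
  by (auto simp: ell2_inner_def inner_l2_def coord_emb mult_ac intro!: infsum_cong)

lemma ell2_norm_emb: "f \<in> ell2 m \<Longrightarrow> ell2_norm m f = norm (emb f)"
  by (simp add: ell2_norm_def ell2_inner_emb norm_eq_sqrt_inner)

lemma ell2_dominated:
  assumes "g \<in> ell2 m" "\<And>x. \<bar>f x\<bar> \<le> \<bar>g x\<bar>" shows "f \<in> ell2 m"
proof -
  have "(\<lambda>x. m x * (g x)\<^sup>2) summable_on UNIV" using assms(1) by (simp add: ell2_def)
  then have "(\<lambda>x. m x * (f x)\<^sup>2) summable_on UNIV"
  proof (rule summable_on_real_comparison)
    fix x
    have "(f x)\<^sup>2 \<le> (g x)\<^sup>2" using assms(2)[of x] by (simp add: abs_le_square_iff)
    then show "\<bar>m x * (f x)\<^sup>2\<bar> \<le> m x * (g x)\<^sup>2" by (simp add: mult_left_mono)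
  qed
  then show ?thesis by (simp add: ell2_def)
qed

lemma emb_dominated_convergence:
  assumes g: "g \<in> ell2 m" and dom: "\<And>n x. \<bar>f n x\<bar> \<le> \<bar>g x\<bar>" and lim: "\<And>x. (\<lambda>n. f n x) \<longlonglongrightarrow> h x"
  shows "h \<in> ell2 m" "(\<lambda>n. emb (f n)) \<longlonglongrightarrow> emb h"
proof -
  have hdom: "\<bar>h x\<bar> \<le> \<bar>g x\<bar>" for x
    using LIMSEQ_le_const2[OF tendsto_rabs[OF lim[of x]], of "\<bar>g x\<bar>"] dom by blast
  show h: "h \<in> ell2 m" by (rule ell2_dominated[OF g hdom])
  have f: "f n \<in> ell2 m" for n by (rule ell2_dominated[OF g dom])
  show "(\<lambda>n. emb (f n)) \<longlonglongrightarrow> emb h"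
  proof (rule l2_dominated_convergence[where w = "emb g"])
    show "\<bar>coord (emb (f n)) x\<bar> \<le> \<bar>coord (emb g) x\<bar>" for n x
      using dom[of n x] by (simp add: coord_emb f g abs_mult mult_left_mono)
    show "(\<lambda>n. coord (emb (f n)) x) \<longlonglongrightarrow> coord (emb h) x" for x
      unfolding coord_emb[OF f] coord_emb[OF h] by (intro tendsto_intros lim)
  qed
qed

lemma finite_energy_iff: "f \<in> finite_energy b \<longleftrightarrow> (\<lambda>(x, y). (sqrt (b x y / 2) * (f x - f y))\<^sup>2) summable_on UNIV"
proof -
  have "(\<lambda>(x, y). (sqrt (b x y / 2) * (f x - f y))\<^sup>2) = (\<lambda>z. (1/2) * (case z of (x, y) \<Rightarrow> b x y * (f x - f y)\<^sup>2))"
    by (auto simp: fun_eq_iff power_mult_distrib)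
  moreover have "(\<lambda>z. (1/2) * (case z of (x, y) \<Rightarrow> b x y * (f x - f y)\<^sup>2)) summable_on UNIV \<longleftrightarrow> f \<in> finite_energy b"
    unfolding finite_energy_def by (subst summable_on_cmult_right') auto
  ultimately show ?thesis by simp
qed

lemma coord_grad: "f \<in> finite_energy b \<Longrightarrow> coord (grad f) (x, y) = sqrt (b x y / 2) * (f x - f y)"
  unfolding grad_def by (subst coord_mk_l2) (auto simp: finite_energy_iff case_prod_unfold)

lemma energy_form_grad:
  assumes "f \<in> finite_energy b" "g \<in> finite_energy b"
  shows "energy_form b f g = inner (grad f) (grad g)"
proof -
  have "inner (grad f) (grad g) = (\<Sum>\<^sub>\<infinity>z. (1/2) * (case z of (x, y) \<Rightarrow> b x y * (f x - f y) * (g x - g y)))"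
    unfolding inner_l2_def
    by (intro infsum_cong) (auto simp: coord_grad[OF assms(1)] coord_grad[OF assms(2)] mult_ac)
  also have "\<dots> = energy_form b f g" unfolding energy_form_def by (rule infsum_cmult_right')
  finally show ?thesis by simp
qed

lemma finite_energy_lincomb:
  assumes "f \<in> finite_energy b" "g \<in> finite_energy b"
  shows "(\<lambda>x. \<alpha> * f x + \<beta> * g x) \<in> finite_energy b"
    "grad (\<lambda>x. \<alpha> * f x + \<beta> * g x) = \<alpha> *\<^sub>R grad f + \<beta> *\<^sub>R grad g"
proof -
  have "(sqrt (b x y / 2) * ((\<alpha> * f x + \<beta> * g x) - (\<alpha> * f y + \<beta> * g y)))\<^sup>2
     = (coord (\<alpha> *\<^sub>R grad f + \<beta> *\<^sub>R grad g) (x, y))\<^sup>2" for x y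
    by (simp add: coord_grad assms algebra_simps)
  then have "(\<lambda>(x, y). (sqrt (b x y / 2) * ((\<alpha> * f x + \<beta> * g x) - (\<alpha> * f y + \<beta> * g y)))\<^sup>2)
      = (\<lambda>z. (coord (\<alpha> *\<^sub>R grad f + \<beta> *\<^sub>R grad g) z)\<^sup>2)"
    by (auto simp: fun_eq_iff)
  then show *: "(\<lambda>x. \<alpha> * f x + \<beta> * g x) \<in> finite_energy b"
    unfolding finite_energy_iff by (simp only: square_summable)
  show "grad (\<lambda>x. \<alpha> * f x + \<beta> * g x) = \<alpha> *\<^sub>R grad f + \<beta> *\<^sub>R grad g"
    by (rule l2_eqI) (auto simp: coord_grad * assms algebra_simps split: prod.splits)
qed

lemma finite_energy_diff:
  assumes "f \<in> finite_energy b" "g \<in> finite_energy b"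
  shows "(\<lambda>x. f x - g x) \<in> finite_energy b" "grad (\<lambda>x. f x - g x) = grad f - grad g"
  using finite_energy_lincomb[OF assms, of 1 "-1"] by simp_all

lemma finite_support_has_sum:
  fixes f :: "'b \<Rightarrow> real"
  assumes "finite F" "\<And>x. x \<notin> F \<Longrightarrow> f x = 0"
  shows "(f has_sum sum f F) UNIV"
  using has_sum_finite[of F f] assms
  by (subst (asm) has_sum_cong_neutral[where T = UNIV and g = f]) auto

lemma finitely_supported_ell2:
  assumes "h \<in> finitely_supported" shows "h \<in> ell2 m"
proof -
  have "finite {x. h x \<noteq> 0}" using assms by (simp add: finitely_supported_def)
  from finite_support_has_sum[OF this, of "\<lambda>x. m x * (h x)\<^sup>2"]
  show ?thesis by (auto simp: ell2_def intro: has_sum_imp_summable)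
qed

lemma finitely_supported_finite_energy:
  assumes "h \<in> finitely_supported" shows "h \<in> finite_energy b"
proof -
  define F where "F = {x. h x \<noteq> 0}"
  have F: "finite F" using assms by (simp add: finitely_supported_def F_def)
  have "((\<lambda>(x, y). 2 * (b x y * (h x)\<^sup>2)) has_sum (\<Sum>x\<in>F. (\<Sum>\<^sub>\<infinity>y. 2 * (b x y * (h x)\<^sup>2)))) UNIV"
    by (rule has_sum_rows[OF F]) (auto simp: F_def intro!: has_sum_infsum summable_on_cmult_right summable_on_cmult_left b_summable)
  then have 1: "(\<lambda>(x, y). 2 * (b x y * (h x)\<^sup>2)) summable_on UNIV" by (rule has_sum_imp_summable)
  have inj: "inj_on prod.swap (UNIV :: ('a \<times> 'a) set)" by simp
  have "(\<lambda>(x, y). 2 * (b y x * (h y)\<^sup>2)) summable_on UNIV"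
    using 1 summable_on_reindex[OF inj, of "\<lambda>(x, y). 2 * (b x y * (h x)\<^sup>2)"]
    by (simp add: o_def case_prod_unfold)
  moreover have "2 * (b y x * (h y)\<^sup>2) = 2 * (b x y * (h y)\<^sup>2)" for x y by (simp add: b_commute[of y x])
  ultimately have 2: "(\<lambda>(x, y). 2 * (b x y * (h y)\<^sup>2)) summable_on UNIV" by (simp only:)
  have "(\<lambda>(x, y). b x y * (h x - h y)\<^sup>2) summable_on UNIV"
  proof (rule summable_on_real_comparison)
    show "(\<lambda>z. (\<lambda>(x, y). 2 * (b x y * (h x)\<^sup>2)) z + (\<lambda>(x, y). 2 * (b x y * (h y)\<^sup>2)) z) summable_on UNIV"
      by (rule summable_on_add[OF 1 2])
    fix z :: "'a \<times> 'a"
    obtain x y where z: "z = (x, y)" by (cases z)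
    have "(h x - h y)\<^sup>2 \<le> 2 * (h x)\<^sup>2 + 2 * (h y)\<^sup>2"
      using sum_squares_bound[of "h x" "- h y"] by (simp add: power2_diff)
    then have "b x y * (h x - h y)\<^sup>2 \<le> b x y * (2 * (h x)\<^sup>2 + 2 * (h y)\<^sup>2)" by (rule mult_left_mono) simp
    then show "\<bar>case z of (x, y) \<Rightarrow> b x y * (h x - h y)\<^sup>2\<bar>
       \<le> (\<lambda>(x, y). 2 * (b x y * (h x)\<^sup>2)) z + (\<lambda>(x, y). 2 * (b x y * (h y)\<^sup>2)) z"
      by (simp add: z algebra_simps)
  qed
  then show ?thesis by (simp add: finite_energy_def)
qed

text \<open>Finite energy makes the formal Laplacian converge, since \<open>\<bar>t\<bar> \<le> 1 + t\<^sup>2\<close> and the rows of \<open>b\<close>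
  are summable.\<close>

lemma row_summable:
  assumes u: "u \<in> finite_energy b"
  shows "(\<lambda>y. b x y * (u x - u y)) summable_on UNIV" "(\<lambda>y. b x y * u y) summable_on UNIV"
proof -
  have "(\<lambda>(x, y). b x y * (u x - u y)\<^sup>2) summable_on (Pair x ` UNIV)"
  proof (rule summable_on_subset_banach)
    show "(\<lambda>(x, y). b x y * (u x - u y)\<^sup>2) summable_on UNIV" using u by (simp add: finite_energy_def)
  qed simp
  then have sq: "(\<lambda>y. b x y * (u x - u y)\<^sup>2) summable_on UNIV"
    by (subst (asm) summable_on_reindex) (simp_all add: inj_on_def o_def)
  show 1: "(\<lambda>y. b x y * (u x - u y)) summable_on UNIV"
  proof (rule summable_on_real_comparison)
    show "(\<lambda>y. b x y + b x y * (u x - u y)\<^sup>2) summable_on UNIV"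
      by (intro summable_on_add sq b_summable)
    fix y
    have "\<bar>u x - u y\<bar> \<le> 1 + (u x - u y)\<^sup>2"
    proof -
      have "s \<le> 1 + s\<^sup>2" if "0 \<le> s" for s :: real
        using sum_squares_bound[of 1 s] that by simp
      from this[of "\<bar>u x - u y\<bar>"] show ?thesis by simp
    qed
    then have "b x y * \<bar>u x - u y\<bar> \<le> b x y * (1 + (u x - u y)\<^sup>2)" by (rule mult_left_mono) simp
    then show "\<bar>b x y * (u x - u y)\<bar> \<le> b x y + b x y * (u x - u y)\<^sup>2"
      by (simp add: abs_mult distrib_left)
  qed
  have "(\<lambda>y. b x y * u x + - (b x y * (u x - u y))) summable_on UNIV"
    by (intro summable_on_add summable_on_cmult_left b_summable summable_on_uminus[THEN iffD2] 1)
  then show "(\<lambda>y. b x y * u y) summable_on UNIV" by (simp add: algebra_simps)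
qed

lemma laplacian_alt:
  assumes "(\<lambda>y. b x y * u y) summable_on UNIV"
  shows "laplacian u x = (\<Sum>\<^sub>\<infinity>y. b x y) * u x - (\<Sum>\<^sub>\<infinity>y. b x y * u y)"
proof -
  have "laplacian u x = (\<Sum>\<^sub>\<infinity>y. b x y * u x + - (b x y * u y))"
    by (simp add: laplacian_def algebra_simps)
  also have "\<dots> = (\<Sum>\<^sub>\<infinity>y. b x y * u x) + (\<Sum>\<^sub>\<infinity>y. - (b x y * u y))"
    by (intro infsum_add summable_on_cmult_left b_summable summable_on_uminus[THEN iffD2] assms)
  finally show ?thesis by (simp add: infsum_cmult_left' infsum_uminus)
qed

lemma green_formula:
  assumes u: "u \<in> finite_energy b" and F: "finite F" and h: "\<And>x. x \<notin> F \<Longrightarrow> h x = 0"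
  shows "energy_form b u h = (\<Sum>x\<in>F. h x * laplacian u x)"
proof -
  define k where "k x y = h x * (b x y * (u x - u y))" for x y
  define S where "S = (\<Sum>x\<in>F. h x * laplacian u x)"
  have 1: "((\<lambda>(x, y). k x y) has_sum S) UNIV"
    unfolding S_def
  proof (rule has_sum_rows[OF F])
    show "(k x has_sum h x * laplacian u x) UNIV" for x
      unfolding k_def[abs_def] laplacian_def by (intro has_sum_cmult_right has_sum_infsum row_summable u)
  qed (simp add: k_def h)
  have inj: "inj_on prod.swap (UNIV :: ('a \<times> 'a) set)" by simp
  have 2: "((\<lambda>(x, y). k y x) has_sum S) UNIV"
    using 1 has_sum_reindex[OF inj, of "\<lambda>(x, y). k x y" S] by (simp add: o_def case_prod_unfold)
  have "k x y + k y x = b x y * (u x - u y) * (h x - h y)" for x y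
    using b_commute[of y x] by (simp add: k_def algebra_simps)
  then have "((\<lambda>(x, y). b x y * (u x - u y) * (h x - h y)) has_sum S + S) UNIV"
    using has_sum_add[OF 1 2] by (simp add: case_prod_unfold)
  then show ?thesis by (simp add: energy_form_def S_def infsumI)
qed

lemma ell2_inner_finite:
  assumes "g \<in> ell2 m" "finite F" "\<And>x. x \<notin> F \<Longrightarrow> h x = 0"
  shows "inner (emb g) (emb h) = (\<Sum>x\<in>F. h x * (m x * g x))"
proof -
  have "{x. h x \<noteq> 0} \<subseteq> F" using assms(3) by auto
  then have "h \<in> finitely_supported"
    using assms(2) by (auto simp: finitely_supported_def intro: finite_subset)
  then have h: "h \<in> ell2 m" by (rule finitely_supported_ell2)
  have "inner (emb g) (emb h) = (\<Sum>\<^sub>\<infinity>x. h x * (m x * g x))"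
    unfolding inner_l2_def by (intro infsum_cong) (simp add: coord_emb assms(1) h)
  also have "\<dots> = (\<Sum>x\<in>F. h x * (m x * g x))"
    by (intro infsumI finite_support_has_sum assms) (simp add: assms(3))
  finally show ?thesis .
qed

lemma form_norm_grad:
  assumes "f \<in> ell2 m" "f \<in> finite_energy b"
  shows "form_norm b m f = sqrt ((norm (grad f))\<^sup>2 + (norm (emb f))\<^sup>2)"
  using assms by (simp add: form_norm_def energy_form_grad ell2_norm_emb power2_norm_eq_inner)

lemma form_domainI:
  assumes f: "f \<in> ell2 m" "f \<in> finite_energy b" and h: "\<And>n. h n \<in> finitely_supported"
    and lim: "(\<lambda>n. grad (h n)) \<longlonglongrightarrow> grad f" "(\<lambda>n. emb (h n)) \<longlonglongrightarrow> emb f"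
  shows "f \<in> form_domain b m"
proof -
  note he = finitely_supported_ell2[OF h] finitely_supported_finite_energy[OF h]
  have eq: "form_norm b m (\<lambda>x. f x - h n x) = sqrt ((norm (grad f - grad (h n)))\<^sup>2 + (norm (emb f - emb (h n)))\<^sup>2)" for n
    by (subst form_norm_grad) (simp_all add: ell2_diff finite_energy_diff f he)
  have "(\<lambda>n. sqrt ((norm (grad f - grad (h n)))\<^sup>2 + (norm (emb f - emb (h n)))\<^sup>2))
      \<longlonglongrightarrow> sqrt ((norm (grad f - grad f))\<^sup>2 + (norm (emb f - emb f))\<^sup>2)"
    by (intro tendsto_intros lim)
  then have lim0: "(\<lambda>n. form_norm b m (\<lambda>x. f x - h n x)) \<longlonglongrightarrow> 0" by (simp add: eq)
  have "\<exists>g\<in>finitely_supported. form_norm b m (\<lambda>x. f x - g x) < \<epsilon>" if "0 < \<epsilon>" for \<epsilon>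
  proof -
    have "\<forall>\<^sub>F n in sequentially. form_norm b m (\<lambda>x. f x - h n x) < \<epsilon>"
      by (rule order_tendstoD(2)[OF lim0 that])
    then obtain n where "form_norm b m (\<lambda>x. f x - h n x) < \<epsilon>"
      using eventually_happens'[OF sequentially_bot] by blast
    then show ?thesis using h by blast
  qed
  then show ?thesis using f by (simp add: form_domain_def)
qed

lemma form_domainD:
  assumes "f \<in> form_domain b m"
  obtains h where "f \<in> ell2 m" "f \<in> finite_energy b" "\<And>n. h n \<in> finitely_supported"
    "(\<lambda>n. grad (h n)) \<longlonglongrightarrow> grad f" "(\<lambda>n. emb (h n)) \<longlonglongrightarrow> emb f"
proof -
  have f: "f \<in> ell2 m" "f \<in> finite_energy b" using assms by (auto simp: form_domain_def)
  have "\<exists>g\<in>finitely_supported. form_norm b m (\<lambda>x. f x - g x) < inverse (real (Suc n))" for n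
    using assms by (simp add: form_domain_def)
  then obtain h where h: "\<And>n. h n \<in> finitely_supported"
    "\<And>n. form_norm b m (\<lambda>x. f x - h n x) < inverse (real (Suc n))" by metis
  note he = finitely_supported_ell2[OF h(1)] finitely_supported_finite_energy[OF h(1)]
  have eq: "form_norm b m (\<lambda>x. f x - h n x) = sqrt ((norm (grad f - grad (h n)))\<^sup>2 + (norm (emb f - emb (h n)))\<^sup>2)" for n
    by (subst form_norm_grad) (simp_all add: ell2_diff finite_energy_diff f he)
  have le: "norm (grad f - grad (h n)) \<le> form_norm b m (\<lambda>x. f x - h n x)"
    "norm (emb f - emb (h n)) \<le> form_norm b m (\<lambda>x. f x - h n x)" for n
    unfolding eq by (auto intro: real_le_rsqrt)
  have 1: "(\<lambda>n. grad (h n) - grad f) \<longlonglongrightarrow> 0"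
    by (rule Lim_null_comparison[OF _ LIMSEQ_inverse_real_of_nat])
      (use le(1) h(2) in \<open>auto simp: norm_minus_commute intro!: always_eventually order_trans[OF le(1) less_imp_le[OF h(2)]] simp del: of_nat_Suc\<close>)
  have 2: "(\<lambda>n. emb (h n) - emb f) \<longlonglongrightarrow> 0"
    by (rule Lim_null_comparison[OF _ LIMSEQ_inverse_real_of_nat])
      (use le(2) h(2) in \<open>auto simp: norm_minus_commute intro!: always_eventually order_trans[OF le(2) less_imp_le[OF h(2)]] simp del: of_nat_Suc\<close>)
  show thesis using that[OF f h(1)] 1 2 by (simp add: LIM_zero_iff)
qed

lemma finitely_supported_form_domain: "h \<in> finitely_supported \<Longrightarrow> h \<in> form_domain b m"
  by (rule form_domainI[where h = "\<lambda>_. h"])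
    (auto simp: finitely_supported_ell2 finitely_supported_finite_energy)

lemma finitely_supported_lincomb:
  assumes "f \<in> finitely_supported" "g \<in> finitely_supported"
  shows "(\<lambda>x. \<alpha> * f x + \<beta> * g x) \<in> finitely_supported"
proof -
  have "{x. \<alpha> * f x + \<beta> * g x \<noteq> 0} \<subseteq> {x. f x \<noteq> 0} \<union> {x. g x \<noteq> 0}" by auto
  then show ?thesis using assms by (auto simp: finitely_supported_def intro: finite_subset)
qed

lemma form_domain_lincomb:
  assumes f: "f \<in> form_domain b m" and g: "g \<in> form_domain b m"
  shows "(\<lambda>x. \<alpha> * f x + \<beta> * g x) \<in> form_domain b m"
proof -
  obtain h where h: "f \<in> ell2 m" "f \<in> finite_energy b" "\<And>n. h n \<in> finitely_supported"
    "(\<lambda>n. grad (h n)) \<longlonglongrightarrow> grad f" "(\<lambda>n. emb (h n)) \<longlonglongrightarrow> emb f" using form_domainD[OF f] by blast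
  obtain k where k: "g \<in> ell2 m" "g \<in> finite_energy b" "\<And>n. k n \<in> finitely_supported"
    "(\<lambda>n. grad (k n)) \<longlonglongrightarrow> grad g" "(\<lambda>n. emb (k n)) \<longlonglongrightarrow> emb g" using form_domainD[OF g] by blast
  note fs = finitely_supported_ell2 finitely_supported_finite_energy h k
  show ?thesis
    by (rule form_domainI[where h = "\<lambda>n x. \<alpha> * h n x + \<beta> * k n x"])
      (auto simp: fs ell2_lincomb finite_energy_lincomb intro!: finitely_supported_lincomb tendsto_intros h k)
qed

text \<open>By density it suffices to test with finitely supported functions.\<close>

lemma form_operatorI:
  assumes u: "u \<in> form_domain b m" and g: "g \<in> ell2 m"
    and test: "\<And>h. h \<in> finitely_supported \<Longrightarrow> inner (grad u) (grad h) = inner (emb g) (emb h)"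
  shows "(u, g) \<in> form_operator b m"
proof -
  have ue: "u \<in> ell2 m" "u \<in> finite_energy b" using u by (auto simp: form_domain_def)
  have "energy_form b u h = ell2_inner m g h" if h: "h \<in> form_domain b m" for h
  proof -
    obtain k where k: "h \<in> ell2 m" "h \<in> finite_energy b" "\<And>n. k n \<in> finitely_supported"
      "(\<lambda>n. grad (k n)) \<longlonglongrightarrow> grad h" "(\<lambda>n. emb (k n)) \<longlonglongrightarrow> emb h" using form_domainD[OF h] by blast
    have "(\<lambda>n. inner (grad u) (grad (k n))) \<longlonglongrightarrow> inner (grad u) (grad h)"
      by (intro tendsto_intros k)
    moreover have "(\<lambda>n. inner (emb g) (emb (k n))) \<longlonglongrightarrow> inner (emb g) (emb h)"
      by (intro tendsto_intros k)
    ultimately have "inner (grad u) (grad h) = inner (emb g) (emb h)"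
      using test[OF k(3)] LIMSEQ_unique by simp
    then show ?thesis by (simp add: energy_form_grad ell2_inner_emb ue g k)
  qed
  then show ?thesis using u g by (simp add: form_operator_def)
qed

lemma form_operatorD:
  assumes "(u, g) \<in> form_operator b m"
  shows "u \<in> form_domain b m" "u \<in> ell2 m" "u \<in> finite_energy b" "g \<in> ell2 m"
    "h \<in> form_domain b m \<Longrightarrow> inner (grad u) (grad h) = inner (emb g) (emb h)"
proof -
  show u: "u \<in> form_domain b m" "u \<in> ell2 m" "u \<in> finite_energy b" "g \<in> ell2 m"
    using assms by (auto simp: form_operator_def form_domain_def)
  show "inner (grad u) (grad h) = inner (emb g) (emb h)" if h: "h \<in> form_domain b m"
  proof -
    have "h \<in> ell2 m" "h \<in> finite_energy b" using h by (auto simp: form_domain_def)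
    then show ?thesis using assms h u
      by (auto simp: form_operator_def energy_form_grad ell2_inner_emb)
  qed
qed

lemma form_operator_lincomb:
  assumes 1: "(u, g) \<in> form_operator b m" and 2: "(u', g') \<in> form_operator b m"
  shows "(\<lambda>x. \<alpha> * u x + \<beta> * u' x, \<lambda>x. \<alpha> * g x + \<beta> * g' x) \<in> form_operator b m"
proof (rule form_operatorI)
  note D = form_operatorD[OF 1] form_operatorD[OF 2]
  show "(\<lambda>x. \<alpha> * u x + \<beta> * u' x) \<in> form_domain b m" by (intro form_domain_lincomb D)
  show "(\<lambda>x. \<alpha> * g x + \<beta> * g' x) \<in> ell2 m" by (intro ell2_lincomb D)
  fix h :: "'a \<Rightarrow> real"
  assume "h \<in> finitely_supported"
  then have "h \<in> form_domain b m" by (rule finitely_supported_form_domain)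
  then show "inner (grad (\<lambda>x. \<alpha> * u x + \<beta> * u' x)) (grad h) = inner (emb (\<lambda>x. \<alpha> * g x + \<beta> * g' x)) (emb h)"
    by (simp add: finite_energy_lincomb ell2_lincomb D inner_add_left)
qed

lemma form_operator_nonneg: "(u, g) \<in> form_operator b m \<Longrightarrow> inner (emb g) (emb u) = (norm (grad u))\<^sup>2"
  using form_operatorD(5)[of u g u] form_operatorD(1)[of u g] by (simp add: power2_norm_eq_inner)

definition exhaustion :: "nat \<Rightarrow> 'a set" where
  "exhaustion k = {x. to_nat x < k}"

lemma finite_exhaustion: "finite (exhaustion k)"
proof -
  have "exhaustion k \<subseteq> from_nat ` {..<k}" unfolding exhaustion_def
    by (auto intro!: image_eqI[where x = "to_nat _"])
  then show ?thesis by (rule finite_subset) simp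
qed

text \<open>Solving \<open>(\<Sum>y. b x y + \<alpha> m x) u x = m x f x + \<Sum>y. b x y u y\<close> by iteration from \<open>0\<close>, truncated at
  step \<open>k\<close> to the \<open>k\<close>-th finite set. For \<open>f \<ge> 0\<close> the iterates increase to the smallest nonnegative
  solution, and they stay finitely supported.\<close>

primrec minimal_iterate :: "real \<Rightarrow> ('a \<Rightarrow> real) \<Rightarrow> nat \<Rightarrow> 'a \<Rightarrow> real" where
  "minimal_iterate \<alpha> f 0 = (\<lambda>_. 0)"
| "minimal_iterate \<alpha> f (Suc k) = (\<lambda>x. if x \<in> exhaustion k
     then (m x * f x + (\<Sum>\<^sub>\<infinity>y. b x y * minimal_iterate \<alpha> f k y)) / ((\<Sum>\<^sub>\<infinity>y. b x y) + \<alpha> * m x) else 0)"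

lemma minimal_iterate_support: "x \<notin> exhaustion k \<Longrightarrow> minimal_iterate \<alpha> f k x = 0"
  by (cases k) (auto simp: exhaustion_def)

lemma minimal_iterate_finitely_supported: "minimal_iterate \<alpha> f k \<in> finitely_supported"
proof -
  have "{x. minimal_iterate \<alpha> f k x \<noteq> 0} \<subseteq> exhaustion k" using minimal_iterate_support by blast
  then show ?thesis unfolding finitely_supported_def using finite_exhaustion finite_subset by blast
qed

lemma minimal_iterate_row: "(\<lambda>y. b x y * minimal_iterate \<alpha> f k y) summable_on UNIV"
  by (intro row_summable finitely_supported_finite_energy minimal_iterate_finitely_supported)

context
  fixes \<alpha> :: real and f :: "'a \<Rightarrow> real"
  assumes \<alpha>: "0 < \<alpha>" and f0: "\<And>x. 0 \<le> f x"
begin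

private abbreviation "v \<equiv> minimal_iterate \<alpha> f"

lemma denom_pos: "0 < (\<Sum>\<^sub>\<infinity>y. b x y) + \<alpha> * m x"
  by (intro add_nonneg_pos infsum_nonneg mult_pos_pos \<alpha> m_pos) simp

lemma iterate_nonneg: "0 \<le> v k x"
proof (induction k arbitrary: x)
  case (Suc k)
  then show ?case using denom_pos[of x] f0[of x]
    by (auto intro!: divide_nonneg_pos add_nonneg_nonneg infsum_nonneg)
qed simp

lemma iterate_mono: "v k x \<le> v (Suc k) x"
proof (induction k arbitrary: x)
  case 0
  then show ?case using iterate_nonneg[of "Suc 0" x] by simp
next
  case (Suc k)
  show ?case
  proof (cases "x \<in> exhaustion k")
    case True
    then have "x \<in> exhaustion (Suc k)" by (simp add: exhaustion_def)
    moreover have "(\<Sum>\<^sub>\<infinity>y. b x y * v k y) \<le> (\<Sum>\<^sub>\<infinity>y. b x y * v (Suc k) y)"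
      by (intro infsum_mono minimal_iterate_row mult_left_mono Suc) simp
    ultimately show ?thesis
      using True denom_pos[of x] by (simp add: divide_right_mono del: minimal_iterate.simps add: minimal_iterate.simps(2)[of _ _ k] minimal_iterate.simps(2)[of _ _ "Suc k"])
  next
    case False
    then show ?thesis using iterate_nonneg[of "Suc (Suc k)" x] by simp
  qed
qed

lemma iterate_incseq: "incseq (\<lambda>k. v k x)"
  by (rule incseq_SucI) (rule iterate_mono)

lemma iterate_bound:
  assumes c: "\<And>x. f x \<le> c" shows "\<alpha> * v k x \<le> c"
proof -
  have c0: "0 \<le> c" using f0[of undefined] c[of undefined] by linarith
  show ?thesis
  proof (induction k arbitrary: x)
    case (Suc k)
    show ?case
    proof (cases "x \<in> exhaustion k")
      case True
      have le: "v k y \<le> c / \<alpha>" for y using Suc[of y] \<alpha> by (simp add: field_simps)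
      have "(\<Sum>\<^sub>\<infinity>y. b x y * v k y) \<le> (\<Sum>\<^sub>\<infinity>y. b x y * (c / \<alpha>))"
        by (intro infsum_mono minimal_iterate_row mult_left_mono le summable_on_cmult_left b_summable) simp
      also have "\<dots> = (\<Sum>\<^sub>\<infinity>y. b x y) * (c / \<alpha>)" by (rule infsum_cmult_left')
      finally have "m x * f x + (\<Sum>\<^sub>\<infinity>y. b x y * v k y) \<le> m x * c + (\<Sum>\<^sub>\<infinity>y. b x y) * (c / \<alpha>)"
        using c[of x] by (intro add_mono mult_left_mono) auto
      also have "\<dots> = (c / \<alpha>) * ((\<Sum>\<^sub>\<infinity>y. b x y) + \<alpha> * m x)" using \<alpha> by (simp add: field_simps)
      finally have "v (Suc k) x \<le> c / \<alpha>" using True denom_pos[of x] by (simp add: pos_divide_le_eq)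
      then show ?thesis using \<alpha> by (simp add: field_simps del: minimal_iterate.simps)
    qed (simp add: c0)
  qed (simp add: c0)
qed

text \<open>On its support an iterate satisfies \<open>L v + \<alpha> v \<le> f\<close>, because passing from one step to the next
  increased the neighbouring values. Pairing with \<open>v \<ge> 0\<close> gives the estimate.\<close>

lemma iterate_energy:
  assumes f: "f \<in> ell2 m"
  shows "(norm (grad (v k)))\<^sup>2 + \<alpha> * (norm (emb (v k)))\<^sup>2 \<le> inner (emb f) (emb (v k))"
proof -
  note fs = minimal_iterate_finitely_supported
  note fe = finitely_supported_finite_energy[OF fs] and fl = finitely_supported_ell2[OF fs]
  define F where "F = exhaustion k"
  have F: "finite F" and out: "\<And>x. x \<notin> F \<Longrightarrow> v k x = 0"
    unfolding F_def by (rule finite_exhaustion) (rule minimal_iterate_support)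
  have "(norm (grad (v k)))\<^sup>2 = energy_form b (v k) (v k)"
    by (simp add: energy_form_grad fe power2_norm_eq_inner)
  also have "\<dots> = (\<Sum>x\<in>F. v k x * laplacian (v k) x)" by (rule green_formula[OF fe F out])
  finally have g: "(norm (grad (v k)))\<^sup>2 = (\<Sum>x\<in>F. v k x * laplacian (v k) x)" .
  have n: "(norm (emb (v k)))\<^sup>2 = (\<Sum>x\<in>F. v k x * (m x * v k x))"
    unfolding power2_norm_eq_inner by (rule ell2_inner_finite[OF fl F out])
  have i: "inner (emb f) (emb (v k)) = (\<Sum>x\<in>F. v k x * (m x * f x))"
    by (rule ell2_inner_finite[OF f F out])
  have le: "laplacian (v k) x + \<alpha> * (m x * v k x) \<le> m x * f x" if "v k x \<noteq> 0" for x
  proof (cases k)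
    case (Suc j)
    then have x: "x \<in> exhaustion j" using that by (auto split: if_splits)
    have "((\<Sum>\<^sub>\<infinity>y. b x y) + \<alpha> * m x) * v k x = m x * f x + (\<Sum>\<^sub>\<infinity>y. b x y * v j y)"
      using x Suc denom_pos[of x] by simp
    also have "(\<Sum>\<^sub>\<infinity>y. b x y * v j y) \<le> (\<Sum>\<^sub>\<infinity>y. b x y * v k y)"
      unfolding Suc by (intro infsum_mono minimal_iterate_row mult_left_mono iterate_mono) simp
    finally show ?thesis
      by (simp add: laplacian_alt[OF minimal_iterate_row] algebra_simps)
  qed (use that in simp)
  have "(norm (grad (v k)))\<^sup>2 + \<alpha> * (norm (emb (v k)))\<^sup>2
     = (\<Sum>x\<in>F. v k x * (laplacian (v k) x + \<alpha> * (m x * v k x)))"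
    unfolding g n by (simp add: sum_distrib_left sum.distrib[symmetric] algebra_simps)
  also have "\<dots> \<le> (\<Sum>x\<in>F. v k x * (m x * f x))"
  proof (rule sum_mono)
    fix x
    show "v k x * (laplacian (v k) x + \<alpha> * (m x * v k x)) \<le> v k x * (m x * f x)"
      by (cases "v k x = 0") (auto intro!: mult_left_mono le iterate_nonneg)
  qed
  finally show ?thesis by (simp add: i)
qed

end

end

section \<open>The Markovian resolvent\<close>

context graph_measure
begin

text \<open>The limit \<open>u\<close> of the iterates \<open>v k\<close> solves the equation pointwise. Writing
  \<open>Q\<^sub>\<alpha> f = Q f + \<alpha> \<parallel>f\<parallel>\<^sup>2\<close>, Fatou and the estimate for the iterates bound both \<open>Q\<^sub>\<alpha> u\<close> and \<open>Q\<^sub>\<alpha> (v k)\<close> by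
  pairings with \<open>f\<close>, while Green's formula gives \<open>Q\<^sub>\<alpha>(u, v k) = \<langle>f, v k\<rangle>\<close>. Together
  \<open>Q\<^sub>\<alpha> (u - v k) \<le> \<langle>f, u - v k\<rangle>\<close>, which tends to \<open>0\<close>: this places \<open>u\<close> in the closure of the finitely
  supported functions.\<close>

lemma resolvent_exists_nonneg:
  assumes \<alpha>: "0 < \<alpha>" and f: "f \<in> ell2 m" and f0: "\<And>x. 0 \<le> f x"
  obtains u where "(u, \<lambda>x. f x - \<alpha> * u x) \<in> form_operator b m"
    "\<And>x. 0 \<le> u x" "\<And>c x. (\<And>x. f x \<le> c) \<Longrightarrow> \<alpha> * u x \<le> c"
proof -
  define v where "v = minimal_iterate \<alpha> f"
  note fs = minimal_iterate_finitely_supported[of \<alpha> f, folded v_def]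
  note fe = finitely_supported_finite_energy[OF fs] and fl = finitely_supported_ell2[OF fs]
  note energy = iterate_energy[where \<alpha> = \<alpha> and f = f, OF \<alpha> f0 f, folded v_def]
  note v0 = iterate_nonneg[where \<alpha> = \<alpha> and f = f, OF \<alpha> f0, folded v_def]
  have norm_le: "norm (emb (v k)) \<le> norm (emb f) / \<alpha>" for k
  proof (cases "norm (emb (v k)) = 0")
    case False
    have "\<alpha> * (norm (emb (v k)))\<^sup>2 \<le> inner (emb f) (emb (v k))"
      using energy[of k] zero_le_power2[of "norm (grad (v k))"] by linarith
    also have "\<dots> \<le> norm (emb f) * norm (emb (v k))" by (rule norm_cauchy_schwarz)
    finally have "(\<alpha> * norm (emb (v k))) * norm (emb (v k)) \<le> norm (emb f) * norm (emb (v k))"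
      by (simp add: power2_eq_square mult.assoc)
    then have "\<alpha> * norm (emb (v k)) \<le> norm (emb f)"
      by (rule mult_right_le_imp_le) (use False in simp)
    then show ?thesis using \<alpha> by (simp add: pos_le_divide_eq mult.commute)
  qed (use \<alpha> in simp)
  have "convergent (\<lambda>k. v k x)" for x
  proof (rule Bseq_mono_convergent)
    have "norm (v k x) \<le> norm (emb f) / \<alpha> / sqrt (m x)" for k
    proof -
      have "\<bar>sqrt (m x) * v k x\<bar> \<le> norm (emb f) / \<alpha>"
        using abs_coord_le_norm[of "emb (v k)" x] norm_le[of k] by (simp add: coord_emb fl)
      then show ?thesis
        unfolding real_norm_def pos_le_divide_eq[OF sqrt_m_pos(1)] by (simp add: abs_mult mult.commute)
    qed
    then show "Bseq (\<lambda>k. v k x)" by (rule BseqI')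
    show "\<forall>i. \<forall>j\<ge>i. v i x \<le> v j x"
      using iterate_incseq[where \<alpha> = \<alpha> and f = f, OF \<alpha> f0, folded v_def] by (auto simp: incseq_def)
  qed
  then obtain u where lim: "\<And>x. (\<lambda>k. v k x) \<longlonglongrightarrow> u x" unfolding convergent_def by metis
  have vu: "v k x \<le> u x" for k x
    by (rule incseq_le[OF iterate_incseq[where \<alpha> = \<alpha> and f = f, OF \<alpha> f0, folded v_def] lim])
  have u0: "0 \<le> u x" for x using v0[of 0 x] vu[of 0 x] by linarith
  have uc: "\<alpha> * u x \<le> c" if "\<And>x. f x \<le> c" for c x
  proof (rule LIMSEQ_le_const2)
    show "(\<lambda>k. \<alpha> * v k x) \<longlonglongrightarrow> \<alpha> * u x" by (intro tendsto_intros lim)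
    show "\<exists>N. \<forall>n\<ge>N. \<alpha> * v n x \<le> c"
      using iterate_bound[where \<alpha> = \<alpha> and f = f, OF \<alpha> f0 that, folded v_def] by blast
  qed
  have ul: "u \<in> ell2 m"
    unfolding ell2_iff
  proof (rule l2_fatou(1)[where v = "\<lambda>k. emb (v k)" and c = "\<lambda>_. (norm (emb f) / \<alpha>)\<^sup>2"])
    show "(\<lambda>k. coord (emb (v k)) x) \<longlonglongrightarrow> sqrt (m x) * u x" for x
      unfolding coord_emb[OF fl] by (intro tendsto_intros lim)
    show "(norm (emb (v k)))\<^sup>2 \<le> (norm (emb f) / \<alpha>)\<^sup>2" for k by (intro power_mono norm_le) simp
  qed (rule tendsto_const)
  have emb_lim: "(\<lambda>k. emb (v k)) \<longlonglongrightarrow> emb u"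
    by (rule emb_dominated_convergence(2)[OF ul _ lim]) (use v0 vu u0 in simp)
  define C where "C = inner (emb f) (emb u) - \<alpha> * (norm (emb u))\<^sup>2"
  have Clim: "(\<lambda>k. inner (emb f) (emb (v k)) - \<alpha> * (norm (emb (v k)))\<^sup>2) \<longlonglongrightarrow> C"
    unfolding C_def by (intro tendsto_intros emb_lim)
  have grad_le: "(norm (grad (v k)))\<^sup>2 \<le> inner (emb f) (emb (v k)) - \<alpha> * (norm (emb (v k)))\<^sup>2" for k
    using energy[of k] by linarith
  have glim: "(\<lambda>k. coord (grad (v k)) z) \<longlonglongrightarrow> (case z of (x, y) \<Rightarrow> sqrt (b x y / 2) * (u x - u y))" for z
    by (cases z) (auto simp: coord_grad fe intro!: tendsto_intros lim)
  have ue: "u \<in> finite_energy b"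
    using l2_fatou(1)[OF glim grad_le Clim] by (simp add: finite_energy_iff case_prod_unfold)
  have uC: "(norm (grad u))\<^sup>2 \<le> C"
    using l2_fatou(2)[OF glim grad_le Clim] by (simp add: grad_def case_prod_unfold)
  have pde: "laplacian u x = m x * (f x - \<alpha> * u x)" for x
  proof -
    have "(\<lambda>k. \<Sum>\<^sub>\<infinity>y. b x y * v k y) \<longlonglongrightarrow> (\<Sum>\<^sub>\<infinity>y. b x y * u y)"
    proof (rule infsum_dominated_convergence[where g = "\<lambda>y. b x y * u y"])
      show "\<bar>b x y * v k y\<bar> \<le> b x y * u y" for k y
        using v0[of k y] vu[of k y] by (simp add: mult_left_mono)
    qed (auto intro!: row_summable ue tendsto_intros lim)
    then have "(\<lambda>k. m x * f x + (\<Sum>\<^sub>\<infinity>y. b x y * v k y)) \<longlonglongrightarrow> m x * f x + (\<Sum>\<^sub>\<infinity>y. b x y * u y)"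
      by (intro tendsto_intros)
    moreover have "\<forall>\<^sub>F k in sequentially. m x * f x + (\<Sum>\<^sub>\<infinity>y. b x y * v k y) = ((\<Sum>\<^sub>\<infinity>y. b x y) + \<alpha> * m x) * v (Suc k) x"
      using eventually_gt_at_top[of "to_nat x"]
    proof eventually_elim
      case (elim k)
      then show ?case using denom_pos[where \<alpha> = \<alpha> and f = f and x = x, OF \<alpha> f0] by (simp add: v_def exhaustion_def)
    qed
    ultimately have "(\<lambda>k. ((\<Sum>\<^sub>\<infinity>y. b x y) + \<alpha> * m x) * v (Suc k) x) \<longlonglongrightarrow> m x * f x + (\<Sum>\<^sub>\<infinity>y. b x y * u y)"
      by (rule Lim_transform_eventually)
    moreover have "(\<lambda>k. ((\<Sum>\<^sub>\<infinity>y. b x y) + \<alpha> * m x) * v (Suc k) x) \<longlonglongrightarrow> ((\<Sum>\<^sub>\<infinity>y. b x y) + \<alpha> * m x) * u x"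
      by (intro tendsto_intros LIMSEQ_Suc lim)
    ultimately have "((\<Sum>\<^sub>\<infinity>y. b x y) + \<alpha> * m x) * u x = m x * f x + (\<Sum>\<^sub>\<infinity>y. b x y * u y)"
      using LIMSEQ_unique by blast
    then show ?thesis by (simp add: laplacian_alt[OF row_summable(2)[OF ue]] algebra_simps)
  qed
  have rl: "(\<lambda>x. f x - \<alpha> * u x) \<in> ell2 m" "emb (\<lambda>x. f x - \<alpha> * u x) = emb f - \<alpha> *\<^sub>R emb u"
    using ell2_lincomb[OF f ul, of 1 "- \<alpha>"] by simp_all
  have weak: "inner (grad u) (grad h) = inner (emb (\<lambda>x. f x - \<alpha> * u x)) (emb h)" if h: "h \<in> finitely_supported" for h
  proof -
    have F: "finite {x. h x \<noteq> 0}" and he: "h \<in> finite_energy b"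
      using h finitely_supported_finite_energy by (auto simp: finitely_supported_def)
    have "inner (grad u) (grad h) = (\<Sum>x\<in>{x. h x \<noteq> 0}. h x * laplacian u x)"
      unfolding energy_form_grad[OF ue he, symmetric] by (rule green_formula[OF ue F]) simp
    also have "\<dots> = inner (emb (\<lambda>x. f x - \<alpha> * u x)) (emb h)"
      unfolding pde by (rule ell2_inner_finite[OF rl(1) F, symmetric]) simp
    finally show ?thesis .
  qed
  \<comment> \<open>expanding the square, the three terms combine to a quantity that tends to \<open>0\<close>\<close>
  have "(\<lambda>k. grad (v k) - grad u) \<longlonglongrightarrow> 0"
  proof -
    have sq: "(norm (grad (v k) - grad u))\<^sup>2 \<le> (inner (emb f) (emb (v k)) - \<alpha> * (norm (emb (v k)))\<^sup>2)
        - 2 * inner (emb f - \<alpha> *\<^sub>R emb u) (emb (v k)) + C" for k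
    proof -
      have "(norm (grad (v k) - grad u))\<^sup>2 = (norm (grad (v k)))\<^sup>2 - 2 * inner (grad u) (grad (v k)) + (norm (grad u))\<^sup>2"
        by (simp add: power2_norm_eq_inner inner_diff_left inner_diff_right inner_commute)
      then show ?thesis using grad_le[of k] uC weak[OF fs[of k]] by (simp add: rl)
    qed
    have "(\<lambda>k. (inner (emb f) (emb (v k)) - \<alpha> * (norm (emb (v k)))\<^sup>2)
        - 2 * inner (emb f - \<alpha> *\<^sub>R emb u) (emb (v k)) + C) \<longlonglongrightarrow> C - 2 * inner (emb f - \<alpha> *\<^sub>R emb u) (emb u) + C"
      by (intro tendsto_intros Clim emb_lim)
    also have "C - 2 * inner (emb f - \<alpha> *\<^sub>R emb u) (emb u) + C = 0"
      by (simp add: C_def power2_norm_eq_inner inner_diff_left)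
    finally have "(\<lambda>k. (norm (grad (v k) - grad u))\<^sup>2) \<longlonglongrightarrow> 0"
      by (rule tendsto_sandwich[rotated 2, OF tendsto_const]) (use sq in auto)
    then have "(\<lambda>k. sqrt ((norm (grad (v k) - grad u))\<^sup>2)) \<longlonglongrightarrow> sqrt 0" by (rule tendsto_real_sqrt)
    then show ?thesis by (simp add: tendsto_norm_zero_iff)
  qed
  then have "(\<lambda>k. grad (v k)) \<longlonglongrightarrow> grad u" by (simp add: LIM_zero_iff)
  then have "u \<in> form_domain b m" by (rule form_domainI[OF ul ue fs _ emb_lim])
  then have "(u, \<lambda>x. f x - \<alpha> * u x) \<in> form_operator b m" by (rule form_operatorI[OF _ rl(1) weak])
  then show thesis using that u0 uc by blast
qed

lemma resolvent_unique:
  assumes \<alpha>: "0 < \<alpha>" and u: "(u, \<lambda>x. f x - \<alpha> * u x) \<in> form_operator b m"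
    and w: "(w, \<lambda>x. f x - \<alpha> * w x) \<in> form_operator b m"
  shows "u = w"
proof -
  define z where "z = (\<lambda>x. u x - w x)"
  have "(\<lambda>x. 1 * u x + (-1) * w x, \<lambda>x. 1 * (f x - \<alpha> * u x) + (-1) * (f x - \<alpha> * w x)) \<in> form_operator b m"
    by (rule form_operator_lincomb[OF u w])
  then have "(z, \<lambda>x. - \<alpha> * z x + 0 * z x) \<in> form_operator b m" by (simp add: z_def algebra_simps)
  note z = this form_operatorD[OF this]
  have "inner (emb (\<lambda>x. - \<alpha> * z x + 0 * z x)) (emb z) = (norm (grad z))\<^sup>2"
    by (rule form_operator_nonneg[OF z(1)])
  then have "- \<alpha> * (norm (emb z))\<^sup>2 = (norm (grad z))\<^sup>2"
    unfolding ell2_lincomb(2)[OF z(3) z(3)] by (simp add: power2_norm_eq_inner)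
  moreover have "0 \<le> (norm (grad z))\<^sup>2" "0 \<le> \<alpha> * (norm (emb z))\<^sup>2" using \<alpha> by auto
  ultimately have "\<alpha> * (norm (emb z))\<^sup>2 = 0" by linarith
  then have "emb z = 0" using \<alpha> by simp
  then have "coord (emb z) x = 0" for x by simp
  then have "z x = 0" for x by (simp add: coord_emb z)
  then show ?thesis by (auto simp: z_def)
qed

lemma resolvent_exists:
  assumes \<alpha>: "0 < \<alpha>" and f: "f \<in> ell2 m"
  shows "\<exists>u. (u, \<lambda>x. f x - \<alpha> * u x) \<in> form_operator b m"
proof -
  have pos: "(\<lambda>x. max (f x) 0) \<in> ell2 m" and neg: "(\<lambda>x. max (- f x) 0) \<in> ell2 m"
    by (auto intro: ell2_dominated[OF f])
  obtain u where u: "(u, \<lambda>x. max (f x) 0 - \<alpha> * u x) \<in> form_operator b m"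
    by (rule resolvent_exists_nonneg[OF \<alpha> pos]) auto
  obtain w where w: "(w, \<lambda>x. max (- f x) 0 - \<alpha> * w x) \<in> form_operator b m"
    by (rule resolvent_exists_nonneg[OF \<alpha> neg]) auto
  have "(\<lambda>x. 1 * u x + (-1) * w x, \<lambda>x. 1 * (max (f x) 0 - \<alpha> * u x) + (-1) * (max (- f x) 0 - \<alpha> * w x)) \<in> form_operator b m"
    by (rule form_operator_lincomb[OF u w])
  moreover have "(\<lambda>x. 1 * (max (f x) 0 - \<alpha> * u x) + (-1) * (max (- f x) 0 - \<alpha> * w x))
     = (\<lambda>x. f x - \<alpha> * (1 * u x + (-1) * w x))"
    by (auto simp: fun_eq_iff algebra_simps max_def)
  ultimately have "(\<lambda>x. 1 * u x + (-1) * w x, \<lambda>x. f x - \<alpha> * (1 * u x + (-1) * w x)) \<in> form_operator b m"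
    by (simp only:)
  then show ?thesis by (rule exI[of _ "\<lambda>x. 1 * u x + (-1) * w x"])
qed

definition resolvent :: "real \<Rightarrow> ('a \<Rightarrow> real) \<Rightarrow> 'a \<Rightarrow> real" where
  "resolvent \<alpha> f = (THE u. (u, \<lambda>x. f x - \<alpha> * u x) \<in> form_operator b m)"

lemma resolvent_operator:
  assumes \<alpha>: "0 < \<alpha>" and f: "f \<in> ell2 m"
  shows "(resolvent \<alpha> f, \<lambda>x. f x - \<alpha> * resolvent \<alpha> f x) \<in> form_operator b m"
  unfolding resolvent_def
proof (rule theI'[where P = "\<lambda>u. (u, \<lambda>x. f x - \<alpha> * u x) \<in> form_operator b m"], rule ex_ex1I)
  show "\<exists>u. (u, \<lambda>x. f x - \<alpha> * u x) \<in> form_operator b m" by (rule resolvent_exists[OF \<alpha> f])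
  show "u = w" if "(u, \<lambda>x. f x - \<alpha> * u x) \<in> form_operator b m" "(w, \<lambda>x. f x - \<alpha> * w x) \<in> form_operator b m" for u w
    using that by (rule resolvent_unique[OF \<alpha>])
qed

lemma resolvent_eqI:
  assumes \<alpha>: "0 < \<alpha>" and u: "(u, \<lambda>x. f x - \<alpha> * u x) \<in> form_operator b m"
  shows "resolvent \<alpha> f = u"
  unfolding resolvent_def
proof (rule the_equality[where P = "\<lambda>u. (u, \<lambda>x. f x - \<alpha> * u x) \<in> form_operator b m"])
  show "(u, \<lambda>x. f x - \<alpha> * u x) \<in> form_operator b m" by (rule u)
next
  fix w assume "(w, \<lambda>x. f x - \<alpha> * w x) \<in> form_operator b m"
  then show "w = u" using u by (rule resolvent_unique[OF \<alpha>])
qed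

lemma resolvent_ell2: "0 < \<alpha> \<Longrightarrow> f \<in> ell2 m \<Longrightarrow> resolvent \<alpha> f \<in> ell2 m"
  by (rule form_operatorD(2)[OF resolvent_operator])

lemma resolvent_markov:
  assumes \<alpha>: "0 < \<alpha>" and f: "f \<in> ell2 m" and f0: "\<And>x. 0 \<le> f x"
  shows "0 \<le> resolvent \<alpha> f x" "(\<And>x. f x \<le> c) \<Longrightarrow> \<alpha> * resolvent \<alpha> f x \<le> c"
proof -
  obtain u where u: "(u, \<lambda>x. f x - \<alpha> * u x) \<in> form_operator b m"
    "\<And>x. 0 \<le> u x" "\<And>c x. (\<And>x. f x \<le> c) \<Longrightarrow> \<alpha> * u x \<le> c"
    using resolvent_exists_nonneg[OF \<alpha> f f0] by blast
  have "resolvent \<alpha> f = u" by (rule resolvent_eqI[OF \<alpha> u(1)])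
  then show "0 \<le> resolvent \<alpha> f x" "(\<And>x. f x \<le> c) \<Longrightarrow> \<alpha> * resolvent \<alpha> f x \<le> c"
    using u by auto
qed

lemma resolvent_lincomb:
  assumes \<alpha>: "0 < \<alpha>" and f: "f \<in> ell2 m" and g: "g \<in> ell2 m"
  shows "resolvent \<alpha> (\<lambda>x. r * f x + s * g x) = (\<lambda>x. r * resolvent \<alpha> f x + s * resolvent \<alpha> g x)"
proof (rule resolvent_eqI[OF \<alpha>])
  show "(\<lambda>x. r * resolvent \<alpha> f x + s * resolvent \<alpha> g x,
      \<lambda>x. r * f x + s * g x - \<alpha> * (r * resolvent \<alpha> f x + s * resolvent \<alpha> g x)) \<in> form_operator b m"
    using form_operator_lincomb[OF resolvent_operator[OF \<alpha> f] resolvent_operator[OF \<alpha> g], of r s]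
    by (simp add: algebra_simps)
qed

lemma resolvent_contraction:
  assumes \<alpha>: "0 < \<alpha>" and f: "f \<in> ell2 m"
  shows "\<alpha> * norm (emb (resolvent \<alpha> f)) \<le> norm (emb f)"
proof (cases "norm (emb (resolvent \<alpha> f)) = 0")
  case False
  define u where "u = resolvent \<alpha> f"
  note op = resolvent_operator[OF \<alpha> f, folded u_def]
  have ul: "u \<in> ell2 m" using form_operatorD(2)[OF op] .
  have "inner (emb (\<lambda>x. f x - \<alpha> * u x)) (emb u) = (norm (grad u))\<^sup>2" by (rule form_operator_nonneg[OF op])
  moreover have "emb (\<lambda>x. f x - \<alpha> * u x) = emb f - \<alpha> *\<^sub>R emb u"
    using ell2_lincomb(2)[OF f ul, of 1 "- \<alpha>"] by simp
  ultimately have "inner (emb f) (emb u) - \<alpha> * (norm (emb u))\<^sup>2 = (norm (grad u))\<^sup>2"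
    by (simp add: inner_diff_left power2_norm_eq_inner)
  then have "\<alpha> * (norm (emb u))\<^sup>2 \<le> inner (emb f) (emb u)" using zero_le_power2[of "norm (grad u)"] by linarith
  also have "\<dots> \<le> norm (emb f) * norm (emb u)" by (rule norm_cauchy_schwarz)
  finally have "(\<alpha> * norm (emb u)) * norm (emb u) \<le> norm (emb f) * norm (emb u)"
    by (simp add: power2_eq_square mult.assoc)
  then show ?thesis unfolding u_def by (rule mult_right_le_imp_le) (use False in simp)
qed simp

lemma resolvent_identity:
  assumes \<alpha>: "0 < \<alpha>" and \<mu>: "0 < \<mu>" and f: "f \<in> ell2 m"
  shows "(\<lambda>x. resolvent \<alpha> f x - resolvent \<mu> f x) = (\<lambda>x. (\<mu> - \<alpha>) * resolvent \<alpha> (resolvent \<mu> f) x)"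
proof -
  define u w where "u = resolvent \<alpha> f" and "w = resolvent \<mu> f"
  note u = resolvent_operator[OF \<alpha> f, folded u_def] and w = resolvent_operator[OF \<mu> f, folded w_def]
  have wl: "w \<in> ell2 m" using form_operatorD(2)[OF w] .
  have "(\<lambda>x. 1 * u x + (-1) * w x, \<lambda>x. 1 * (f x - \<alpha> * u x) + (-1) * (f x - \<mu> * w x)) \<in> form_operator b m"
    by (rule form_operator_lincomb[OF u w])
  then have "(\<lambda>x. u x - w x, \<lambda>x. ((\<mu> - \<alpha>) * w x + 0 * w x) - \<alpha> * (u x - w x)) \<in> form_operator b m"
    by (simp add: algebra_simps)
  then have "resolvent \<alpha> (\<lambda>x. (\<mu> - \<alpha>) * w x + 0 * w x) = (\<lambda>x. u x - w x)"
    by (rule resolvent_eqI[OF \<alpha>])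
  then show ?thesis unfolding resolvent_lincomb[OF \<alpha> wl wl] by (simp add: u_def w_def)
qed

text \<open>With \<open>w = \<alpha> (L + \<alpha>)\<^sup>-\<^sup>1 h - h\<close> the resolvent equation tested with \<open>w\<close> reads
  \<open>\<alpha> \<parallel>w\<parallel>\<^sup>2 = - Q w - Q(h, w)\<close>, and the right-hand side is at most \<open>Q h\<close>.\<close>

lemma resolvent_approx_form_domain:
  assumes \<alpha>: "0 < \<alpha>" and h: "h \<in> form_domain b m"
  shows "\<alpha> * (norm (\<alpha> *\<^sub>R emb (resolvent \<alpha> h) - emb h))\<^sup>2 \<le> (norm (grad h))\<^sup>2"
proof -
  define u where "u = resolvent \<alpha> h"
  have hd: "h \<in> ell2 m" "h \<in> finite_energy b" using h by (auto simp: form_domain_def)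
  note op = resolvent_operator[OF \<alpha> hd(1), folded u_def]
  note D = form_operatorD[OF op]
  define w where "w = (\<lambda>x. \<alpha> * u x + (-1) * h x)"
  have wd: "w \<in> form_domain b m" unfolding w_def by (intro form_domain_lincomb D h)
  have we: "emb w = \<alpha> *\<^sub>R emb u - emb h" "grad w = \<alpha> *\<^sub>R grad u - grad h"
    unfolding w_def using ell2_lincomb(2)[OF D(2) hd(1), of \<alpha> "-1"] finite_energy_lincomb(2)[OF D(3) hd(2), of \<alpha> "-1"]
    by simp_all
  have "emb (\<lambda>x. h x - \<alpha> * u x) = - emb w"
    using ell2_lincomb(2)[OF hd(1) D(2), of 1 "- \<alpha>"] by (simp add: we)
  then have "inner (grad u) (grad w) = - (norm (emb w))\<^sup>2"
    using D(5)[OF wd] by (simp add: power2_norm_eq_inner)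
  then have "\<alpha> * (norm (emb w))\<^sup>2 = - inner (\<alpha> *\<^sub>R grad u) (grad w)" by simp
  also have "\<alpha> *\<^sub>R grad u = grad w + grad h" by (simp add: we)
  also have "- inner (grad w + grad h) (grad w) = - (norm (grad w))\<^sup>2 + inner (- grad h) (grad w)"
    by (simp add: inner_add_left power2_norm_eq_inner)
  also have "\<dots> \<le> - (norm (grad w))\<^sup>2 + norm (- grad h) * norm (grad w)"
    by (intro add_left_mono norm_cauchy_schwarz)
  also have "\<dots> \<le> (norm (grad h))\<^sup>2"
  proof -
    have "s * t \<le> s\<^sup>2 + t\<^sup>2" if "0 \<le> s" "0 \<le> t" for s t :: real
      using sum_squares_bound[of s t] mult_nonneg_nonneg[OF that] by linarith
    from this[of "norm (grad h)" "norm (grad w)"] show ?thesis by simp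
  qed
  finally show ?thesis by (simp add: we u_def)
qed

definition J :: "real \<Rightarrow> 'a l2 \<Rightarrow> 'a l2" where
  "J \<alpha> v = emb (resolvent \<alpha> (prj v))"

lemma J_emb: "f \<in> ell2 m \<Longrightarrow> J \<alpha> (emb f) = emb (resolvent \<alpha> f)"
  by (simp add: J_def prj_emb)

lemma finitely_supported_dense:
  obtains h where "\<And>n. h n \<in> finitely_supported" "(\<lambda>n. emb (h n)) \<longlonglongrightarrow> v"
proof -
  define h where "h n = (\<lambda>x. if x \<in> exhaustion n then prj v x else 0)" for n
  have "{x. h n x \<noteq> 0} \<subseteq> exhaustion n" for n by (auto simp: h_def)
  then have fs: "h n \<in> finitely_supported" for n
    unfolding finitely_supported_def using finite_exhaustion finite_subset by blast
  have "(\<lambda>n. emb (h n)) \<longlonglongrightarrow> emb (prj v)"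
  proof (rule emb_dominated_convergence(2)[where g = "prj v"])
    show "(\<lambda>n. h n x) \<longlonglongrightarrow> prj v x" for x
    proof (rule tendsto_eventually)
      show "\<forall>\<^sub>F n in sequentially. h n x = prj v x"
        using eventually_gt_at_top[of "to_nat x"] by eventually_elim (simp add: h_def exhaustion_def)
    qed
  qed (auto simp: h_def)
  then show thesis using that[OF fs] by simp
qed

sublocale resolvent_family J
proof (rule resolvent_family.intro)
  fix \<alpha> :: real assume \<alpha>: "0 < \<alpha>"
  have lin: "J \<alpha> (r *\<^sub>R v + s *\<^sub>R w) = r *\<^sub>R J \<alpha> v + s *\<^sub>R J \<alpha> w" for r s v w
    unfolding J_def prj_lincomb resolvent_lincomb[OF \<alpha> prj_ell2 prj_ell2]
    by (simp add: ell2_lincomb resolvent_ell2 \<alpha>)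
  show contr: "\<alpha> * norm (J \<alpha> v) \<le> norm v" for v
    using resolvent_contraction[OF \<alpha> prj_ell2, of v] by (simp add: J_def)
  show "bounded_linear (J \<alpha>)"
  proof (rule bounded_linear_intro[where K = "1 / \<alpha>"])
    show "J \<alpha> (v + w) = J \<alpha> v + J \<alpha> w" for v w using lin[of 1 v 1 w] by simp
    show "J \<alpha> (r *\<^sub>R v) = r *\<^sub>R J \<alpha> v" for r v using lin[of r v 0 v] by simp
    show "norm (J \<alpha> v) \<le> norm v * (1 / \<alpha>)" for v using contr[of v] \<alpha> by (simp add: field_simps)
  qed
next
  fix \<alpha> \<mu> :: real and v assume \<alpha>: "0 < \<alpha>" and \<mu>: "0 < \<mu>"
  have l: "resolvent \<alpha> (prj v) \<in> ell2 m" "resolvent \<mu> (prj v) \<in> ell2 m"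
    by (simp_all add: resolvent_ell2 \<alpha> \<mu>)
  then have ll: "resolvent \<alpha> (resolvent \<mu> (prj v)) \<in> ell2 m" by (simp add: resolvent_ell2 \<alpha>)
  have "J \<alpha> v - J \<mu> v = emb (\<lambda>x. resolvent \<alpha> (prj v) x - resolvent \<mu> (prj v) x)"
    by (simp add: J_def ell2_diff l)
  also have "\<dots> = (\<mu> - \<alpha>) *\<^sub>R J \<alpha> (J \<mu> v)"
    unfolding resolvent_identity[OF \<alpha> \<mu> prj_ell2]
    using ell2_lincomb(2)[OF ll ll, of "\<mu> - \<alpha>" 0] by (simp add: J_def prj_emb l)
  finally show "J \<alpha> v - J \<mu> v = (\<mu> - \<alpha>) *\<^sub>R J \<alpha> (J \<mu> v)" .
next
  fix v
  have Jd: "J \<alpha> (v - w) = J \<alpha> v - J \<alpha> w" if "0 < \<alpha>" for \<alpha> v w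
  proof -
    have "prj (v - w) = (\<lambda>x. 1 * prj v x + (-1) * prj w x)" using prj_lincomb[of 1 v "-1" w] by simp
    then show ?thesis
      by (simp add: J_def resolvent_lincomb[OF that prj_ell2 prj_ell2, of 1 _ "-1", simplified] ell2_diff resolvent_ell2 that)
  qed
  show "(\<lambda>n. real (Suc n) *\<^sub>R J (real (Suc n)) v) \<longlonglongrightarrow> v"
  proof (rule LIMSEQ_I)
    fix e :: real assume e: "0 < e"
    obtain k where k: "\<And>n. k n \<in> finitely_supported" "(\<lambda>n. emb (k n)) \<longlonglongrightarrow> v"
      using finitely_supported_dense by blast
    obtain i where "norm (emb (k i) - v) < e / 3" using LIMSEQ_D[OF k(2), of "e / 3"] e by auto
    then obtain h where h: "h \<in> form_domain b m" "h \<in> ell2 m" "norm (v - emb h) < e / 3"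
      using finitely_supported_form_domain[OF k(1)] finitely_supported_ell2[OF k(1)]
      by (auto simp: norm_minus_commute)
    obtain N where N: "(norm (grad h))\<^sup>2 / (e / 3)\<^sup>2 < real N" using reals_Archimedean2 by blast
    show "\<exists>N. \<forall>n\<ge>N. norm (real (Suc n) *\<^sub>R J (real (Suc n)) v - v) < e"
    proof (intro exI[of _ N] allI impI)
      fix n assume n: "N \<le> n"
      define a where "a = real (Suc n)"
      have a: "0 < a" "(norm (grad h))\<^sup>2 / (e / 3)\<^sup>2 < a" using N n by (auto simp: a_def)
      have "a * (norm (a *\<^sub>R J a (emb h) - emb h))\<^sup>2 \<le> (norm (grad h))\<^sup>2"
        unfolding J_emb[OF h(2)] by (rule resolvent_approx_form_domain[OF a(1) h(1)])
      also have "\<dots> < a * (e / 3)\<^sup>2" using a(2) e by (simp add: pos_divide_less_eq)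
      finally have "(norm (a *\<^sub>R J a (emb h) - emb h))\<^sup>2 < (e / 3)\<^sup>2" using a(1) by simp
      then have 1: "norm (a *\<^sub>R J a (emb h) - emb h) < e / 3"
        by (rule power2_less_imp_less) (use e in simp)
      have 2: "norm (a *\<^sub>R J a (v - emb h)) < e / 3"
        using resolvent_contraction[OF a(1) prj_ell2, of "v - emb h"] a(1) h(3) by (simp add: J_def)
      have eq: "a *\<^sub>R J a v - v = (a *\<^sub>R J a (v - emb h) + (a *\<^sub>R J a (emb h) - emb h)) - (v - emb h)"
        by (simp add: Jd a scaleR_diff_right)
      have "norm (a *\<^sub>R J a v - v) \<le> norm (a *\<^sub>R J a (v - emb h) + (a *\<^sub>R J a (emb h) - emb h)) + norm (v - emb h)"
        unfolding eq by (rule norm_triangle_ineq4)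
      moreover have "norm (a *\<^sub>R J a (v - emb h) + (a *\<^sub>R J a (emb h) - emb h))
          \<le> norm (a *\<^sub>R J a (v - emb h)) + norm (a *\<^sub>R J a (emb h) - emb h)"
        by (rule norm_triangle_ineq)
      ultimately have "norm (a *\<^sub>R J a v - v) < e" using 1 2 h(3) by linarith
      then show "norm (real (Suc n) *\<^sub>R J (real (Suc n)) v - v) < e" by (simp only: a_def)
    qed
  qed
qed

end

section \<open>Volume growth and bounded subharmonic functions\<close>

text \<open>Joint convexity of \<open>q\<^sup>2 / w\<close>. It says that \<open>q\<^sup>2 / w\<close> solves a Hamilton-Jacobi inequality across jumps of
  arbitrary size.\<close>

lemma square_over_sum_le:
  fixes q l w h :: real
  assumes "0 < w" "0 < h"
  shows "(q + l)\<^sup>2 / (w + h) \<le> q\<^sup>2 / w + l\<^sup>2 / h"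
proof -
  have "q\<^sup>2 / w + l\<^sup>2 / h - (q + l)\<^sup>2 / (w + h) = (q * h - l * w)\<^sup>2 / (w * h * (w + h))"
    using assms by (simp add: divide_simps) (simp add: power2_eq_square algebra_simps)
  also have "\<dots> \<ge> 0" using assms by simp
  finally show ?thesis by simp
qed

text \<open>Going down an edge from value \<open>u\<close> to value \<open>v\<close>, the Gaussian exponent gains at most
  \<open>l\<^sup>2 / (c (u - v))\<close>, while the factor \<open>exp u\<close> loses \<open>u - v\<close>. The resulting negative term
  \<open>- (u - v)\<^sup>2\<close> is what later absorbs the cross terms of the cutoff function.\<close>

lemma edge_gain:
  fixes q\<^sub>x q\<^sub>y v w c l s :: real
  assumes "0 < c" "s < v" "v < u" "q\<^sub>x \<le> q\<^sub>y + l" "0 \<le> q\<^sub>x" 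
  shows "(u - v) * (exp (v - q\<^sub>y\<^sup>2 / (c * (v - s))) - exp (u - q\<^sub>x\<^sup>2 / (c * (u - s))))
           \<le> exp (v - q\<^sub>y\<^sup>2 / (c * (v - s))) * (l\<^sup>2 / c - (u - v)\<^sup>2)"
proof -
  define h where "h = u - v"
  have h: "0 < h" using assms by (simp add: h_def)
  have "q\<^sub>x\<^sup>2 / (u - s) \<le> (q\<^sub>y + l)\<^sup>2 / ((v - s) + h)"
    using assms unfolding h_def by (simp add: divide_right_mono power_mono)
  also have "\<dots> \<le> q\<^sub>y\<^sup>2 / (v - s) + l\<^sup>2 / h"
    using square_over_sum_le[of "v - s" h] assms h by simp
  finally have "(q\<^sub>x\<^sup>2 / (u - s)) / c \<le> (q\<^sub>y\<^sup>2 / (v - s) + l\<^sup>2 / h) / c"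
    using assms(1) by (intro divide_right_mono) auto
  also have "(q\<^sub>y\<^sup>2 / (v - s) + l\<^sup>2 / h) / c = q\<^sub>y\<^sup>2 / (c * (v - s)) + l\<^sup>2 / (c * h)"
    by (simp add: add_divide_distrib mult.commute)
  finally have E: "q\<^sub>x\<^sup>2 / (c * (u - s)) \<le> q\<^sub>y\<^sup>2 / (c * (v - s)) + l\<^sup>2 / (c * h)"
    by (simp add: mult.commute)
  define G where "G = exp (v - q\<^sub>y\<^sup>2 / (c * (v - s)))"
  have "G * (1 + (h - l\<^sup>2 / (c * h))) \<le> G * exp (h - l\<^sup>2 / (c * h))"
    unfolding G_def by (intro mult_left_mono exp_ge_add_one_self) auto
  also have "\<dots> = exp ((v - q\<^sub>y\<^sup>2 / (c * (v - s))) + (h - l\<^sup>2 / (c * h)))"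
    unfolding G_def by (rule exp_add[symmetric])
  also have "\<dots> \<le> exp (u - q\<^sub>x\<^sup>2 / (c * (u - s)))"
    using E by (simp add: h_def)
  finally have "h * (G - exp (u - q\<^sub>x\<^sup>2 / (c * (u - s)))) \<le> h * (G * (l\<^sup>2 / (c * h) - h))"
    using h by (intro mult_left_mono) (auto simp: algebra_simps)
  also have "\<dots> = G * (l\<^sup>2 / c - h\<^sup>2)"
    using h assms(1) by (simp add: field_simps power2_eq_square)
  finally show ?thesis unfolding G_def h_def .
qed

text \<open>Green's formula against a test function \<open>G\<close> of finite support: if each edge contributes at most its
  squared length times a density at its lower endpoint, the sum over the edges is controlled by that density.
  Edges leaving the support have only one endpoint in it and are counted once.\<close>

lemma green_test_bound:
  fixes b :: "'a \<Rightarrow> 'a \<Rightarrow> real"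
  assumes sym: "\<And>x y. b x y = b y x"
    and F: "finite F"
    and G0: "\<And>x. x \<notin> F \<Longrightarrow> G x = 0" and H0: "\<And>x. x \<notin> F \<Longrightarrow> H x = 0"
    and Hnn: "\<And>x. 0 \<le> H x" and b0: "\<And>x y. 0 \<le> b x y"
    and pair: "\<And>x y. u y \<le> u x \<Longrightarrow> (u x - u y) * (G y - G x) \<le> (l x y)\<^sup>2 * H y"
    and lsym: "\<And>x y. l x y = l y x"
    and su: "\<And>x. x \<in> F \<Longrightarrow> (\<lambda>y. b x y * (u y - u x)) summable_on UNIV"
    and sl: "\<And>x. x \<in> F \<Longrightarrow> (\<lambda>y. b x y * (l x y)\<^sup>2) summable_on UNIV"
  shows "(\<Sum>x\<in>F. G x * (\<Sum>\<^sub>\<infinity>y. b x y * (u y - u x))) \<le> (\<Sum>x\<in>F. H x * (\<Sum>\<^sub>\<infinity>y. b x y * (l x y)\<^sup>2))"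
proof -
  define T where "T x y = G x * (b x y * (u y - u x))" for x y
  define S where "S x y = (if u x \<le> u y then H x * (b x y * (l x y)\<^sup>2) else 0)" for x y
  define S' where "S' x y = H x * (b x y * (l x y)\<^sup>2)" for x y
  have TS: "T x y + T y x \<le> S x y + S y x" for x y
  proof -
    have *: "T x y + T y x \<le> S y x" if "u y \<le> u x" for x y
    proof -
      have "T x y + T y x = b x y * ((u x - u y) * (G y - G x))"
        by (simp add: T_def sym[of y x] algebra_simps)
      also have "\<dots> \<le> b x y * ((l x y)\<^sup>2 * H y)"
        by (intro mult_left_mono pair that b0)
      finally show ?thesis using that by (simp add: S_def sym[of y x] lsym[of y x] mult_ac)
    qed
    have S0: "0 \<le> S x y" for x y by (simp add: S_def Hnn b0)
    show ?thesis
    proof (cases "u y \<le> u x")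
      case True
      from *[OF True] S0[of x y] show ?thesis by linarith
    next
      case False
      then have "u x \<le> u y" by simp
      from *[OF this] S0[of y x] show ?thesis by linarith
    qed
  qed
  have sT: "T x summable_on A" if "x \<in> F" for x A
  proof (rule summable_on_subset_banach)
    show "T x summable_on UNIV"
      unfolding T_def using su[OF that] by (intro summable_on_cmult_right)
  qed simp
  have sS': "S' x summable_on A" if "x \<in> F" for x A
  proof (rule summable_on_subset_banach)
    show "S' x summable_on UNIV"
      unfolding S'_def using sl[OF that] by (intro summable_on_cmult_right)
  qed simp
  have SS': "S x y \<le> S' x y" for x y by (simp add: S_def S'_def Hnn b0)
  have split: "infsum f UNIV = sum f F + infsum f (- F)" if "\<And>A. f summable_on A" for f :: "'a \<Rightarrow> real"
    using infsum_Un_disjoint[OF that[of F] that[of "-F"]] F by simp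
  have inner: "(\<Sum>x\<in>F. \<Sum>y\<in>F. T x y) \<le> (\<Sum>x\<in>F. \<Sum>y\<in>F. S x y)"
  proof -
    have "2 * (\<Sum>x\<in>F. \<Sum>y\<in>F. T x y) = (\<Sum>x\<in>F. \<Sum>y\<in>F. T x y) + (\<Sum>x\<in>F. \<Sum>y\<in>F. T y x)"
      using sum.swap[of T F F] by simp
    also have "\<dots> = (\<Sum>x\<in>F. \<Sum>y\<in>F. T x y + T y x)" by (simp add: sum.distrib)
    also have "\<dots> \<le> (\<Sum>x\<in>F. \<Sum>y\<in>F. S x y + S y x)" by (intro sum_mono TS)
    also have "\<dots> = (\<Sum>x\<in>F. \<Sum>y\<in>F. S x y) + (\<Sum>x\<in>F. \<Sum>y\<in>F. S y x)" by (simp add: sum.distrib)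
    also have "\<dots> = 2 * (\<Sum>x\<in>F. \<Sum>y\<in>F. S x y)"
      using sum.swap[of S F F] by simp
    finally show ?thesis by simp
  qed
  have outer: "infsum (T x) (-F) \<le> infsum (S' x) (-F)" if "x \<in> F" for x
  proof (rule infsum_mono[OF sT[OF that] sS'[OF that]])
    fix y assume "y \<in> -F"
    then have "T y x = 0" "S y x = 0" by (auto simp: T_def S_def G0 H0)
    then show "T x y \<le> S' x y" using TS[of x y] SS'[of x y] by simp
  qed
  have "(\<Sum>x\<in>F. G x * (\<Sum>\<^sub>\<infinity>y. b x y * (u y - u x))) = (\<Sum>x\<in>F. infsum (T x) UNIV)"
    unfolding T_def by (simp add: infsum_cmult_right')
  also have "\<dots> = (\<Sum>x\<in>F. sum (T x) F) + (\<Sum>x\<in>F. infsum (T x) (-F))"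
    by (simp add: split[OF sT] sum.distrib)
  also have "\<dots> \<le> (\<Sum>x\<in>F. sum (S' x) F) + (\<Sum>x\<in>F. infsum (S' x) (-F))"
  proof (rule add_mono)
    show "(\<Sum>x\<in>F. sum (T x) F) \<le> (\<Sum>x\<in>F. sum (S' x) F)"
      by (rule order_trans[OF inner]) (intro sum_mono SS')
    show "(\<Sum>x\<in>F. infsum (T x) (-F)) \<le> (\<Sum>x\<in>F. infsum (S' x) (-F))"
      by (intro sum_mono outer)
  qed
  also have "\<dots> = (\<Sum>x\<in>F. infsum (S' x) UNIV)"
    by (simp add: split[OF sS'] sum.distrib)
  also have "\<dots> = (\<Sum>x\<in>F. H x * (\<Sum>\<^sub>\<infinity>y. b x y * (l x y)\<^sup>2))"
    unfolding S'_def by (simp add: infsum_cmult_right')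
  finally show ?thesis .
qed

lemma bounded_diff_summable:
  fixes b :: "'a \<Rightarrow> 'a \<Rightarrow> real"
  assumes "(\<lambda>y. b x y) summable_on UNIV" "\<And>y. 0 \<le> b x y" "\<And>y. 0 \<le> u y" "\<And>y. u y \<le> (1::real)"
  shows "(\<lambda>y. b x y * (u y - u x)) summable_on UNIV"
proof (rule Infinite_Sum.abs_summable_summable)
  show "(\<lambda>y. norm (b x y * (u y - u x))) summable_on UNIV"
  proof (rule Infinite_Sum.abs_summable_on_comparison_test[where g = "\<lambda>y. b x y"])
    show "(\<lambda>y. norm (b x y)) summable_on UNIV" using assms by simp
    fix y
    have "\<bar>u y - u x\<bar> \<le> 1" using assms(3,4)[of y] assms(3,4)[of x] by linarith
    then show "norm (b x y * (u y - u x)) \<le> norm (b x y)"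
      using assms(2)[of y] by (simp add: abs_mult mult_left_le)
  qed
qed

locale intrinsic_graph = graph_measure b m
  for b :: "'a::countable \<Rightarrow> 'a \<Rightarrow> real" and m :: "'a \<Rightarrow> real" +
  fixes d :: "'a \<Rightarrow> 'a \<Rightarrow> real" and p :: 'a
  assumes pm: "pseudo_metric d" and intr: "intrinsic b m d"
    and finite_ball: "\<And>r. 0 \<le> r \<Longrightarrow> finite (dist_ball d p r)"
begin

lemma d_nonneg [simp]: "0 \<le> d x y" and d_commute: "d x y = d y x"
  and d_triangle: "d x z \<le> d x y + d y z"
  using pm by (auto simp: pseudo_metric_def)

text \<open>Here \<open>q\<close> is the distance to the ball of radius \<open>R/2\<close> and \<open>\<phi>\<close> a cutoff that is \<open>1\<close> up to radius \<open>3R/4\<close>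
  and \<open>0\<close> beyond \<open>R\<close>. The Gaussian weight, with \<open>c = 16\<close>, and the cutoff, whose Lipschitz constant
  \<open>4/R\<close> is at most \<open>1/8\<close>, together cost less than the zeroth order term, as \<open>u > 1/2\<close> on the support of
  \<open>g\<close>. What remains lives in the collar where \<open>\<phi> < 1\<close>. There \<open>q \<ge> R/4\<close>, so either \<open>u > s\<close>, or \<open>g\<close> is
  at most \<open>3 exp (- R\<^sup>2 / (256 (s - s')))\<close>.\<close>

lemma level_set_decay:
  fixes u :: "'a \<Rightarrow> real"
  assumes u0: "\<And>x. 0 \<le> u x" and u1: "\<And>x. u x \<le> 1"
    and sub: "\<And>x. m x * u x \<le> (\<Sum>\<^sub>\<infinity>y. b x y * (u y - u x))"
    and R: "32 \<le> R" and s': "1/2 \<le> s'" and s: "s' < s"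
  shows "sum m {x \<in> dist_ball d p (R/2). s' < u x}
           \<le> sum m {x \<in> dist_ball d p R. s < u x}
             + sum m (dist_ball d p R) * exp (- R\<^sup>2 / (256 * (s - s')))"
proof -
  define q where "q x = max 0 (d p x - R/2)" for x
  define \<phi> where "\<phi> x = max 0 (min 1 (4 - 4 * d p x / R))" for x
  define g where "g x = (if s' < u x then exp (u x - (q x)\<^sup>2 / (16 * (u x - s'))) else 0)" for x
  define F where "F = dist_ball d p R"
  define C where "C = {x \<in> F. d p x \<le> 3 * R / 4}"
  define G where "G x = (\<phi> x)\<^sup>2 * g x" for x
  define H where "H x = (if x \<in> F then g x * (3/32) else 0)" for x
  have F: "finite F" unfolding F_def using R by (intro finite_ball) simp
  have C: "C \<subseteq> F" "finite C" using F by (auto simp: C_def)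
  have g0: "0 \<le> g x" for x by (simp add: g_def)
  have G0: "0 \<le> G x" for x by (simp add: G_def g0)
  have H0: "0 \<le> H x" for x by (simp add: H_def g0)
  have \<phi>: "0 \<le> \<phi> x" "\<phi> x \<le> 1" for x by (auto simp: \<phi>_def)
  have \<phi>1: "\<phi> x = 1" if "x \<in> C" for x
    using that R by (simp add: \<phi>_def C_def field_simps)
  have G_out: "G x = 0" if "x \<notin> F" for x
    using that R by (simp add: G_def \<phi>_def F_def dist_ball_def field_simps)
  have lip: "\<bar>d p x - d p y\<bar> \<le> d x y" for x y
    using d_triangle[of p x y] d_triangle[of p y x] d_commute[of x y] by linarith
  have \<phi>_lip: "(\<phi> y - \<phi> x)\<^sup>2 \<le> (d x y)\<^sup>2 / 64" for x y
  proof -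
    have "\<bar>\<phi> y - \<phi> x\<bar> \<le> \<bar>4 * d p x / R - 4 * d p y / R\<bar>"
      unfolding \<phi>_def by linarith
    also have "4 * d p x / R - 4 * d p y / R = 4 / R * (d p x - d p y)"
      by (simp add: right_diff_distrib)
    also have "\<bar>4 / R * (d p x - d p y)\<bar> = 4 * \<bar>d p x - d p y\<bar> / R"
      unfolding abs_mult using R by simp
    also have "\<dots> \<le> 4 * d x y / 32"
      using R lip[of x y] by (intro frac_le) auto
    finally have "\<bar>\<phi> y - \<phi> x\<bar>\<^sup>2 \<le> (d x y / 8)\<^sup>2"
      by (intro power_mono) auto
    then show ?thesis by (simp add: power_divide)
  qed
  have pair: "(u x - u y) * (G y - G x) \<le> (d x y)\<^sup>2 * H y" if le: "u y \<le> u x" for x y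
  proof (cases "u x = u y \<or> y \<notin> F \<or> u y \<le> s'")
    case True
    then have "u x = u y \<or> G y = 0" using G_out[of y] by (auto simp: g_def G_def)
    then have "(u x - u y) * (G y - G x) \<le> 0"
      using le G0[of x] by (auto intro: mult_nonneg_nonpos)
    also have "0 \<le> (d x y)\<^sup>2 * H y" by (simp add: H0)
    finally show ?thesis .
  next
    case False
    define h where "h = u x - u y"
    define \<Delta> where "\<Delta> = \<phi> y - \<phi> x"
    have h: "0 < h" "h \<le> 1" using False le u1[of x] u0[of y] by (auto simp: h_def)
    have "q x \<le> q y + d x y" using lip[of x y] d_nonneg[of x y] unfolding q_def by linarith
    then have gain: "h * (g y - g x) \<le> g y * ((d x y)\<^sup>2 / 16 - h\<^sup>2)"
      using edge_gain[of 16 s' "u y" "u x" "q x" "q y" "d x y"] False le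
      by (simp add: g_def h_def q_def)
    have \<Delta>: "\<Delta>\<^sup>2 \<le> (d x y)\<^sup>2 / 64" using \<phi>_lip by (simp add: \<Delta>_def)
    \<comment> \<open>the cross term is split by \<open>2 (h \<phi> x) \<Delta> \<le> (h \<phi> x)\<^sup>2 + \<Delta>\<^sup>2\<close>; the first part is paid for by \<open>gain\<close>\<close>
    have "0 \<le> (h * \<phi> x - \<Delta>)\<^sup>2" "h * \<Delta>\<^sup>2 \<le> \<Delta>\<^sup>2"
      using h by (auto simp: mult_right_le_one_le mult_left_le_one_le)
    then have cut: "h * ((\<phi> y)\<^sup>2 - (\<phi> x)\<^sup>2) \<le> 2 * \<Delta>\<^sup>2 + h\<^sup>2 * (\<phi> x)\<^sup>2"
      unfolding \<Delta>_def by (simp add: power2_eq_square algebra_simps)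
    have "h * (G y - G x) = (\<phi> x)\<^sup>2 * (h * (g y - g x)) + g y * (h * ((\<phi> y)\<^sup>2 - (\<phi> x)\<^sup>2))"
      by (simp add: G_def algebra_simps)
    also have "\<dots> \<le> (\<phi> x)\<^sup>2 * (g y * ((d x y)\<^sup>2 / 16 - h\<^sup>2)) + g y * (2 * \<Delta>\<^sup>2 + h\<^sup>2 * (\<phi> x)\<^sup>2)"
      by (intro add_mono mult_left_mono gain cut g0) simp
    also have "\<dots> = g y * ((\<phi> x)\<^sup>2 * ((d x y)\<^sup>2 / 16) + 2 * \<Delta>\<^sup>2)"
      by (simp add: algebra_simps)
    also have "\<dots> \<le> g y * (1 * ((d x y)\<^sup>2 / 16) + 2 * ((d x y)\<^sup>2 / 64))"
      using \<phi>[of x] \<Delta> by (intro mult_left_mono add_mono mult_right_mono g0) (auto simp: power_le_one)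
    also have "\<dots> = (d x y)\<^sup>2 * H y" using False by (simp add: H_def)
    finally show ?thesis by (simp add: h_def)
  qed
  have su: "(\<lambda>y. b x y * (u y - u x)) summable_on UNIV" for x
    by (rule bounded_diff_summable) (auto simp: u0 u1 b_summable)
  have sd: "(\<lambda>y. b x y * (d x y)\<^sup>2) summable_on UNIV" "(\<Sum>\<^sub>\<infinity>y. b x y * (d x y)\<^sup>2) \<le> m x" for x
    using intr by (auto simp: intrinsic_def)
  have "(\<Sum>x\<in>F. m x * G x) * (1/2) \<le> (\<Sum>x\<in>F. G x * (m x * u x))"
    unfolding sum_distrib_right
  proof (rule sum_mono)
    fix x
    have "G x * (1/2) \<le> G x * u x"
    proof (cases "s' < u x")
      case True
      with s' have "1/2 \<le> u x" by simp
      then show ?thesis using G0[of x] by (rule mult_left_mono)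
    qed (simp add: G_def g_def)
    then have "m x * (G x * (1/2)) \<le> m x * (G x * u x)"
      by (rule mult_left_mono) simp
    then show "m x * G x * (1/2) \<le> G x * (m x * u x)" by (simp add: mult_ac)
  qed
  also have "\<dots> \<le> (\<Sum>x\<in>F. G x * (\<Sum>\<^sub>\<infinity>y. b x y * (u y - u x)))"
    by (intro sum_mono mult_left_mono sub G0)
  also have "\<dots> \<le> (\<Sum>x\<in>F. H x * (\<Sum>\<^sub>\<infinity>y. b x y * (d x y)\<^sup>2))"
    by (rule green_test_bound[OF b_commute F G_out _ H0 b_nonneg pair d_commute su sd(1)])
      (auto simp: H_def)
  also have "\<dots> \<le> (\<Sum>x\<in>F. H x * m x)"
    by (intro sum_mono mult_left_mono sd H0)
  also have "\<dots> = (\<Sum>x\<in>F. m x * g x) * (3/32)"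
    unfolding sum_distrib_right by (intro sum.cong) (auto simp: H_def)
  finally have main: "(\<Sum>x\<in>F. m x * G x) * (1/2) \<le> (\<Sum>x\<in>F. m x * g x) * (3/32)" .
  have CG: "(\<Sum>x\<in>C. m x * g x) \<le> (\<Sum>x\<in>F. m x * G x)"
  proof -
    have "(\<Sum>x\<in>C. m x * g x) = (\<Sum>x\<in>C. m x * G x)" by (intro sum.cong) (auto simp: G_def \<phi>1)
    also have "\<dots> \<le> (\<Sum>x\<in>F. m x * G x)" by (rule sum_mono2[OF F C(1)]) (simp add: G0)
    finally show ?thesis .
  qed
  have "(\<Sum>x\<in>F. m x * g x) = (\<Sum>x\<in>F - C. m x * g x) + (\<Sum>x\<in>C. m x * g x)"
    by (rule sum.subset_diff[OF C(1) F])
  with main CG have 1: "(\<Sum>x\<in>C. m x * g x) \<le> (\<Sum>x\<in>F - C. m x * g x) * (3/13)"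
    by simp
  have "sum m {x \<in> dist_ball d p (R/2). s' < u x} \<le> (\<Sum>x\<in>{x \<in> dist_ball d p (R/2). s' < u x}. m x * g x)"
  proof (rule sum_mono)
    fix x assume "x \<in> {x \<in> dist_ball d p (R/2). s' < u x}"
    then have "1 \<le> g x" using u0[of x] by (simp add: g_def q_def dist_ball_def)
    then have "m x * 1 \<le> m x * g x" by (intro mult_left_mono) auto
    then show "m x \<le> m x * g x" by simp
  qed
  also have "\<dots> \<le> (\<Sum>x\<in>C. m x * g x)"
    using R by (intro sum_mono2 C) (auto simp: C_def F_def dist_ball_def g0)
  finally have 2: "sum m {x \<in> dist_ball d p (R/2). s' < u x} \<le> (\<Sum>x\<in>C. m x * g x)" .
  define \<eta> where "\<eta> = exp (- R\<^sup>2 / (256 * (s - s')))"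
  have up: "g x \<le> 3 * (if s < u x then 1 else 0) + 3 * \<eta>" if "x \<in> F - C" for x
  proof (cases "s' < u x")
    case True
    have e3: "exp (u x) \<le> 3" using exp_le u1[of x] exp_le_cancel_iff[of "u x" 1] by linarith
    show ?thesis
    proof (cases "s < u x")
      case True': True
      have "g x \<le> exp (u x)" using True by (simp add: g_def)
      then show ?thesis using True' e3 by (simp add: \<eta>_def add_increasing2)
    next
      case False
      have "3 * R / 4 < d p x" using that by (auto simp: C_def)
      then have "R/4 \<le> q x" unfolding q_def by linarith
      then have "(R/4)\<^sup>2 / (16 * (s - s')) \<le> (q x)\<^sup>2 / (16 * (u x - s'))"
        using True False R by (intro frac_le power_mono) auto
      then have "- ((q x)\<^sup>2 / (16 * (u x - s'))) \<le> - R\<^sup>2 / (256 * (s - s'))"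
        by (simp add: power_divide)
      then have "exp (u x) * exp (- ((q x)\<^sup>2 / (16 * (u x - s')))) \<le> 3 * \<eta>"
        unfolding \<eta>_def using e3 by (intro mult_mono) auto
      then have "g x \<le> 3 * \<eta>" using True by (simp add: g_def exp_add[symmetric])
      then show ?thesis using False by simp
    qed
  qed (simp add: g_def \<eta>_def)
  have "(\<Sum>x\<in>F - C. m x * g x) \<le> (\<Sum>x\<in>F - C. m x * (3 * (if s < u x then 1 else 0) + 3 * \<eta>))"
    by (intro sum_mono mult_left_mono up) auto
  also have "\<dots> \<le> (\<Sum>x\<in>F. m x * (3 * (if s < u x then 1 else 0) + 3 * \<eta>))"
    using F by (intro sum_mono2) (auto simp: \<eta>_def)
  also have "\<dots> = (\<Sum>x\<in>F. 3 * (if s < u x then m x else 0) + 3 * (m x * \<eta>))"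
    by (intro sum.cong) (auto simp: algebra_simps)
  also have "\<dots> = 3 * (\<Sum>x\<in>F. if s < u x then m x else 0) + 3 * (sum m F * \<eta>)"
    by (simp add: sum.distrib sum_distrib_left[symmetric] sum_distrib_right[symmetric])
  also have "(\<Sum>x\<in>F. if s < u x then m x else 0) = sum m {x \<in> F. s < u x}"
    using F by (simp add: sum.inter_filter)
  finally have 3: "(\<Sum>x\<in>F - C. m x * g x) \<le> 3 * (sum m {x \<in> F. s < u x} + sum m F * \<eta>)" by simp
  have "0 \<le> sum m {x \<in> F. s < u x} + sum m F * \<eta>"
    by (intro add_nonneg_nonneg mult_nonneg_nonneg sum_nonneg) (auto simp: \<eta>_def)
  moreover have "z \<le> w" if "a \<le> c * (3/13)" "z \<le> a" "c \<le> 3 * w" "0 \<le> w" for a c z w :: real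
    using that by linarith
  ultimately show ?thesis using 1 2 3 unfolding F_def[symmetric] \<eta>_def[symmetric] by blast
qed

abbreviation vol :: "real \<Rightarrow> real" where
  "vol r \<equiv> sum m (dist_ball d p r)"

text \<open>The summand \<open>k\<close> in the denominator makes the errors at the dyadic radii summable even if the
  volume grows slowly; it does not affect the divergence of the sum.\<close>

definition level_step :: "nat \<Rightarrow> real" where
  "level_step k = 4 ^ k / (256 * (log_sharp (vol (2 ^ k)) + k))"

lemma log_sharp_ge_1: "1 \<le> log_sharp x"
  by (simp add: log_sharp_def)

lemma log_sharp_mono: "0 < x \<Longrightarrow> x \<le> y \<Longrightarrow> log_sharp x \<le> log_sharp y"
  unfolding log_sharp_def by (intro max.mono) auto

lemma dist_ball_mono: "r \<le> r' \<Longrightarrow> dist_ball d p r \<subseteq> dist_ball d p r'"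
  by (auto simp: dist_ball_def)

lemma vol_mono: "0 \<le> r \<Longrightarrow> r \<le> r' \<Longrightarrow> vol r \<le> vol r'"
  by (intro sum_mono2 finite_ball dist_ball_mono) auto

lemma vol_pos: "0 \<le> r \<Longrightarrow> 0 < vol r"
proof -
  assume r: "0 \<le> r"
  have "p \<in> dist_ball d p r" using r pm by (simp add: dist_ball_def pseudo_metric_def)
  then show ?thesis by (intro sum_pos finite_ball r m_pos) auto
qed

lemma level_step_pos: "0 < level_step k"
  using log_sharp_ge_1[of "vol (2 ^ k)"] by (simp add: level_step_def)

lemma vol_level_step: "vol (2 ^ k) * exp (- (2 ^ k)\<^sup>2 / (256 * level_step k)) \<le> exp (- real k)"
proof -
  define W where "W = log_sharp (vol (2 ^ k))"
  have V: "0 < vol (2 ^ k)" by (rule vol_pos) simp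
  have W: "0 < W + k" "ln (vol (2 ^ k)) \<le> W"
    using log_sharp_ge_1[of "vol (2 ^ k)"] by (auto simp: W_def log_sharp_def)
  have "(2 ^ k)\<^sup>2 / (256 * level_step k) = W + k"
    using W by (simp add: level_step_def W_def[symmetric] power_mult_distrib[symmetric]
        power_even_eq power2_eq_square)
  then have "vol (2 ^ k) * exp (- (2 ^ k)\<^sup>2 / (256 * level_step k)) = exp (ln (vol (2 ^ k))) * exp (- (W + k))"
    using V by simp
  also have "\<dots> \<le> exp (- real k)" using W by (simp add: mult_exp_exp)
  finally show ?thesis .
qed

text \<open>Descending from level \<open>1\<close> at radius \<open>2\<^sup>N\<close>, where the level set is empty, down to radius
  \<open>2\<^sup>k\<close>. The levels are kept at or above \<open>1/2\<close>, as \<open>level_set_decay\<close> demands.\<close>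

lemma level_iterate:
  fixes u :: "'a \<Rightarrow> real"
  assumes u0: "\<And>x. 0 \<le> u x" and u1: "\<And>x. u x \<le> 1"
    and sub: "\<And>x. m x * u x \<le> (\<Sum>\<^sub>\<infinity>y. b x y * (u y - u x))"
    and "k \<le> N" and "4 \<le> k"
  shows "sum m {x \<in> dist_ball d p (2 ^ k). max (1/2) (1 - sum level_step {k<..N}) < u x}
           \<le> (\<Sum>i\<in>{k<..N}. exp (- real i))"
  using \<open>k \<le> N\<close>
proof (induction rule: inc_induct)
  case base
  have "{x \<in> dist_ball d p (2 ^ N). max (1/2) (1 - sum level_step {N<..N}) < u x} = {}"
    using u1 by (auto simp: not_less)
  then show ?case by (simp only: sum.empty) simp
next
  case (step n)
  define S where "S j = max (1/2) (1 - sum level_step {j<..N})" for j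
  have ins: "{n<..N} = insert (Suc n) {Suc n<..N}" using step.hyps by auto
  have S: "S n \<le> S (Suc n)" "S (Suc n) - S n \<le> level_step (Suc n)"
  proof -
    have "sum level_step {n<..N} = level_step (Suc n) + sum level_step {Suc n<..N}"
      by (simp add: ins)
    then show "S n \<le> S (Suc n)" "S (Suc n) - S n \<le> level_step (Suc n)"
      using level_step_pos[of "Suc n"] unfolding S_def by linarith+
  qed
  have half: "dist_ball d p (2 ^ Suc n / 2) = dist_ball d p (2 ^ n)" by simp
  have fin: "finite (dist_ball d p (2 ^ Suc n))" by (rule finite_ball) simp
  have "sum m {x \<in> dist_ball d p (2 ^ n). S n < u x}
     \<le> sum m {x \<in> dist_ball d p (2 ^ Suc n). S (Suc n) < u x} + exp (- real (Suc n))"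
  proof (cases "S n = S (Suc n)")
    case True
    have "sum m {x \<in> dist_ball d p (2 ^ n). S n < u x}
        \<le> sum m {x \<in> dist_ball d p (2 ^ Suc n). S (Suc n) < u x}"
      using True dist_ball_mono[of "2 ^ n" "2 ^ Suc n"] fin by (intro sum_mono2) auto
    then show ?thesis by (simp add: add_increasing2)
  next
    case False
    have "(2::real) ^ 5 \<le> 2 ^ Suc n" using step.hyps \<open>4 \<le> k\<close> by (intro power_increasing) auto
    moreover have "(2::real) ^ 5 = 32" by simp
    ultimately have R: "(32::real) \<le> 2 ^ Suc n" by (simp only:)
    have "1/2 \<le> S n" by (simp add: S_def)
    moreover have "S n < S (Suc n)" using S(1) False by linarith
    ultimately have "sum m {x \<in> dist_ball d p (2 ^ n). S n < u x}
     \<le> sum m {x \<in> dist_ball d p (2 ^ Suc n). S (Suc n) < u x}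
        + vol (2 ^ Suc n) * exp (- (2 ^ Suc n)\<^sup>2 / (256 * (S (Suc n) - S n)))"
      by (rule level_set_decay[OF u0 u1 sub R, unfolded half])
    also have "exp (- (2 ^ Suc n)\<^sup>2 / (256 * (S (Suc n) - S n)))
       \<le> exp (- (2 ^ Suc n)\<^sup>2 / (256 * level_step (Suc n)))"
    proof -
      have "((2::real) ^ Suc n)\<^sup>2 / (256 * level_step (Suc n)) \<le> (2 ^ Suc n)\<^sup>2 / (256 * (S (Suc n) - S n))"
        using S False by (intro frac_le mult_left_mono) auto
      then show ?thesis by (simp only: exp_le_cancel_iff minus_divide_left[symmetric] neg_le_iff_le)
    qed
    also have "vol (2 ^ Suc n) * exp (- (2 ^ Suc n)\<^sup>2 / (256 * level_step (Suc n))) \<le> exp (- real (Suc n))"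
      by (rule vol_level_step)
    finally show ?thesis using vol_pos[of "2 ^ Suc n"] by (simp add: mult_left_mono)
  qed
  also have "\<dots> \<le> (\<Sum>i\<in>{Suc n<..N}. exp (- real i)) + exp (- real (Suc n))"
    using step.IH by (simp add: S_def)
  also have "\<dots> = (\<Sum>i\<in>{n<..N}. exp (- real i))" unfolding ins by simp
  finally show ?case by (simp add: S_def)
qed

lemma mass_of_ball: "0 \<le> r \<Longrightarrow> mass_of m (dist_ball d p r) = vol r"
  unfolding mass_of_def measure_def
  by (simp add: emeasure_point_measure_finite2 finite_ball sum_nonneg)

text \<open>Dyadic comparison of the integral with a sum; the summand \<open>k\<close> in \<^const>\<open>level_step\<close> is harmless, because
  if the steps tend to \<open>0\<close>, then \<open>log\<^sup>\<sharp>\<close> of the volume is eventually at least \<open>k\<close>.\<close>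

lemma level_step_not_summable:
  assumes "(\<integral>\<^sup>+ r\<in>{1..}. ennreal (r / log_sharp (mass_of m (dist_ball d p r))) \<partial>lborel) = \<infinity>"
  shows "\<not> summable level_step"
proof
  define L where "L k = log_sharp (vol (2 ^ k))" for k :: nat
  have L1: "1 \<le> L k" for k by (simp add: L_def log_sharp_ge_1)
  assume "summable level_step"
  then have sm: "summable (\<lambda>k. 512 * level_step k)" by (rule summable_mult)
  have "level_step \<longlonglongrightarrow> 0" by (rule summable_LIMSEQ_zero) fact
  then have ev: "\<forall>\<^sub>F k in sequentially. level_step k < 1/512"
    by (rule order_tendstoD) simp
  have "\<forall>\<^sub>F k in sequentially. norm (4 ^ k / L k) \<le> 512 * level_step k"
    using ev
  proof eventually_elim
    case (elim k)
    have "2 * real k \<le> 2 * 2 ^ k" using of_nat_less_two_power[of k, where 'a=real] by linarith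
    also have "2 * 2 ^ k \<le> (4::real) ^ k * 2" by (simp add: power_mono)
    finally have k4: "real k * 2 \<le> 4 ^ k * 2" by simp
    have "4 ^ k * 2 < L k + k"
      using elim L1[of k] by (simp add: level_step_def L_def[symmetric] field_simps)
    with k4 have "real k \<le> L k" by linarith
    then have "4 ^ k / L k \<le> 4 ^ k * 2 / (L k + k)"
      using L1[of k] by (simp add: field_simps)
    also have "\<dots> = 512 * level_step k"
      unfolding level_step_def L_def[symmetric] using L1[of k] by (simp add: divide_simps)
    finally show ?case using L1[of k] by simp
  qed
  then have "summable (\<lambda>k. 4 ^ k / L k)" by (rule summable_comparison_test_ev) (rule sm)
  then have sm2: "summable (\<lambda>k. 2 * (4 ^ k / L k))" by (rule summable_mult)
  have "(\<integral>\<^sup>+ r\<in>{1..}. ennreal (r / log_sharp (mass_of m (dist_ball d p r))) \<partial>lborel)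
     \<le> (\<integral>\<^sup>+ (r::real). (\<Sum>k. ennreal (2 * 2 ^ k / L k) * indicator {2 ^ k..<2 ^ Suc k} r) \<partial>lborel)"
  proof (rule nn_integral_mono)
    fix r :: real
    show "ennreal (r / log_sharp (mass_of m (dist_ball d p r))) * indicator {1..} r
       \<le> (\<Sum>k. ennreal (2 * 2 ^ k / L k) * indicator {2 ^ k..<2 ^ Suc k} r)"
    proof (cases "1 \<le> r")
      case True
      define k where "k = nat \<lfloor>log 2 r\<rfloor>"
      have "real k \<le> log 2 r" "log 2 r < real (Suc k)"
        using True unfolding k_def by (auto simp: zero_le_log_cancel_iff) linarith
      then have "2 powr real k \<le> r" "r < 2 powr real (Suc k)"
        using True by (auto simp: powr_le_iff less_powr_iff)
      then have k: "2 ^ k \<le> r" "r < 2 ^ Suc k" by (simp_all add: powr_realpow del: power_Suc of_nat_Suc)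
      have "L k \<le> log_sharp (mass_of m (dist_ball d p r))"
        using True k by (simp add: L_def mass_of_ball log_sharp_mono vol_mono vol_pos)
      then have "r / log_sharp (mass_of m (dist_ball d p r)) \<le> 2 * 2 ^ k / L k"
        using k True L1[of k] by (intro frac_le) auto
      then have "ennreal (r / log_sharp (mass_of m (dist_ball d p r))) * indicator {1..} r
          \<le> (\<Sum>j\<in>{k}. ennreal (2 * 2 ^ j / L j) * indicator {2 ^ j..<2 ^ Suc j} r)"
        using k True by (simp add: ennreal_leI)
      also have "\<dots> \<le> (\<Sum>k. ennreal (2 * 2 ^ k / L k) * indicator {2 ^ k..<2 ^ Suc k} r)"
        by (rule sum_le_suminf) auto
      finally show ?thesis .
    qed simp
  qed
  also have "\<dots> = (\<Sum>k. \<integral>\<^sup>+ (r::real). ennreal (2 * 2 ^ k / L k) * indicator {2 ^ k..<2 ^ Suc k} r \<partial>lborel)"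
    by (rule nn_integral_suminf) simp
  also have "\<dots> = (\<Sum>k. ennreal (2 * (4 ^ k / L k)))"
  proof (rule suminf_cong)
    fix k
    have "(4::real) ^ k = 2 ^ k * 2 ^ k" by (simp add: power_mult_distrib[symmetric])
    then show "(\<integral>\<^sup>+ (r::real). ennreal (2 * 2 ^ k / L k) * indicator {2 ^ k..<2 ^ Suc k} r \<partial>lborel)
        = ennreal (2 * (4 ^ k / L k))"
      using L1[of k] by (simp add: nn_integral_cmult_indicator ennreal_mult''[symmetric] mult_ac)
  qed
  also have "\<dots> = ennreal (\<Sum>k. 2 * (4 ^ k / L k))"
  proof (rule suminf_ennreal2[OF _ sm2])
    show "0 \<le> 2 * (4 ^ k / L k)" for k using L1[of k] by simp
  qed
  finally show False using assms by (simp add: top_unique)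
qed

lemma sum_geometric_half: "k \<le> N \<Longrightarrow> (\<Sum>i\<in>{k<..N}. (1/2) ^ i) = (1/2) ^ k - (1/2::real) ^ N"
proof (induction rule: dec_induct)
  case (step n)
  then have "{k<..Suc n} = insert (Suc n) {k<..n}" by auto
  then show ?case using step by simp
qed simp

text \<open>Scale \<open>u\<close> so that its supremum is \<open>1\<close> and pick \<open>z\<close> with \<open>u z > 1/2\<close>. For each large \<open>k\<close>
  the descent from a radius \<open>2\<^sup>N\<close> reaches level \<open>1/2\<close> no later than at radius \<open>2\<^sup>k\<close>, so \<open>m z \<le> 2\<^sup>-\<^sup>k\<close>.\<close>

theorem bounded_subharmonic_zero:
  fixes u :: "'a \<Rightarrow> real"
  assumes vol: "(\<integral>\<^sup>+ r\<in>{1..}. ennreal (r / log_sharp (mass_of m (dist_ball d p r))) \<partial>lborel) = \<infinity>"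
    and u0: "\<And>x. 0 \<le> u x" and u1: "\<And>x. u x \<le> 1"
    and sub: "\<And>x. m x * u x \<le> (\<Sum>\<^sub>\<infinity>y. b x y * (u y - u x))"
  shows "u x = 0"
proof (rule ccontr)
  assume "u x \<noteq> 0"
  then have ux: "0 < u x" using u0[of x] by simp
  define M where "M = Sup (range u)"
  have bdd: "bdd_above (range u)" using u1 by (auto simp: bdd_above_def)
  have uM: "u y \<le> M" for y unfolding M_def by (intro cSup_upper bdd) auto
  have M: "0 < M" using ux uM[of x] by simp
  then have "\<exists>y\<in>range u. M / 2 < y" unfolding M_def
    by (intro less_cSupD) (auto simp: M_def[symmetric])
  then obtain z where z: "M / 2 < u z" by auto
  define w where "w y = u y / M" for y
  have w0: "0 \<le> w y" and w1: "w y \<le> 1" for y using u0[of y] uM[of y] M by (auto simp: w_def)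
  have wsub: "m y * w y \<le> (\<Sum>\<^sub>\<infinity>y'. b y y' * (w y' - w y))" for y
  proof -
    have "m y * w y = (1 / M) * (m y * u y)" by (simp add: w_def)
    also have "\<dots> \<le> (1 / M) * (\<Sum>\<^sub>\<infinity>y'. b y y' * (u y' - u y))"
      using M by (intro mult_left_mono sub) auto
    also have "\<dots> = (\<Sum>\<^sub>\<infinity>y'. (1 / M) * (b y y' * (u y' - u y)))"
      by (rule infsum_cmult_right'[symmetric])
    also have "\<dots> = (\<Sum>\<^sub>\<infinity>y'. b y y' * (w y' - w y))"
      by (rule infsum_cong) (simp add: w_def diff_divide_distrib right_diff_distrib)
    finally show ?thesis .
  qed
  have wz: "1/2 < w z" using z M by (simp add: w_def field_simps)
  have "\<exists>k. real (nat \<lceil>d p z\<rceil>) + 4 \<le> real k \<and> (1/2) ^ k < m z"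
  proof -
    have "(\<lambda>k. (1/2::real) ^ k) \<longlonglongrightarrow> 0" by (rule LIMSEQ_realpow_zero) auto
    then have "\<forall>\<^sub>F k in sequentially. (1/2) ^ k < m z" by (rule order_tendstoD) (rule m_pos)
    moreover have "\<forall>\<^sub>F k in sequentially. nat \<lceil>d p z\<rceil> + 4 \<le> k" by (rule eventually_ge_at_top)
    ultimately have "\<forall>\<^sub>F k in sequentially. real (nat \<lceil>d p z\<rceil>) + 4 \<le> real k \<and> (1/2) ^ k < m z"
      by eventually_elim linarith
    then show ?thesis by (rule eventually_happens'[OF sequentially_bot])
  qed
  then obtain k where k: "real (nat \<lceil>d p z\<rceil>) + 4 \<le> real k" "(1/2) ^ k < m z" by blast
  have "4 \<le> k" using k(1) by linarith
  have "d p z \<le> 2 ^ k" using k(1) of_nat_less_two_power[of k, where 'a=real] by linarith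
  have "\<exists>N\<ge>k. 1/2 \<le> sum level_step {k<..N}"
  proof (rule ccontr)
    assume A: "\<not> (\<exists>N\<ge>k. 1/2 \<le> sum level_step {k<..N})"
    have A': "sum level_step {k<..max k n} \<le> 1/2" for n
      using A max.cobounded1[of k n] by fastforce
    have "summable level_step"
    proof (rule summableI_nonneg_bounded)
      show "0 \<le> level_step n" for n using level_step_pos[of n] by simp
      fix n
      have "sum level_step {..<n} \<le> sum level_step ({..k} \<union> {k<..max k n})"
        using level_step_pos by (intro sum_mono2) (auto simp: less_imp_le)
      also have "\<dots> = sum level_step {..k} + sum level_step {k<..max k n}"
        by (rule sum.union_disjoint) auto
      also have "\<dots> \<le> sum level_step {..k} + 1/2" using A'[of n] by simp
      finally show "sum level_step {..<n} \<le> sum level_step {..k} + 1/2" .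
    qed
    with level_step_not_summable[OF vol] show False by contradiction
  qed
  then obtain N where N: "k \<le> N" "1/2 \<le> sum level_step {k<..N}" by blast
  have mx: "max (1/2) (1 - sum level_step {k<..N}) = 1/2" using N(2) by simp
  have "m z \<le> sum m {x \<in> dist_ball d p (2 ^ k). 1/2 < w x}"
    using \<open>d p z \<le> 2 ^ k\<close> wz
    by (intro member_le_sum) (auto simp: dist_ball_def finite_ball[unfolded dist_ball_def])
  also have "\<dots> \<le> (\<Sum>i\<in>{k<..N}. exp (- real i))"
    using level_iterate[OF w0 w1 wsub N(1) \<open>4 \<le> k\<close>] unfolding mx .
  also have "\<dots> \<le> (\<Sum>i\<in>{k<..N}. (1/2) ^ i)"
  proof (rule sum_mono)
    fix i
    have "exp (- real i) = exp (-1) ^ i" by (simp add: exp_of_nat_mult[symmetric])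
    also have "exp (-1::real) \<le> 1/2"
      using exp_ge_add_one_self[of 1] by (simp add: exp_minus field_simps)
    then have "exp (-1) ^ i \<le> (1/2::real) ^ i" by (rule power_mono) simp
    finally show "exp (- real i) \<le> (1/2) ^ i" .
  qed
  also have "\<dots> \<le> (1/2) ^ k" by (simp add: sum_geometric_half N)
  finally show False using k(2) by simp
qed

end

section \<open>The heat semigroup and conservation of mass\<close>

context graph_measure
begin

definition lift :: "(real \<Rightarrow> ('a \<Rightarrow> real) \<Rightarrow> 'a \<Rightarrow> real) \<Rightarrow> real \<Rightarrow> 'a l2 \<Rightarrow> 'a l2" where
  "lift S t v = emb (S t (prj v))"

lemma C0_semigroupD:
  assumes "C0_semigroup m S"
  shows "0 \<le> t \<Longrightarrow> f \<in> ell2 m \<Longrightarrow> S t f \<in> ell2 m"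
    "0 \<le> t \<Longrightarrow> f \<in> ell2 m \<Longrightarrow> g \<in> ell2 m \<Longrightarrow>
       S t (\<lambda>x. \<alpha> * f x + \<beta> * g x) = (\<lambda>x. \<alpha> * S t f x + \<beta> * S t g x)"
    "0 \<le> t \<Longrightarrow> \<exists>C. \<forall>f\<in>ell2 m. ell2_norm m (S t f) \<le> C * ell2_norm m f"
    "f \<in> ell2 m \<Longrightarrow> S 0 f = f"
    "0 \<le> s \<Longrightarrow> 0 \<le> t \<Longrightarrow> f \<in> ell2 m \<Longrightarrow> S (s + t) f = S s (S t f)"
    "f \<in> ell2 m \<Longrightarrow> ((\<lambda>t. ell2_norm m (\<lambda>x. S t f x - f x)) \<longlongrightarrow> 0) (at_right 0)"
  using assms unfolding C0_semigroup_def by blast+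

lemma lift_c0_semigroup:
  assumes S: "C0_semigroup m S" shows "c0_semigroup (lift S)"
  unfolding c0_semigroup_def
proof (intro conjI allI impI)
  note D = C0_semigroupD[OF S]
  fix t :: real assume t: "0 \<le> t"
  have lin: "lift S t (r *\<^sub>R v + s *\<^sub>R w) = r *\<^sub>R lift S t v + s *\<^sub>R lift S t w" for r s v w
    unfolding lift_def prj_lincomb D(2)[OF t prj_ell2 prj_ell2] by (intro ell2_lincomb D t prj_ell2)
  obtain C where C: "\<And>f. f \<in> ell2 m \<Longrightarrow> ell2_norm m (S t f) \<le> C * ell2_norm m f"
    using D(3)[OF t] by blast
  show "bounded_linear (lift S t)"
  proof (rule bounded_linear_intro[where K = C])
    show "lift S t (v + w) = lift S t v + lift S t w" for v w using lin[of 1 v 1 w] by simp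
    show "lift S t (r *\<^sub>R v) = r *\<^sub>R lift S t v" for r v using lin[of r v 0 v] by simp
    show "norm (lift S t v) \<le> norm v * C" for v
      using C[OF prj_ell2, of v] D(1)[OF t prj_ell2, of v] by (simp add: lift_def ell2_norm_emb mult.commute)
  qed
next
  fix v show "lift S 0 v = v" by (simp add: lift_def C0_semigroupD(4)[OF S])
next
  fix s t :: real and v assume "0 \<le> s" "0 \<le> t"
  then show "lift S (s + t) v = lift S s (lift S t v)"
    by (simp add: lift_def C0_semigroupD(5)[OF S] prj_emb C0_semigroupD(1)[OF S])
next
  fix v
  have "((\<lambda>t. norm (lift S t v - v)) \<longlongrightarrow> 0) (at_right 0)"
  proof (rule Lim_transform_eventually[OF C0_semigroupD(6)[OF S prj_ell2, of v]])
    show "\<forall>\<^sub>F t in at_right 0. ell2_norm m (\<lambda>x. S t (prj v) x - prj v x) = norm (lift S t v - v)"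
      by (rule eventually_at_right_less[THEN eventually_mono])
        (simp add: lift_def ell2_norm_emb ell2_diff C0_semigroupD(1)[OF S])
  qed
  then have "((\<lambda>t. lift S t v - v) \<longlongrightarrow> 0) (at_right 0)" by (simp add: tendsto_norm_zero_iff)
  then show "((\<lambda>t. lift S t v) \<longlongrightarrow> v) (at_right 0)" by (simp add: LIM_zero_iff)
qed

lemma lift_generator:
  assumes S: "C0_semigroup m S" and f: "f \<in> ell2 m" and g: "g \<in> ell2 m"
  shows "(emb f, emb g) \<in> generator (lift S) \<longleftrightarrow> (f, g) \<in> semigroup_generator m S"
proof -
  have "\<forall>\<^sub>F t in at_right 0. norm ((lift S t (emb f) - emb f) /\<^sub>R t - emb g) = ell2_norm m (\<lambda>x. (S t f x - f x) / t - g x)"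
  proof (rule eventually_at_right_less[THEN eventually_mono])
    fix t :: real assume "0 < t"
    then have St: "S t f \<in> ell2 m" using C0_semigroupD(1)[OF S _ f] by simp
    have q: "(\<lambda>x. (1/t) * S t f x + (-1/t) * f x) \<in> ell2 m"
      "emb (\<lambda>x. (1/t) * S t f x + (-1/t) * f x) = (1/t) *\<^sub>R emb (S t f) + (-1/t) *\<^sub>R emb f"
      by (rule ell2_lincomb[OF St f])+
    have eq: "(\<lambda>x. (S t f x - f x) / t - g x) = (\<lambda>x. ((1/t) * S t f x + (-1/t) * f x) - g x)"
      by (simp add: fun_eq_iff diff_divide_distrib)
    have "ell2_norm m (\<lambda>x. (S t f x - f x) / t - g x) = norm ((1/t) *\<^sub>R emb (S t f) + (-1/t) *\<^sub>R emb f - emb g)"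
      unfolding eq q(2)[symmetric] ell2_diff(2)[OF q(1) g, symmetric]
      by (rule ell2_norm_emb[OF ell2_diff(1)[OF q(1) g]])
    also have "(1/t) *\<^sub>R emb (S t f) + (-1/t) *\<^sub>R emb f = (lift S t (emb f) - emb f) /\<^sub>R t"
      by (simp add: lift_def prj_emb f scaleR_diff_right divide_inverse)
    finally show "norm ((lift S t (emb f) - emb f) /\<^sub>R t - emb g) = ell2_norm m (\<lambda>x. (S t f x - f x) / t - g x)"
      by simp
  qed
  then have "((\<lambda>t. norm ((lift S t (emb f) - emb f) /\<^sub>R t - emb g)) \<longlongrightarrow> 0) (at_right 0)
     \<longleftrightarrow> ((\<lambda>t. ell2_norm m (\<lambda>x. (S t f x - f x) / t - g x)) \<longlongrightarrow> 0) (at_right 0)"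
    by (rule tendsto_cong)
  then show ?thesis
    by (simp add: generator_def semigroup_generator_def f g tendsto_norm_zero_iff LIM_zero_iff)
qed

text \<open>The semigroup generated through the resolvents, a witness for the choice in
  \<^const>\<open>heat_semigroup\<close>.\<close>

definition canonical_semigroup :: "real \<Rightarrow> ('a \<Rightarrow> real) \<Rightarrow> 'a \<Rightarrow> real" where
  "canonical_semigroup t f = prj (T t (emb f))"

lemma lift_canonical: "lift canonical_semigroup = T"
  by (simp add: fun_eq_iff lift_def canonical_semigroup_def)

lemma canonical_C0: "C0_semigroup m canonical_semigroup"
  unfolding C0_semigroup_def
proof (intro conjI allI impI ballI)
  note D = c0_semigroupD[OF T_c0]
  show "canonical_semigroup t f \<in> ell2 m" for t f by (simp add: canonical_semigroup_def)
  show "canonical_semigroup t (\<lambda>x. \<alpha> * f x + \<beta> * g x)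
      = (\<lambda>x. \<alpha> * canonical_semigroup t f x + \<beta> * canonical_semigroup t g x)"
    if "0 \<le> t" "f \<in> ell2 m" "g \<in> ell2 m" for t f g \<alpha> \<beta>
  proof -
    interpret L: bounded_linear "T t" by (rule D(1)[OF that(1)])
    show ?thesis
      by (simp add: canonical_semigroup_def ell2_lincomb(2)[OF that(2,3)] L.add L.scaleR prj_lincomb)
  qed
  show "\<exists>C. \<forall>f\<in>ell2 m. ell2_norm m (canonical_semigroup t f) \<le> C * ell2_norm m f" if "0 \<le> t" for t
    by (rule exI[of _ 1]) (simp add: canonical_semigroup_def ell2_norm_emb T_contr that)
  show "canonical_semigroup 0 f = f" if "f \<in> ell2 m" for f
    by (simp add: canonical_semigroup_def D(2) prj_emb that)
  show "canonical_semigroup (s + t) f = canonical_semigroup s (canonical_semigroup t f)"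
    if "0 \<le> s" "0 \<le> t" for s t f
    by (simp add: canonical_semigroup_def D(3) that)
  show "((\<lambda>t. ell2_norm m (\<lambda>x. canonical_semigroup t f x - f x)) \<longlongrightarrow> 0) (at_right 0)" if f: "f \<in> ell2 m" for f
  proof -
    have "ell2_norm m (\<lambda>x. canonical_semigroup t f x - f x) = norm (T t (emb f) - emb f)" for t
      by (simp add: canonical_semigroup_def ell2_norm_emb ell2_diff f)
    moreover have "((\<lambda>t. norm (T t (emb f) - emb f)) \<longlongrightarrow> 0) (at_right 0)"
      using D(4)[of "emb f"] by (simp add: tendsto_norm_zero_iff LIM_zero_iff)
    ultimately show ?thesis by simp
  qed
qed

lemma canonical_generator:
  "semigroup_generator m canonical_semigroup = {(f, \<lambda>x. - g x) | f g. (f, g) \<in> form_operator b m}"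
proof (intro equalityI subsetI)
  fix z assume "z \<in> semigroup_generator m canonical_semigroup"
  then obtain f h where z: "z = (f, h)" and fh: "(f, h) \<in> semigroup_generator m canonical_semigroup" by (cases z) auto
  then have l: "f \<in> ell2 m" "h \<in> ell2 m" by (auto simp: semigroup_generator_def)
  then have "(emb f, emb h) \<in> generator T"
    using lift_generator[OF canonical_C0 l] fh by (simp add: lift_canonical)
  then obtain v where v: "emb f = J 1 v" "emb h = J 1 v - v" unfolding generator_T by auto
  have f: "f = resolvent 1 (prj v)"
  proof -
    have "prj (emb f) = prj (emb (resolvent 1 (prj v)))" by (simp only: v(1) J_def)
    then show ?thesis unfolding prj_emb[OF l(1)] prj_emb[OF resolvent_ell2[OF zero_less_one prj_ell2]] .
  qed
  have op: "(f, \<lambda>x. prj v x - 1 * f x) \<in> form_operator b m"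
    unfolding f by (rule resolvent_operator) simp_all
  have "h = prj (emb h)" by (simp add: prj_emb l)
  also have "emb h = 1 *\<^sub>R emb f + (-1) *\<^sub>R v" by (simp add: v)
  also have "prj (1 *\<^sub>R emb f + (-1) *\<^sub>R v) = (\<lambda>x. - (prj v x - 1 * f x))" unfolding prj_lincomb by (simp add: prj_emb l)
  finally have h: "h = (\<lambda>x. - (prj v x - 1 * f x))" .
  show "z \<in> {(f, \<lambda>x. - g x) | f g. (f, g) \<in> form_operator b m}" unfolding z h
    by (rule CollectI, rule exI[of _ f], rule exI[of _ "\<lambda>x. prj v x - 1 * f x"], rule conjI[OF refl op])
next
  fix z assume "z \<in> {(f, \<lambda>x. - g x) | f g. (f, g) \<in> form_operator b m}"
  then obtain f g where z: "z = (f, \<lambda>x. - g x)" and op: "(f, g) \<in> form_operator b m" by blast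
  note l = form_operatorD(2,4)[OF op]
  have neg: "(\<lambda>x. - g x) \<in> ell2 m" "emb (\<lambda>x. - g x) = - emb g"
    using ell2_lincomb[OF l(2) l(2), of "-1" 0] by simp_all
  have s: "(\<lambda>x. g x + f x) \<in> ell2 m" "emb (\<lambda>x. g x + f x) = emb g + emb f"
    using ell2_lincomb[OF l(2) l(1), of 1 1] by simp_all
  have "resolvent 1 (\<lambda>x. g x + f x) = f" by (rule resolvent_eqI) (simp_all add: op)
  then have "J 1 (emb (\<lambda>x. g x + f x)) = emb f" by (simp add: J_emb s(1))
  then have "(emb f, emb f - emb (\<lambda>x. g x + f x)) \<in> generator T"
    using domain_in_generator[of "emb (\<lambda>x. g x + f x)"] by simp
  then have "(emb f, emb (\<lambda>x. - g x)) \<in> generator (lift canonical_semigroup)"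
    by (simp add: s neg lift_canonical)
  then show "z \<in> semigroup_generator m canonical_semigroup"
    unfolding z using lift_generator[OF canonical_C0 l(1) neg(1)] by simp
qed

lemma heat_semigroup_spec:
  "C0_semigroup m (heat_semigroup b m)"
  "semigroup_generator m (heat_semigroup b m) = {(f, \<lambda>x. - g x) | f g. (f, g) \<in> form_operator b m}"
proof -
  have "C0_semigroup m (heat_semigroup b m) \<and>
    semigroup_generator m (heat_semigroup b m) = {(f, \<lambda>x. - g x) | f g. (f, g) \<in> form_operator b m}"
    unfolding heat_semigroup_def
    by (rule someI[of "\<lambda>S. C0_semigroup m S \<and>
      semigroup_generator m S = {(f, \<lambda>x. - g x) | f g. (f, g) \<in> form_operator b m}" canonical_semigroup])
      (intro conjI canonical_C0 canonical_generator)
  then show "C0_semigroup m (heat_semigroup b m)"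
    "semigroup_generator m (heat_semigroup b m) = {(f, \<lambda>x. - g x) | f g. (f, g) \<in> form_operator b m}" by auto
qed

text \<open>Whatever semigroup the choice operator selects, it has the same generator as the constructed
  one and so agrees with it.\<close>

lemma heat_semigroup_eq:
  assumes t: "0 \<le> t" and f: "f \<in> ell2 m"
  shows "heat_semigroup b m t f = prj (T t (emb f))"
proof -
  have "lift (heat_semigroup b m) t (emb f) = T t (emb f)"
  proof (rule c0_semigroup_unique[OF lift_c0_semigroup[OF heat_semigroup_spec(1)] T_c0 _ _ _ t])
    have "(v, w) \<in> generator (lift (heat_semigroup b m)) \<longleftrightarrow> (v, w) \<in> generator T" for v w
      using lift_generator[OF heat_semigroup_spec(1) prj_ell2 prj_ell2, of v w]
        lift_generator[OF canonical_C0 prj_ell2 prj_ell2, of v w]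
      by (simp add: lift_canonical heat_semigroup_spec(2) canonical_generator)
    then show "generator (lift (heat_semigroup b m)) = generator T" by auto
    show "inner w v \<le> 0" if "(v, w) \<in> generator T" for v w
      by (rule contraction_generator_dissipative[OF T_contr that])
    show "\<exists>F. (\<forall>n. F n \<in> Domain (generator T)) \<and> F \<longlonglongrightarrow> v" for v
    proof -
      obtain F where F: "\<And>n. F n \<in> range (J 1)" "F \<longlonglongrightarrow> v" using domain_dense[of v] by blast
      have "F n \<in> Domain (generator T)" for n
      proof -
        obtain g where "F n = J 1 g" using F(1)[of n] by blast
        then show ?thesis using DomainI[OF domain_in_generator[of g]] by simp
      qed
      then show ?thesis using F(2) by blast
    qed
  qed
  then have "prj (emb (heat_semigroup b m t f)) = prj (T t (emb f))" by (simp add: lift_def prj_emb f)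
  then show ?thesis by (simp add: prj_emb C0_semigroupD(1)[OF heat_semigroup_spec(1) t f])
qed

lemma K_iterate_markov:
  assumes f: "f \<in> ell2 m" and f0: "\<And>x. 0 \<le> f x"
  obtains h where "h \<in> ell2 m" "(K n ^^ k) (emb f) = emb h" "\<And>x. 0 \<le> h x"
    "\<And>c x. (\<And>y. f y \<le> c) \<Longrightarrow> h x \<le> c"
proof -
  have "\<exists>h. h \<in> ell2 m \<and> (K n ^^ k) (emb f) = emb h \<and> (\<forall>x. 0 \<le> h x) \<and> (\<forall>c. (\<forall>y. f y \<le> c) \<longrightarrow> (\<forall>x. h x \<le> c))"
  proof (induction k)
    case 0
    then show ?case using f f0 by auto
  next
    case (Suc k)
    then obtain h where h: "h \<in> ell2 m" "(K n ^^ k) (emb f) = emb h" "\<And>x. 0 \<le> h x"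
      "\<And>c. (\<forall>y. f y \<le> c) \<Longrightarrow> \<forall>x. h x \<le> c" by blast
    define a where "a = real (Suc n)"
    have a: "0 < a" by (simp add: a_def)
    note rl = resolvent_ell2[OF a h(1)]
    note M = resolvent_markov[OF a h(1) h(3)]
    have "(K n ^^ Suc k) (emb f) = a *\<^sub>R J a (emb h)" by (simp add: h(2) K_def a_def)
    also have "\<dots> = emb (\<lambda>x. a * resolvent a h x + 0 * resolvent a h x)"
      unfolding ell2_lincomb(2)[OF rl rl] by (simp add: J_emb h(1))
    finally have 1: "(K n ^^ Suc k) (emb f) = emb (\<lambda>x. a * resolvent a h x)" by simp
    have 2: "(\<lambda>x. a * resolvent a h x) \<in> ell2 m" using ell2_lincomb(1)[OF rl rl, of a 0] by simp
    show ?case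
    proof (intro exI[of _ "\<lambda>x. a * resolvent a h x"] conjI allI impI 1 2)
      show "0 \<le> a * resolvent a h x" for x using M(1) a by simp
      show "a * resolvent a h x \<le> c" if "\<forall>y. f y \<le> c" for c x
        by (rule M(2)) (use h(4)[OF that] in blast)
    qed
  qed
  then show thesis using that by blast
qed

lemma T_markov:
  assumes f: "f \<in> ell2 m" and f0: "\<And>x. 0 \<le> f x" and t: "0 \<le> t"
  shows "0 \<le> coord (T t (emb f)) x" "(\<And>y. f y \<le> c) \<Longrightarrow> coord (T t (emb f)) x \<le> sqrt (m x) * c"
proof -
  have "- coord (T t (emb f)) x \<le> 0"
  proof (rule T_functional_bound[OF _ _ t])
    show "bounded_linear (\<lambda>v. - coord v x)" by (intro bounded_linear_minus bounded_linear_coord)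
    fix n k
    obtain h where "h \<in> ell2 m" "(K n ^^ k) (emb f) = emb h" "\<And>x. 0 \<le> h x"
      using K_iterate_markov[OF f f0] by metis
    then show "- coord ((K n ^^ k) (emb f)) x \<le> 0" by (simp add: coord_emb)
  qed
  then show "0 \<le> coord (T t (emb f)) x" by simp
  assume c: "\<And>y. f y \<le> c"
  show "coord (T t (emb f)) x \<le> sqrt (m x) * c"
  proof (rule T_functional_bound[OF bounded_linear_coord _ t])
    fix n k
    obtain h where "h \<in> ell2 m" "(K n ^^ k) (emb f) = emb h" "\<And>x. h x \<le> c"
      using K_iterate_markov[OF f f0] c by metis
    then show "coord ((K n ^^ k) (emb f)) x \<le> sqrt (m x) * c" by (simp add: coord_emb mult_left_mono)
  qed
qed

lemma heat_markov:
  assumes f: "f \<in> ell2 m" and f0: "\<And>x. 0 \<le> f x" and t: "0 \<le> t"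
  shows "0 \<le> heat_semigroup b m t f x" "(\<And>y. f y \<le> c) \<Longrightarrow> heat_semigroup b m t f x \<le> c"
  using T_markov[OF f f0 t, where x = x] by (simp_all add: heat_semigroup_eq[OF t f] prj_def pos_divide_le_eq m_pos mult.commute)

lemma heat_mono:
  assumes f: "f \<in> ell2 m" and g: "g \<in> ell2 m" and le: "\<And>x. f x \<le> g x" and t: "0 \<le> t"
  shows "heat_semigroup b m t f x \<le> heat_semigroup b m t g x"
proof -
  have "0 \<le> heat_semigroup b m t (\<lambda>x. 1 * g x + (-1) * f x) x"
    by (rule heat_markov(1)[OF ell2_lincomb(1)[OF g f] _ t]) (simp add: le)
  then show ?thesis unfolding C0_semigroupD(2)[OF heat_semigroup_spec(1) t g f] by simp
qed

text \<open>With \<open>g = (L + 1)\<^sup>-\<^sup>1 f\<close>, the derivative of \<open>e\<^sup>-\<^sup>s e\<^sup>-\<^sup>s\<^sup>L g\<close> is \<open>- e\<^sup>-\<^sup>s e\<^sup>-\<^sup>s\<^sup>L f\<close>, which is at least \<open>- e\<^sup>-\<^sup>s\<close> as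
  \<open>f \<le> 1\<close>.\<close>

lemma heat_resolvent_lower_bound:
  assumes f: "f \<in> ell2 m" and f0: "\<And>x. 0 \<le> f x" and f1: "\<And>x. f x \<le> 1" and t: "0 \<le> t"
  shows "exp (- t) * heat_semigroup b m t (resolvent 1 f) x \<ge> resolvent 1 f x - (1 - exp (- t))"
proof -
  define v where "v = emb f"
  have J1: "J 1 v = emb (resolvent 1 f)" by (simp add: v_def J_emb f)
  have rl: "resolvent 1 f \<in> ell2 m" by (simp add: resolvent_ell2 f)
  define \<phi> where "\<phi> s = exp (- s) * coord (T s (J 1 v)) x - exp (- s) * sqrt (m x)" for s
  have der: "((\<lambda>s. coord (T s (J 1 v)) x) has_real_derivative coord (T s (J 1 v)) x - coord (T s v) x) (at s within {0..})"
    if s: "0 \<le> s" for s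
  proof -
    have "((\<lambda>s. T s (J 1 v)) has_vector_derivative T s (J 1 v - v)) (at s within {0..})"
      by (rule orbit_derivative[OF T_c0 domain_in_generator s])
    then have "((\<lambda>s. coord (T s (J 1 v)) x) has_vector_derivative coord (T s (J 1 v - v)) x) (at s within {0..})"
      by (rule bounded_linear.has_vector_derivative[OF bounded_linear_coord])
    moreover have "T s (J 1 v - v) = T s (J 1 v) - T s v"
      by (rule linear_diff[OF bounded_linear.linear[OF T_linear[OF s]]])
    ultimately show ?thesis by (simp add: has_real_derivative_iff_has_vector_derivative)
  qed
  have \<phi>der: "(\<phi> has_real_derivative exp (- s) * (sqrt (m x) - coord (T s v) x)) (at s within {0..})" if s: "0 \<le> s" for s
    unfolding \<phi>_def by (auto intro!: derivative_eq_intros der[OF s] simp: algebra_simps)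
  have "\<phi> 0 \<le> \<phi> t"
  proof (rule DERIV_nonneg_imp_increasing_open[of 0 t \<phi>, OF t])
    fix s assume s: "0 < s" "s < t"
    have "(\<phi> has_real_derivative exp (- s) * (sqrt (m x) - coord (T s v) x)) (at s within {0<..})"
      by (rule DERIV_subset[OF \<phi>der]) (use s in auto)
    then have "(\<phi> has_real_derivative exp (- s) * (sqrt (m x) - coord (T s v) x)) (at s)"
      using at_within_open[of s "{0<..}"] s by simp
    moreover have "0 \<le> exp (- s) * (sqrt (m x) - coord (T s v) x)"
      using T_markov(2)[OF f f0, of s 1 x] s f1 by (simp add: v_def)
    ultimately show "\<exists>y. (\<phi> has_real_derivative y) (at s) \<and> 0 \<le> y" by blast
  next
    have "continuous_on {0..} \<phi>"
      unfolding continuous_on_eq_continuous_within by (auto intro: DERIV_continuous[OF \<phi>der])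
    then show "continuous_on {0..t} \<phi>" by (rule continuous_on_subset) auto
  qed
  moreover have "coord (T s (J 1 v)) x = sqrt (m x) * heat_semigroup b m s (resolvent 1 f) x" if "0 \<le> s" for s
    unfolding J1 heat_semigroup_eq[OF that rl] prj_def by simp
  moreover have "heat_semigroup b m 0 (resolvent 1 f) = resolvent 1 f"
    by (rule C0_semigroupD(4)[OF heat_semigroup_spec(1) rl])
  ultimately have "sqrt (m x) * (resolvent 1 f x - 1)
      \<le> sqrt (m x) * (exp (- t) * heat_semigroup b m t (resolvent 1 f) x - exp (- t))"
    using t by (simp add: \<phi>_def algebra_simps)
  then have "resolvent 1 f x - 1 \<le> exp (- t) * heat_semigroup b m t (resolvent 1 f) x - exp (- t)"
    by (rule mult_left_le_imp_le) (simp add: m_pos)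
  then show ?thesis by linarith
qed

lemma heat_continuous:
  assumes t: "0 \<le> t" and f: "\<And>n. f n \<in> ell2 m" and g: "g \<in> ell2 m" and lim: "(\<lambda>n. emb (f n)) \<longlonglongrightarrow> emb g"
  shows "(\<lambda>n. heat_semigroup b m t (f n) x) \<longlonglongrightarrow> heat_semigroup b m t g x"
  unfolding heat_semigroup_eq[OF t f] heat_semigroup_eq[OF t g] prj_def
  by (intro tendsto_divide tendsto_const bounded_linear.tendsto[OF bounded_linear_coord]
      bounded_linear.tendsto[OF T_linear[OF t]] lim) simp

text \<open>Test with the indicator of a point: the form operator acts as the formal Laplacian.\<close>

lemma form_operator_pointwise:
  assumes op: "(u, g) \<in> form_operator b m"
  shows "laplacian u x = m x * g x"
proof -
  define h where "h y = (if y = x then 1 else 0 :: real)" for y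
  have h: "h \<in> finitely_supported" by (simp add: finitely_supported_def h_def)
  note D = form_operatorD[OF op]
  have he: "h \<in> finite_energy b" by (rule finitely_supported_finite_energy[OF h])
  have "laplacian u x = energy_form b u h"
    using green_formula[OF D(3), of "{x}" h] by (simp add: h_def)
  also have "\<dots> = inner (emb g) (emb h)"
    unfolding energy_form_grad[OF D(3) he] by (rule D(5)[OF finitely_supported_form_domain[OF h]])
  also have "\<dots> = m x * g x" using ell2_inner_finite[OF D(4), of "{x}" h] by (simp add: h_def)
  finally show ?thesis .
qed

end

theorem theorem1p1:
  fixes b d :: "'a::countable \<Rightarrow> 'a \<Rightarrow> real" and m :: "'a \<Rightarrow> real" and p :: 'a
  assumes "\<And>x. 0 < m x"
    and "weighted_graph b"
    and "pseudo_metric d"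
    and "intrinsic b m d"
    and "\<And>r. 0 \<le> r \<Longrightarrow> finite (dist_ball d p r)"
    and "(\<integral>\<^sup>+ r\<in>{1..}. ennreal (r / log_sharp (mass_of m (dist_ball d p r))) \<partial>lborel) = \<infinity>"
  shows "stochastically_complete b m"
proof -
  interpret intrinsic_graph b m d p
    by unfold_locales (use assms in auto)
  define e where "e n x = (if x \<in> exhaustion n then 1 else 0 :: real)" for n and x :: 'a
  have e: "e n \<in> ell2 m" "0 \<le> e n x" "e n x \<le> 1" for n x
  proof -
    have "{x. e n x \<noteq> 0} \<subseteq> exhaustion n" by (auto simp: e_def)
    then have "e n \<in> finitely_supported"
      unfolding finitely_supported_def using finite_exhaustion finite_subset by blast
    then show "e n \<in> ell2 m" by (rule finitely_supported_ell2)
  qed (auto simp: e_def)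
  have e_inc: "incseq (\<lambda>n. e n x)" for x by (rule incseq_SucI) (simp add: e_def exhaustion_def)
  have e_lim: "(\<lambda>n. e n x) \<longlonglongrightarrow> 1" for x
  proof (rule tendsto_eventually)
    show "\<forall>\<^sub>F n in sequentially. e n x = 1"
      using eventually_gt_at_top[of "to_nat x"] by eventually_elim (simp add: e_def exhaustion_def)
  qed
  define g where "g n = resolvent 1 (e n)" for n
  have g: "g n \<in> ell2 m" "0 \<le> g n x" "g n x \<le> 1" for n x
  proof -
    show "g n \<in> ell2 m" unfolding g_def by (rule resolvent_ell2[OF zero_less_one e(1)])
    show "0 \<le> g n x" unfolding g_def by (rule resolvent_markov(1)[OF zero_less_one e(1) e(2)])
    show "g n x \<le> 1"
      using resolvent_markov(2)[OF zero_less_one e(1) e(2) e(3), of n x] by (simp add: g_def)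
  qed
  have g_inc: "g n x \<le> g (Suc n) x" for n x
  proof -
    have "0 \<le> resolvent 1 (\<lambda>x. 1 * e (Suc n) x + (-1) * e n x) x"
      by (rule resolvent_markov(1)[OF zero_less_one ell2_lincomb(1)[OF e(1) e(1)]])
        (use e_inc in \<open>simp add: incseq_Suc_iff\<close>)
    then show ?thesis unfolding resolvent_lincomb[OF zero_less_one e(1) e(1)] by (simp add: g_def)
  qed
  have "convergent (\<lambda>n. g n x)" for x
    by (rule Bseq_mono_convergent[OF BseqI'[where K = 1]])
      (use g g_inc in \<open>auto intro: lift_Suc_mono_le[of "\<lambda>n. g n x"]\<close>)
  then obtain w where w: "\<And>x. (\<lambda>n. g n x) \<longlonglongrightarrow> w x" unfolding convergent_def by metis
  have w01: "0 \<le> w x" "w x \<le> 1" for x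
    using LIMSEQ_le_const[OF w] LIMSEQ_le_const2[OF w] g by blast+
  have "1 - w x = 0" for x
  proof (rule bounded_subharmonic_zero[OF assms(6)])
    show "0 \<le> 1 - w x" "1 - w x \<le> 1" for x using w01 by simp_all
    fix x
    have L1: "(\<lambda>n. laplacian (g n) x) \<longlonglongrightarrow> (\<Sum>\<^sub>\<infinity>y. b x y * (w x - w y))"
      unfolding laplacian_def
    proof (rule infsum_dominated_convergence[OF b_summable])
      fix n y
      have "\<bar>g n x - g n y\<bar> \<le> 1" using g(2,3)[of n x] g(2,3)[of n y] by linarith
      then show "\<bar>b x y * (g n x - g n y)\<bar> \<le> b x y" by (simp add: abs_mult mult_left_le)
    qed (intro tendsto_intros w)
    have L2: "laplacian (g n) x = m x * (e n x - 1 * g n x)" for n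
      using form_operator_pointwise[OF resolvent_operator[OF zero_less_one e(1)]] by (simp add: g_def)
    have "(\<lambda>n. m x * (e n x - 1 * g n x)) \<longlonglongrightarrow> m x * (1 - 1 * w x)"
      by (intro tendsto_intros e_lim w)
    then have "m x * (1 - 1 * w x) = (\<Sum>\<^sub>\<infinity>y. b x y * (w x - w y))"
      by (rule LIMSEQ_unique) (rule L1[unfolded L2])
    then show "m x * (1 - w x) \<le> (\<Sum>\<^sub>\<infinity>y. b x y * ((1 - w y) - (1 - w x)))"
      by (simp add: algebra_simps)
  qed
  then have g_lim: "(\<lambda>n. g n x) \<longlonglongrightarrow> 1" for x using w[of x] by simp
  have "heat_semigroup_bounded b m t (\<lambda>_. 1) = (\<lambda>_. 1)" if "0 < t" for t
  proof -
    have t: "0 \<le> t" using that by simp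
    have main: "(\<lambda>n. heat_semigroup b m t (F n) x) \<longlonglongrightarrow> 1"
      if F: "\<And>n. F n \<in> ell2 m" "\<And>n x. 0 \<le> F n x"
        and inc: "\<And>x. incseq (\<lambda>n. F n x)" and lim: "\<And>x. (\<lambda>n. F n x) \<longlonglongrightarrow> 1" for F x
    proof -
      have F1: "F n x \<le> 1" for n x by (rule incseq_le[OF inc lim])
      have le1: "heat_semigroup b m t (F n) x \<le> 1" for n by (rule heat_markov(2)[OF F t F1])
      have "convergent (\<lambda>n. heat_semigroup b m t (F n) x)"
      proof (rule Bseq_mono_convergent[OF BseqI'[where K = 1]])
        show "norm (heat_semigroup b m t (F n) x) \<le> 1" for n
          using le1[of n] heat_markov(1)[OF F t, of n x] by simp
        show "\<forall>i. \<forall>j\<ge>i. heat_semigroup b m t (F i) x \<le> heat_semigroup b m t (F j) x"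
          using inc by (auto intro!: heat_mono F t simp: incseq_def)
      qed
      then obtain l where l: "(\<lambda>n. heat_semigroup b m t (F n) x) \<longlonglongrightarrow> l" unfolding convergent_def by blast
      have "l \<le> 1" by (rule LIMSEQ_le_const2[OF l]) (use le1 in blast)
      \<comment> \<open>\<open>min (F n) (g k)\<close> lies below \<open>F n\<close> and tends to \<open>g k\<close> in \<open>\<ell>\<^sup>2\<close>, whereas \<open>F n\<close> converges only pointwise\<close>
      have below: "heat_semigroup b m t (g k) x \<le> l" for k
      proof (rule LIMSEQ_le[OF _ l])
        have dom: "(\<lambda>x. min (F n x) (g k x)) \<in> ell2 m" for n
          by (rule ell2_dominated[OF g(1)[of k]]) (use F(2) g(2) in \<open>auto simp: min_def\<close>)
        show "(\<lambda>n. heat_semigroup b m t (\<lambda>x. min (F n x) (g k x)) x) \<longlonglongrightarrow> heat_semigroup b m t (g k) x"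
        proof (rule heat_continuous[OF t dom g(1)])
          show "(\<lambda>n. emb (\<lambda>x. min (F n x) (g k x))) \<longlonglongrightarrow> emb (g k)"
          proof (rule emb_dominated_convergence(2)[OF g(1)[of k]])
            show "\<bar>min (F n x) (g k x)\<bar> \<le> \<bar>g k x\<bar>" for n x using F(2)[of n x] g(2)[of k x] by (simp add: min_def)
            show "(\<lambda>n. min (F n x) (g k x)) \<longlonglongrightarrow> g k x" for x
            proof -
              have "(\<lambda>n. min (F n x) (g k x)) \<longlonglongrightarrow> min 1 (g k x)" by (intro tendsto_intros lim)
              then show ?thesis by (simp only: min_absorb2[OF g(3)])
            qed
          qed
        qed
        show "\<exists>N. \<forall>n\<ge>N. heat_semigroup b m t (\<lambda>x. min (F n x) (g k x)) x \<le> heat_semigroup b m t (F n) x"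
          by (intro exI allI impI heat_mono dom F t) simp
      qed
      have "g k x - (1 - exp (- t)) \<le> exp (- t) * l" for k
      proof -
        have "g k x - (1 - exp (- t)) \<le> exp (- t) * heat_semigroup b m t (g k) x"
          unfolding g_def by (rule heat_resolvent_lower_bound[OF e t])
        also have "\<dots> \<le> exp (- t) * l" by (intro mult_left_mono below) simp
        finally show ?thesis .
      qed
      moreover have "(\<lambda>k. g k x - (1 - exp (- t))) \<longlonglongrightarrow> 1 - (1 - exp (- t))" by (intro tendsto_intros g_lim)
      ultimately have "1 - (1 - exp (- t)) \<le> exp (- t) * l" by (intro LIMSEQ_le_const2) auto
      then have "1 \<le> l" by simp
      with \<open>l \<le> 1\<close> l show ?thesis by simp
    qed
    show ?thesis unfolding heat_semigroup_bounded_def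
    proof (rule the_equality)
      show "\<forall>F :: nat \<Rightarrow> 'a \<Rightarrow> real. (\<forall>n. F n \<in> ell2 m \<and> (\<forall>x. 0 \<le> F n x)) \<longrightarrow>
        (\<forall>x. incseq (\<lambda>n. F n x) \<and> (\<lambda>n. F n x) \<longlonglongrightarrow> 1) \<longrightarrow>
        (\<forall>x. (\<lambda>n. heat_semigroup b m t (F n) x) \<longlonglongrightarrow> (\<lambda>_. 1) x)"
        using main by blast
      fix u :: "'a \<Rightarrow> real"
      assume u: "\<forall>F :: nat \<Rightarrow> 'a \<Rightarrow> real. (\<forall>n. F n \<in> ell2 m \<and> (\<forall>x. 0 \<le> F n x)) \<longrightarrow>
        (\<forall>x. incseq (\<lambda>n. F n x) \<and> (\<lambda>n. F n x) \<longlonglongrightarrow> 1) \<longrightarrow>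
        (\<forall>x. (\<lambda>n. heat_semigroup b m t (F n) x) \<longlonglongrightarrow> u x)"
      have "(\<lambda>n. heat_semigroup b m t (e n) x) \<longlonglongrightarrow> u x" for x
        using u[rule_format, of e] e e_inc e_lim by blast
      moreover have "(\<lambda>n. heat_semigroup b m t (e n) x) \<longlonglongrightarrow> 1" for x
        by (rule main[OF e(1) e(2) e_inc e_lim])
      ultimately have "u x = 1" for x by (rule LIMSEQ_unique)
      then show "u = (\<lambda>_. 1)" by auto
    qed
  qed
  then show ?thesis by (simp add: stochastically_complete_def)
qed

end
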